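(* Let $q$ be a prime power and $f_1=t-1$. For a $\Phi^*$-colored partition $\tilde{\boldsymbol\lambda}\in\mathcal P^{\Phi^*}$ (of finite weight) and a positive integer $k$, $$Q^*_k(f_1)\prod_{\phi\in\Phi^*}S_{\tilde{\boldsymbol\lambda}(\phi)}(\phi).1=\sum_{\tilde{\boldsymbol\tau}\subset\underline{\tilde{\boldsymbol\lambda}}}\mathcal A(q;\tilde{\boldsymbol\tau})\,(-1)^{\|\tilde{\boldsymbol\tau}\|}\prod_{\phi\in\Phi^*}S_{\tilde{\boldsymbol\lambda}(\phi)-\tilde{\boldsymbol\tau}(\phi)}(\phi)\;Q^*_{k-\|\tilde{\boldsymbol\tau}\|}(f_1).1,$$ where the sum is over all $\Phi^*$-colored compositions $\tilde{\boldsymbol\tau}$ such that, for each $\phi\in\Phi^*$, $\tilde{\boldsymbol\tau}(\phi)$ has exactly $l(\tilde{\boldsymbol\lambda}(\phi))$ parts, all of them positive, and $\tilde{\boldsymbol\tau}(\phi)\subset\underline{\tilde{\boldsymbol\lambda}(\phi)}$; and $$\mathcal A(q;\tilde{\boldsymbol\tau})=\prod_{\phi\in\Phi^*}\prod_{i=1}^{l(\tilde{\boldsymbol\tau}(\phi))}A(q^{|\phi|};\tilde{\boldsymbol\tau}(\phi)_i).$$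
   Context: $M_n=\mathbb F_{q^n}^\times\subset M=\overline{\mathbb F}_q^\times$; $M_n^*$ is the group of complex characters of $M_n$, with $M_m^*\subset M_n^*$ for $m\mid n$ (via the norm map); $M^*=\bigcup_n M_n^*$. The Frobenius $x\mapsto x^q$ acts on $M$ and $M^*$; $\Phi$ and $\Phi^*$ are the sets of its orbits in $M$ and $M^*$. Elements of $\Phi$ are identified with monic irreducible polynomials $f\ne t$ over $\mathbb F_q$, $|f|=\deg f$; $|\phi|$ is the size of $\phi\in\Phi^*$. $\mathcal F_G=\bigotimes_{\phi\in\Phi^*}\mathbb C[p_n(\phi):n\ge1]$ is the polynomial algebra on independent generators $p_n(\phi)$. For $f\in\Phi$ with root $x$, $$p_n(f)=\frac{(-1)^{n|f|-1}}{q^{n|f|}-1}\sum_{\xi\in M^*_{n|f|}}\overline{\xi(x)}\,p_{n|f|/|\phi_\xi|}(\phi_\xi),$$ where $\phi_\xi$ is the orbit of $\xi$. The $p_n(f)$ ($n\ge1,f\in\Phi$) are also algebraically independent generators of $\mathcal F_G$. In particular $p_n(f_1)=\frac{(-1)^{n-1}}{q^n-1}\sum_{|\phi|\,\mid\, n}|\phi|\,p_{n/|\phi|}(\phi)$. Here $\partial/\partial p_n(\phi)$ is taken with respect to the generators indexed by $\Phi^*$ and $\partial/\partial p_n(f)$ with respect to the generators indexed by $\Phi$; $p_n(\phi),p_n(f)$ act by multiplication. The operators $S_n(\phi)$, $Q_n^*(f_1)\in\mathrm{End}(\mathcal F_G)$, $n\in\mathbb Z$, are defined by $$\sum_{n\in\mathbb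 Z}S_n(\phi)z^n=\exp\Big(\sum_{n\ge1}\tfrac1n p_n(\phi)z^n\Big)\exp\Big(-\sum_{n\ge1}\tfrac{\partial}{\partial p_n(\phi)}z^{-n}\Big),$$ $$\sum_{n\in\mathbb Z}Q_n^*(f_1)z^{-n}=\exp\Big(-\sum_{n\ge1}\tfrac{1-q^{-n}}{n}p_n(f_1)z^n\Big)\exp\Big(\sum_{n\ge1}\tfrac{\partial}{\partial p_n(f_1)}z^{-n}\Big).$$ For an integer sequence $\alpha=(\alpha_1,\dots,\alpha_l)$, $S_\alpha(\phi)=S_{\alpha_1}(\phi)\cdots S_{\alpha_l}(\phi)$ (identity if $l=0$); operators of different colors $\phi\ne\psi$ commute. "$X.1$" denotes the operator $X$ applied to $1\in\mathcal F_G$. A $\Phi^*$-colored partition (resp. composition) is a map from $\Phi^*$ to partitions (resp. compositions), with weight $\|\tilde{\boldsymbol\lambda}\|=\sum_\phi|\phi||\tilde{\boldsymbol\lambda}(\phi)|$ finite. For a partition $\lambda=(\lambda_1,\dots,\lambda_l)$ with $l=l(\lambda)$ nonzero parts, $\underline\lambda=(\lambda_1+l,\lambda_2+l-1,\dots,\lambda_l+1)$; $\underline{\tilde{\boldsymbol\lambda}}(\phi)=\underline{\tilde{\boldsymbol\lambda}(\phi)}$. For compositions, $\tau\subset\mu$ means $\tau_i\le\mu_i$ for all $i$. Further, $$A(q^{|\phi|};i)=\begin{cases} q^{i|\phi|}(q^{-|\phi|}-1), & i>1,\\ -q^{|\phi|}, & i=1.\end{cases}$$ *)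

theory Defs
  imports
    Complex_Main
    "HOL-Library.Cardinality"
    "HOL-Library.Poly_Mapping"
    "HOL-Library.Groups_Big_Fun"
    "HOL-Algebra.Algebraic_Closure_Type"
begin

text \<open>
  The finite field with \<open>q\<close> elements is a type \<open>'a :: finite_field\<close>, so \<open>q = CARD('a)\<close>; its algebraic
  closure is the library type \<open>'a alg_closure\<close>.
\<close>

subsection \<open>The groups of units and their characters\<close>

text \<open>The subfield with \<open>q ^ n\<close> elements of the algebraic closure consists of the \<open>x\<close> with
  \<open>x ^ (q ^ n) = x\<close>.\<close>

definition units_level :: "nat \<Rightarrow> 'a::finite_field alg_closure set" where
  "units_level n = {x. x \<noteq> 0 \<and> x ^ (CARD('a) ^ n) = x}"

text \<open>Characters are extended by \<open>0\<close>, so that each one is represented by exactly one function.\<close>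

definition characters :: "nat \<Rightarrow> ('a::finite_field alg_closure \<Rightarrow> complex) set" where
  "characters n = {\<xi>. (\<forall>x\<in>units_level n. \<xi> x \<noteq> 0) \<and>
     (\<forall>x\<in>units_level n. \<forall>y\<in>units_level n. \<xi> (x * y) = \<xi> x * \<xi> y) \<and>
     (\<forall>x. x \<notin> units_level n \<longrightarrow> \<xi> x = 0)}"

text \<open>\<open>norm_map n m\<close> is the norm from level \<open>n\<close> to level \<open>m\<close>, for \<open>m dvd n\<close>: the product of the
  conjugates over the field with \<open>q ^ m\<close> elements.\<close>

definition norm_map :: "nat \<Rightarrow> nat \<Rightarrow> 'a::finite_field alg_closure \<Rightarrow> 'a alg_closure" where
  "norm_map n m x = (\<Prod>i<n div m. x ^ (CARD('a) ^ (m * i)))"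

text \<open>The union of the character groups is their direct limit along inflation by the norm maps: two
  characters are identified if their inflations to some common level agree.\<close>

fun same_character ::
  "nat \<times> ('a::finite_field alg_closure \<Rightarrow> complex) \<Rightarrow> nat \<times> ('a alg_closure \<Rightarrow> complex) \<Rightarrow> bool" where
  "same_character (m, \<xi>) (n, \<eta>) \<longleftrightarrow>
     0 < m \<and> 0 < n \<and> \<xi> \<in> characters m \<and> \<eta> \<in> characters n \<and>
     (\<exists>k>0. m dvd k \<and> n dvd k \<and> (\<forall>x\<in>units_level k. \<xi> (norm_map k m x) = \<eta> (norm_map k n x)))"

lemma norm_map_trans:
  fixes x :: "'a::finite_field alg_closure"
  assumes "0 < k" "m dvd n" "n dvd k"
  shows "norm_map n m (norm_map k n x) = norm_map k m x"
proof -
  have prod_split: "(\<Prod>l<c + d. g l) = (\<Prod>l<c. g l) * (\<Prod>i<d. g (c + i))"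
    for g :: "nat \<Rightarrow> 'a alg_closure" and c d
    by (induction d) (simp_all add: mult.assoc)
  obtain a where a: "n = m * a" using assms(2) by auto
  obtain b where b: "k = n * b" using assms(3) by auto
  have pos: "0 < a" "0 < n" "0 < m" using assms(1) a b by auto
  let ?q = "CARD('a)"
  have "norm_map n m (norm_map k n x) = (\<Prod>i<a. \<Prod>j<b. x ^ (?q ^ (m * (j * a + i))))"
  proof -
    have "(x ^ (?q ^ (n * j))) ^ (?q ^ (m * i)) = x ^ (?q ^ (m * (j * a + i)))" for i j
      by (simp add: a algebra_simps flip: power_mult power_add)
    then show ?thesis
      using pos by (simp add: norm_map_def prod_power_distrib b) (simp add: a)
  qed
  also have "\<dots> = (\<Prod>j<b. \<Prod>i<a. x ^ (?q ^ (m * (j * a + i))))"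
    by (rule prod.swap)
  also have "\<dots> = (\<Prod>l<b * a. x ^ (?q ^ (m * l)))"
  proof (induction b)
    case (Suc b)
    have "(\<Prod>l<a + b * a. x ^ (?q ^ (m * l))) =
      (\<Prod>l<b * a. x ^ (?q ^ (m * l))) * (\<Prod>i<a. x ^ (?q ^ (m * (b * a + i))))"
      using prod_split[of "\<lambda>l. x ^ (?q ^ (m * l))" "b * a" a] by (simp add: add.commute)
    then show ?case using Suc by simp
  qed simp
  also have "\<dots> = norm_map k m x"
    using pos by (simp add: norm_map_def a b mult.assoc mult.commute)
  finally show ?thesis .
qed

lemma norm_map_in_units_level:
  fixes x :: "'a::finite_field alg_closure"
  assumes "0 < k" "n dvd k" "x \<in> units_level k"
  shows "norm_map k n x \<in> units_level n"
proof -
  obtain b where b: "k = n * b" using assms(2) by auto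
  have pos: "0 < b" "0 < n" using assms(1) b by auto
  let ?q = "CARD('a)"
  let ?g = "\<lambda>i. x ^ (?q ^ (n * i))"
  have x: "x \<noteq> 0" "?g b = x" using assms(3) b by (auto simp: units_level_def)
  have "norm_map k n x = (\<Prod>i<b. ?g i)"
    using pos b by (simp add: norm_map_def)
  moreover have "(\<Prod>i<b. ?g i) ^ (?q ^ n) = (\<Prod>i<b. ?g (Suc i))"
    by (simp add: prod_power_distrib add.commute flip: power_mult power_add)
  moreover have "x * (\<Prod>i<b. ?g (Suc i)) = x * (\<Prod>i<b. ?g i)"
  proof -
    have "?g 0 * (\<Prod>i<b. ?g (Suc i)) = (\<Prod>i<Suc b. ?g i)"
      by (rule prod.lessThan_Suc_shift[symmetric])
    also have "\<dots> = (\<Prod>i<b. ?g i) * ?g b" by (rule prod.lessThan_Suc)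
    also have "\<dots> = x * (\<Prod>i<b. ?g i)" by (subst x(2)) (rule mult.commute)
    finally show ?thesis by simp
  qed
  ultimately show ?thesis using x(1) by (simp add: units_level_def)
qed

quotient_type (overloaded) 'a dual =
  "nat \<times> ('a::finite_field alg_closure \<Rightarrow> complex)" / partial: same_character
proof (rule part_equivpI)
  have "(\<lambda>x. if x \<in> units_level 1 then 1 else 0) \<in>
      (characters 1 :: ('a alg_closure \<Rightarrow> complex) set)"
    by (simp add: characters_def units_level_def power_mult_distrib)
  then have "same_character (1, \<lambda>x. if x \<in> units_level 1 then 1 else 0)
      (1, (\<lambda>x. if x \<in> units_level 1 then 1 else 0) :: 'a alg_closure \<Rightarrow> complex)"
    unfolding same_character.simps by (metis one_dvd zero_less_one)
  then show "\<exists>c :: nat \<times> ('a alg_closure \<Rightarrow> complex). same_character c c" by blast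
  show "symp (same_character :: nat \<times> ('a alg_closure \<Rightarrow> complex) \<Rightarrow> _)"
  proof (rule sympI)
    fix c d :: "nat \<times> ('a alg_closure \<Rightarrow> complex)"
    assume "same_character c d"
    then show "same_character d c"
      by (cases c; cases d) (simp only: same_character.simps, metis)
  qed
  show "transp (same_character :: nat \<times> ('a alg_closure \<Rightarrow> complex) \<Rightarrow> _)"
  proof (rule transpI)
    fix c d e :: "nat \<times> ('a alg_closure \<Rightarrow> complex)"
    assume cd: "same_character c d" and de: "same_character d e"
    obtain m \<xi> n \<eta> l \<theta> where eqs: "c = (m, \<xi>)" "d = (n, \<eta>)" "e = (l, \<theta>)"
      by (metis surj_pair)
    from cd obtain k where k: "k > 0" "m dvd k" "n dvd k"
      "\<And>x. x \<in> units_level k \<Longrightarrow> \<xi> (norm_map k m x) = \<eta> (norm_map k n x)"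
      by (auto simp: eqs)
    from de obtain k' where k': "k' > 0" "n dvd k'" "l dvd k'"
      "\<And>x. x \<in> units_level k' \<Longrightarrow> \<eta> (norm_map k' n x) = \<theta> (norm_map k' l x)"
      by (auto simp: eqs)
    define K where "K = k * k'"
    have K: "K > 0" "k dvd K" "k' dvd K" using k k' by (auto simp: K_def)
    have "\<xi> (norm_map K m x) = \<theta> (norm_map K l x)" if "x \<in> units_level K" for x
      using k(4)[OF norm_map_in_units_level[OF K(1,2) that]]
        k'(4)[OF norm_map_in_units_level[OF K(1,3) that]]
      by (simp add: norm_map_trans[OF K(1) k(2) K(2)] norm_map_trans[OF K(1) k(3) K(2)]
          norm_map_trans[OF K(1) k'(2) K(3)] norm_map_trans[OF K(1) k'(3) K(3)])
    moreover have "m dvd K" "l dvd K" using K k k' by (auto intro: dvd_trans)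
    ultimately show "same_character c e"
      using cd de K(1) unfolding eqs same_character.simps by blast
  qed
qed

subsection \<open>Frobenius orbits\<close>

definition frob :: "'a::finite_field alg_closure \<Rightarrow> 'a alg_closure" where
  "frob x = x ^ CARD('a)"

text \<open>Composing a character with the Frobenius is raising it to the \<open>q\<close>-th power.\<close>

lift_definition frob_dual :: "'a::finite_field dual \<Rightarrow> 'a dual" is
  "\<lambda>(n, \<xi>). (n, \<lambda>x. \<xi> x ^ CARD('a))"
proof -
  have chars: "(\<lambda>x. \<xi> x ^ CARD('a)) \<in> characters n" if "\<xi> \<in> characters n"
    for n and \<xi> :: "'a alg_closure \<Rightarrow> complex"
    using that by (simp add: characters_def power_mult_distrib)
  fix c d :: "nat \<times> ('a alg_closure \<Rightarrow> complex)"
  assume "same_character c d"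
  then show "same_character (case c of (n, \<xi>) \<Rightarrow> (n, \<lambda>x. \<xi> x ^ CARD('a)))
      (case d of (n, \<xi>) \<Rightarrow> (n, \<lambda>x. \<xi> x ^ CARD('a)))"
    by (cases c; cases d) (simp only: same_character.simps prod.case, metis chars)
qed

definition orbit_of :: "('b \<Rightarrow> 'b) \<Rightarrow> 'b \<Rightarrow> 'b set" where
  "orbit_of f x = {(f ^^ i) x |i. True}"

typedef (overloaded) 'a orb = "{orbit_of frob x |x :: 'a::finite_field alg_closure. x \<noteq> 0}"
  by (rule exI[of _ "orbit_of frob 1"]) (auto intro!: exI[of _ 1])

typedef (overloaded) 'a dual_orb = "{orbit_of frob_dual c |c :: 'a::finite_field dual. True}"
  by auto

definition orb_size :: "'a::finite_field orb \<Rightarrow> nat" where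
  "orb_size f = card (Rep_orb f)"

definition dual_size :: "'a::finite_field dual_orb \<Rightarrow> nat" where
  "dual_size \<phi> = card (Rep_dual_orb \<phi>)"

text \<open>The orbit \<open>\<phi>\<^sub>\<xi>\<close> of a character \<open>\<xi>\<close> of level \<open>n\<close>.\<close>

definition char_orb :: "nat \<Rightarrow> ('a::finite_field alg_closure \<Rightarrow> complex) \<Rightarrow> 'a dual_orb" where
  "char_orb n \<xi> = Abs_dual_orb (orbit_of frob_dual (abs_dual (n, \<xi>)))"

text \<open>A monic irreducible polynomial other than \<open>t\<close> is identified with its set of roots.\<close>

definition poly_orb :: "'a::finite_field poly \<Rightarrow> 'a orb" where
  "poly_orb f = Abs_orb {x. poly (map_poly to_ac f) x = 0}"

definition f1 :: "'a::finite_field orb" where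
  "f1 = poly_orb [:-1, 1:]"

subsection \<open>Polynomial algebras\<close>

type_synonym 'v cpoly = "('v \<Rightarrow>\<^sub>0 nat) \<Rightarrow>\<^sub>0 complex"

definition Const :: "complex \<Rightarrow> 'v cpoly" where
  "Const c = Poly_Mapping.single 0 c"

definition Var :: "'v \<Rightarrow> 'v cpoly" where
  "Var v = Poly_Mapping.single (Poly_Mapping.single v 1) 1"

definition partial_deriv :: "'v \<Rightarrow> 'v cpoly \<Rightarrow> 'v cpoly" where
  "partial_deriv v F = (\<Sum>m\<in>Poly_Mapping.keys F.
     Poly_Mapping.single (m - Poly_Mapping.single v 1)
       (of_nat (Poly_Mapping.lookup m v) * Poly_Mapping.lookup F m))"

definition subst :: "('w \<Rightarrow> 'v cpoly) \<Rightarrow> 'w cpoly \<Rightarrow> 'v cpoly" where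
  "subst g F = (\<Sum>m\<in>Poly_Mapping.keys F. Const (Poly_Mapping.lookup F m) *
     (\<Prod>w\<in>Poly_Mapping.keys m. g w ^ Poly_Mapping.lookup m w))"

subsection \<open>The algebra and its two sets of generators\<close>

text \<open>The generator \<open>p\<^sub>n(\<phi>)\<close>, \<open>n \<ge> 1\<close>, is the variable with index \<open>(\<phi>, n - 1)\<close>; the functions
  indexed by \<open>n\<close> below are only meaningful for \<open>n \<ge> 1\<close>.\<close>

type_synonym 'a FG = "('a dual_orb \<times> nat) cpoly"

definition p_dual :: "nat \<Rightarrow> 'a::finite_field dual_orb \<Rightarrow> 'a FG" where
  "p_dual n \<phi> = Var (\<phi>, n - 1)"

definition partial_dual :: "nat \<Rightarrow> 'a::finite_field dual_orb \<Rightarrow> 'a FG \<Rightarrow> 'a FG" where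
  "partial_dual n \<phi> = partial_deriv (\<phi>, n - 1)"

definition p_orb :: "nat \<Rightarrow> 'a::finite_field orb \<Rightarrow> 'a FG" where
  "p_orb n f =
     (let N = n * orb_size f; x = (SOME x. x \<in> Rep_orb f) in
      Const ((-1) ^ (N - 1) / (of_nat CARD('a) ^ N - 1)) *
      (\<Sum>\<xi>\<in>characters N. Const (cnj (\<xi> x)) *
         p_dual (N div dual_size (char_orb N \<xi>)) (char_orb N \<xi>)))"

text \<open>The isomorphism onto the algebra from the polynomial algebra on variables indexed, as above, by
  \<open>(f, n - 1)\<close>, which expresses that the \<open>p\<^sub>n(f)\<close> are algebraically independent generators. The
  derivative with respect to \<open>p\<^sub>n(f)\<close> is the partial derivative transported along it.\<close>

definition from_orb_gens :: "('a::finite_field orb \<times> nat) cpoly \<Rightarrow> 'a FG" where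
  "from_orb_gens = subst (\<lambda>(f, n). p_orb (Suc n) f)"

definition partial_orb :: "nat \<Rightarrow> 'a::finite_field orb \<Rightarrow> 'a FG \<Rightarrow> 'a FG" where
  "partial_orb n f F = from_orb_gens (partial_deriv (f, n - 1) (inv_into UNIV from_orb_gens F))"

subsection \<open>Vertex operators\<close>

text \<open>The coefficient of \<open>z\<^sup>n\<close> in the exponential of the series \<open>a\<^sub>1 z + a\<^sub>2 z\<^sup>2 + \<dots>\<close> of operators,
  applied to \<open>F\<close>: expand the \<open>m\<close>-th power of the series into a sum over words of length \<open>m\<close>.\<close>

definition exp_coeff :: "(nat \<Rightarrow> 'v cpoly \<Rightarrow> 'v cpoly) \<Rightarrow> nat \<Rightarrow> 'v cpoly \<Rightarrow> 'v cpoly" where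
  "exp_coeff a n F = (\<Sum>m\<le>n. Const (1 / fact m) *
     (\<Sum>ks\<in>{ks. length ks = m \<and> (\<forall>k\<in>set ks. 1 \<le> k) \<and> sum_list ks = n}. foldr a ks F))"

text \<open>The coefficient of \<open>z\<^sup>N\<close> in \<open>(\<Sum>i\<ge>0. A i z\<^sup>i) (\<Sum>j\<ge>0. B j z\<^bsup>-j\<^esup>)\<close>, applied to \<open>F\<close>. The sum
  has finite support if \<open>B j F = 0\<close> for almost all \<open>j\<close>.\<close>

definition product_coeff ::
  "(nat \<Rightarrow> 'v cpoly \<Rightarrow> 'v cpoly) \<Rightarrow> (nat \<Rightarrow> 'v cpoly \<Rightarrow> 'v cpoly) \<Rightarrow> int \<Rightarrow> 'v cpoly \<Rightarrow> 'v cpoly" where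
  "product_coeff A B N F = Sum_any (\<lambda>(i, j). if int i - int j = N then A i (B j F) else 0)"

definition S_op :: "int \<Rightarrow> 'a::finite_field dual_orb \<Rightarrow> 'a FG \<Rightarrow> 'a FG" where
  "S_op n \<phi> = product_coeff
     (exp_coeff (\<lambda>k F. Const (1 / of_nat k) * p_dual k \<phi> * F))
     (exp_coeff (\<lambda>k F. - partial_dual k \<phi> F)) n"

text \<open>The operator \<open>Q\<^sub>n\<^sup>*(f\<^sub>1)\<close> is the coefficient of \<open>z\<^bsup>-n\<^esup>\<close>.\<close>

definition Q_op :: "int \<Rightarrow> 'a::finite_field FG \<Rightarrow> 'a FG" where
  "Q_op n = product_coeff
     (exp_coeff (\<lambda>k F. - (Const ((1 - 1 / of_nat CARD('a) ^ k) / of_nat k) * p_orb k f1 * F)))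
     (exp_coeff (\<lambda>k. partial_orb k f1)) (- n)"

definition S_seq :: "int list \<Rightarrow> 'a::finite_field dual_orb \<Rightarrow> 'a FG \<Rightarrow> 'a FG" where
  "S_seq \<alpha> \<phi> F = foldr (\<lambda>n. S_op n \<phi>) \<alpha> F"

text \<open>The product over all \<open>\<phi>\<close> of the pairwise commuting operators \<open>S_seq (\<alpha> \<phi>) \<phi>\<close>, all but finitely
  many of which are the identity.\<close>

definition S_colored :: "('a::finite_field dual_orb \<Rightarrow> int list) \<Rightarrow> 'a FG \<Rightarrow> 'a FG" where
  "S_colored \<alpha> = Finite_Set.fold (\<lambda>\<phi> T. S_seq (\<alpha> \<phi>) \<phi> \<circ> T) id {\<phi>. \<alpha> \<phi> \<noteq> []}"

subsection \<open>Colored partitions and compositions\<close>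

definition is_partition :: "nat list \<Rightarrow> bool" where
  "is_partition lam \<longleftrightarrow> sorted_wrt (\<ge>) lam \<and> (\<forall>i\<in>set lam. 1 \<le> i)"

text \<open>Since parts are positive, having finite weight means having finite support.\<close>

definition colored_partition :: "('a::finite_field dual_orb \<Rightarrow> nat list) \<Rightarrow> bool" where
  "colored_partition lam \<longleftrightarrow> (\<forall>\<phi>. is_partition (lam \<phi>)) \<and> finite {\<phi>. lam \<phi> \<noteq> []}"

definition weight :: "('a::finite_field dual_orb \<Rightarrow> nat list) \<Rightarrow> nat" where
  "weight \<tau> = Sum_any (\<lambda>\<phi>. dual_size \<phi> * sum_list (\<tau> \<phi>))"

definition underline :: "nat list \<Rightarrow> nat list" where
  "underline lam = map (\<lambda>i. lam ! i + (length lam - i)) [0..<length lam]"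

definition sub_compositions ::
  "('a::finite_field dual_orb \<Rightarrow> nat list) \<Rightarrow> ('a dual_orb \<Rightarrow> nat list) set" where
  "sub_compositions lam = {\<tau>. \<forall>\<phi>. length (\<tau> \<phi>) = length (lam \<phi>) \<and>
     (\<forall>i<length (\<tau> \<phi>). 1 \<le> \<tau> \<phi> ! i \<and> \<tau> \<phi> ! i \<le> underline (lam \<phi>) ! i)}"

definition list_diff :: "nat list \<Rightarrow> nat list \<Rightarrow> int list" where
  "list_diff lam \<tau> = map2 (\<lambda>a b. int a - int b) lam \<tau>"

definition A_factor :: "complex \<Rightarrow> nat \<Rightarrow> complex" where
  "A_factor Q i = (if i > 1 then Q ^ i * (1 / Q - 1) else - Q)"

definition A_coeff :: "('a::finite_field dual_orb \<Rightarrow> nat list) \<Rightarrow> complex" where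
  "A_coeff \<tau> = Prod_any (\<lambda>\<phi>.
     \<Prod>i<length (\<tau> \<phi>). A_factor (of_nat CARD('a) ^ dual_size \<phi>) (\<tau> \<phi> ! i))"

end

theory Submission
  imports Defs
begin

text \<open>
  The generating series \<open>Q(z) = \<Sum>\<^sub>n Q_op n z\<^bsup>-n\<^esup>\<close> and \<open>S(\<phi>; w) = \<Sum>\<^sub>n S_op n \<phi> w\<^sup>n\<close> are products of an exponential of
  multiplication operators (the creation half) and an exponential of derivations (the annihilation half).
  Moving an annihilation half past a creation half only produces a scalar factor. To compute it, both
  operators have to be expressed by the same generators.

  This is Fourier analysis on the cyclic groups \<open>M\<^sub>n\<close>. On level \<open>n\<close>, the generators indexed by orbits in \<open>M\<close> and
  in its dual become functions on \<open>M\<^sub>n\<close> and on its character group, and \<open>from_orb_gens\<close> is the Fourier transform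
  between them. Orthogonality of characters shows that it is an isomorphism (\<open>from_to_orb_gens\<close>,
  \<open>to_from_orb_gens\<close>), so that the derivative with respect to \<open>p\<^sub>n(f\<^sub>1)\<close> is a derivation; since \<open>f\<^sub>1\<close> is the orbit of
  the unit \<open>1\<close>, it maps \<open>p\<^sub>m(\<phi>)\<close> to \<open>(-1) ^ (n - 1)\<close> if \<open>n = m \<bar>\<phi>\<bar>\<close> and to \<open>0\<close> otherwise. Conversely, \<open>p\<^sub>n(f\<^sub>1)\<close> is
  a multiple of the sum of \<open>\<bar>\<phi>\<bar> p\<^sub>k(\<phi>)\<close> over all \<open>\<phi>\<close> and \<open>k\<close> with \<open>n = k \<bar>\<phi>\<bar>\<close>.

  Put \<open>d = \<bar>\<phi>\<bar>\<close> and \<open>u = (-z) ^ d\<close>. The scalar factors are \<open>1 - w/u\<close> for \<open>Q(z) S(\<phi>; w)\<close> and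
  \<open>1 - u/(q\<^sup>d w)\<close> for \<open>S(\<phi>; w) Q(z)\<close>, in both cases relative to the normal ordered product, and the quotient of
  the two expands as \<open>\<Sum>\<^sub>t A(q\<^sup>d; t) (w/u) ^ t\<close>. Therefore
  \<open>Q_op k (S_op n \<phi> F) = \<Sum>\<^sub>t A(q\<^sup>d; t) (-1) ^ (d t) S_op (n - t) \<phi> (Q_op (k - d t) F)\<close>, where the sum may be cut off
  as soon as \<open>n - t\<close> is so negative that the summands vanish (\<open>Q_S_exchange\<close>, \<open>Q_op_S_op\<close>). If \<open>F\<close> is obtained from \<open>1\<close>
  by \<open>r\<close> operators of color \<open>\<phi>\<close> and arbitrary operators of other colors, this happens for \<open>t > n + r + 1\<close>. Passing
  \<open>Q\<close> through the product operator by operator gives the theorem, with exactly the bounds \<open>\<tau>\<^sub>i \<le> \<lambda>\<^sub>i + (l - i)\<close>,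
  counting from \<open>i = 0\<close>, that define \<open>underline\<close>.

  The exponentials are handled through the recurrence \<open>n X\<^sub>n = \<Sum>\<^sub>k k a\<^sub>k X\<^bsub>n-k\<^esub>\<close> for the coefficients of
  \<open>exp (\<Sum>\<^sub>k a\<^sub>k z\<^sup>k)\<close>; \<open>exp_commutation\<close> derives all scalar factors from it.
\<close>

section \<open>Polynomial algebras\<close>

lemma Const_0 [simp]: "Const 0 = 0"
  by (simp add: Const_def)

lemma Const_1 [simp]: "Const 1 = 1"
  by (simp add: Const_def)

lemma Const_add: "Const (a + b) = Const a + Const b"
  by (simp add: Const_def single_add)

lemma Const_diff: "Const (a - b) = Const a - Const b"
  by (simp add: Const_def single_diff)

lemma Const_uminus: "Const (- a) = - Const a"
  by (simp add: Const_def single_uminus)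

lemma Const_mult: "Const (a * b) = Const a * Const b"
  by (simp add: Const_def mult_single)

lemma Const_sum: "Const (\<Sum>i\<in>A. f i) = (\<Sum>i\<in>A. Const (f i))"
  by (induction A rule: infinite_finite_induct) (auto simp: Const_add)

lemma Const_of_nat: "Const (of_nat n) = of_nat n"
  by (induction n) (simp_all add: Const_add)

lemma Const_mult_assoc: "Const a * (Const b * F) = Const (a * b) * F"
  by (simp add: Const_mult mult.assoc)

lemma Const_cancel:
  assumes "Const c * F = Const c * G" "c \<noteq> 0"
  shows "F = G"
proof -
  have "Const (inverse c) * (Const c * F) = Const (inverse c) * (Const c * G)"
    using assms by simp
  then show ?thesis
    using assms(2) by (simp add: Const_mult_assoc)
qed

lemma cpoly_monomial_induct [case_names add monomial]:
  fixes F :: "'v cpoly"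
  assumes "\<And>F G. P F \<Longrightarrow> P G \<Longrightarrow> P (F + G)" "\<And>m c. P (Poly_Mapping.single m c)"
  shows "P F"
proof (induction F rule: update_induct)
  case const
  show ?case using assms(2)[of 0 0] by simp
next
  case (update F m c)
  have "Poly_Mapping.update m c F = F + Poly_Mapping.single m c"
    using update(1)
    by (intro poly_mapping_eqI) (auto simp: lookup_update lookup_add lookup_single in_keys_iff)
  then show ?case using assms update by metis
qed

lemma cpoly_induct [case_names Const add Var]:
  fixes F :: "'v cpoly"
  assumes C: "\<And>c. P (Const c)" and A: "\<And>F G. P F \<Longrightarrow> P G \<Longrightarrow> P (F + G)"
    and V: "\<And>v F. P F \<Longrightarrow> P (Var v * F)"
  shows "P F"
proof (induction F rule: cpoly_monomial_induct)
  case (monomial m c)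
  show ?case
  proof (induction m rule: update_induct)
    case const
    show ?case using C[of c] by (simp add: Const_def)
  next
    case (update m v k)
    have eq: "Poly_Mapping.update v k m = m + Poly_Mapping.single v k"
      using update(1)
      by (intro poly_mapping_eqI) (auto simp: lookup_update lookup_add lookup_single in_keys_iff)
    have "P (Poly_Mapping.single (m + Poly_Mapping.single v i) c)" for i
    proof (induction i)
      case (Suc i)
      have "Poly_Mapping.single v (Suc i) = Poly_Mapping.single v i + Poly_Mapping.single v 1"
        by (simp flip: single_add)
      then have "Poly_Mapping.single (m + Poly_Mapping.single v (Suc i)) c =
          Var v * Poly_Mapping.single (m + Poly_Mapping.single v i) c"
        by (simp add: Var_def mult_single add_ac)
      then show ?case using V[OF Suc] by simp
    qed (use update in simp)
    then show ?case by (simp add: eq)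
  qed
qed (rule A)

definition linear_op :: "('v cpoly \<Rightarrow> 'w cpoly) \<Rightarrow> bool" where
  "linear_op T \<longleftrightarrow> (\<forall>F G. T (F + G) = T F + T G) \<and> (\<forall>c F. T (Const c * F) = Const c * T F)"

lemma linear_op_add: "linear_op T \<Longrightarrow> T (F + G) = T F + T G"
  and linear_op_scale: "linear_op T \<Longrightarrow> T (Const c * F) = Const c * T F"
  by (auto simp: linear_op_def)

lemma linear_op_mult: "linear_op (\<lambda>F. M * F)"
  by (simp add: linear_op_def algebra_simps)

lemma linear_op_0: "linear_op T \<Longrightarrow> T 0 = 0"
  using linear_op_scale[of T 0 0] by simp

lemma linear_op_uminus: "linear_op T \<Longrightarrow> T (- F) = - T F"
  using linear_op_scale[of T "-1" F] by (simp add: Const_uminus)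

lemma linear_op_diff: "linear_op T \<Longrightarrow> T (F - G) = T F - T G"
  using linear_op_add[of T F "- G"] by (simp add: linear_op_uminus)

lemma linear_op_sum: "linear_op T \<Longrightarrow> T (\<Sum>i\<in>A. f i) = (\<Sum>i\<in>A. T (f i))"
  by (induction A rule: infinite_finite_induct) (auto simp: linear_op_0 linear_op_add)

lemma linear_op_Sum_any:
  assumes "linear_op T" "finite {i. f i \<noteq> 0}"
  shows "T (Sum_any f) = Sum_any (\<lambda>i. T (f i))"
proof -
  have "Sum_any (\<lambda>i. T (f i)) = (\<Sum>i\<in>{i. f i \<noteq> 0}. T (f i))"
    using assms(2) by (rule Sum_any.expand_superset) (auto simp: linear_op_0[OF assms(1)])
  then show ?thesis
    using assms(1) by (simp add: Sum_any.expand_set linear_op_sum)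
qed

subsection \<open>Derivations\<close>

definition derivation :: "('v cpoly \<Rightarrow> 'v cpoly) \<Rightarrow> bool" where
  "derivation \<delta> \<longleftrightarrow> linear_op \<delta> \<and> (\<forall>F G. \<delta> (F * G) = \<delta> F * G + F * \<delta> G)"

lemma derivation_linear: "derivation \<delta> \<Longrightarrow> linear_op \<delta>"
  and derivation_mult: "derivation \<delta> \<Longrightarrow> \<delta> (F * G) = \<delta> F * G + F * \<delta> G"
  by (auto simp: derivation_def)

lemma derivation_1: "derivation \<delta> \<Longrightarrow> \<delta> 1 = 0"
  using derivation_mult[of \<delta> 1 1] by simp

lemma derivation_Const: "derivation \<delta> \<Longrightarrow> \<delta> (Const c) = 0"
  using linear_op_scale[OF derivation_linear, of \<delta> c 1] by (simp add: derivation_1)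

lemma derivation_uminus:
  assumes "derivation \<delta>"
  shows "derivation (\<lambda>F. - \<delta> F)"
  using assms by (auto simp: derivation_def linear_op_def)

lemma partial_deriv_expand:
  assumes "finite A" "Poly_Mapping.keys F \<subseteq> A"
  shows "partial_deriv v F = (\<Sum>m\<in>A. Poly_Mapping.single (m - Poly_Mapping.single v 1)
    (of_nat (Poly_Mapping.lookup m v) * Poly_Mapping.lookup F m))"
  unfolding partial_deriv_def
  using assms by (intro sum.mono_neutral_left) (auto simp: in_keys_iff)

lemma partial_deriv_add: "partial_deriv v (F + G) = partial_deriv v F + partial_deriv v G"
proof -
  let ?A = "Poly_Mapping.keys F \<union> Poly_Mapping.keys G"
  have "Poly_Mapping.keys (F + G) \<subseteq> ?A" by (rule keys_add)
  then show ?thesis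
    by (simp add: partial_deriv_expand[of ?A] lookup_add single_add algebra_simps sum.distrib)
qed

lemma partial_deriv_single:
  "partial_deriv v (Poly_Mapping.single m c) =
     Poly_Mapping.single (m - Poly_Mapping.single v 1) (of_nat (Poly_Mapping.lookup m v) * c)"
  by (subst partial_deriv_expand[of "{m}"]) auto

lemma partial_deriv_mult:
  "partial_deriv v (F * G) = partial_deriv v F * G + F * partial_deriv v G"
proof (induction F rule: cpoly_monomial_induct)
  case (add F F')
  then show ?case by (simp add: partial_deriv_add algebra_simps)
next
  case (monomial m a)
  show ?case
  proof (induction G rule: cpoly_monomial_induct)
    case (add G G')
    then show ?case by (simp add: partial_deriv_add algebra_simps)
  next
    case (monomial n b)
    let ?s = "Poly_Mapping.single v (1::nat)"
    have shift: "k + l - ?s = (k - ?s) + l" if "Poly_Mapping.lookup k v \<noteq> 0"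
      for k l :: "'a \<Rightarrow>\<^sub>0 nat"
      using that
      by (intro poly_mapping_eqI) (auto simp: lookup_add lookup_minus lookup_single when_def)
    have "Poly_Mapping.single (m + n - ?s) (of_nat (Poly_Mapping.lookup m v) * (a * b)) =
        Poly_Mapping.single (m - ?s + n) (of_nat (Poly_Mapping.lookup m v) * (a * b))"
    proof (cases "Poly_Mapping.lookup m v = 0")
      case False
      then show ?thesis by (simp only: shift[OF False])
    qed simp
    moreover have "Poly_Mapping.single (m + n - ?s) (of_nat (Poly_Mapping.lookup n v) * (a * b)) =
        Poly_Mapping.single (m + (n - ?s)) (of_nat (Poly_Mapping.lookup n v) * (a * b))"
    proof (cases "Poly_Mapping.lookup n v = 0")
      case False
      then show ?thesis by (simp only: shift[OF False] add.commute[of m])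
    qed simp
    ultimately show ?case
      by (simp add: mult_single partial_deriv_single lookup_add single_add algebra_simps)
  qed
qed

lemma derivation_partial_deriv: "derivation (partial_deriv v)"
proof -
  have "partial_deriv v (Const c) = 0" for c
    by (simp add: Const_def partial_deriv_single)
  then show ?thesis
    by (simp add: derivation_def linear_op_def partial_deriv_add partial_deriv_mult)
qed

lemma partial_deriv_Var: "partial_deriv v (Var w) = (if v = w then 1 else 0)"
  by (auto simp: Var_def partial_deriv_single lookup_single when_def)

text \<open>Two derivations commute as soon as their iterates agree on the generators, because their
  commutator is again a derivation.\<close>

lemma derivations_commute:
  assumes \<delta>: "derivation \<delta>" and \<epsilon>: "derivation \<epsilon>" and Var: "\<And>v. \<delta> (\<epsilon> (Var v)) = \<epsilon> (\<delta> (Var v))"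
  shows "\<delta> (\<epsilon> F) = \<epsilon> (\<delta> F)"
proof (induction F rule: cpoly_induct)
  case (Const c)
  show ?case
    using assms by (simp add: derivation_Const linear_op_0 derivation_linear)
next
  case (add F G)
  then show ?case
    by (simp add: linear_op_add[OF derivation_linear[OF \<delta>]] linear_op_add[OF derivation_linear[OF \<epsilon>]])
next
  case (Var v F)
  then show ?case
    by (simp add: derivation_mult[OF \<delta>] derivation_mult[OF \<epsilon>] assms(3)
        linear_op_add[OF derivation_linear[OF \<delta>]] linear_op_add[OF derivation_linear[OF \<epsilon>]] add_ac)
qed

subsection \<open>Substitution homomorphisms\<close>

definition alg_hom :: "('v cpoly \<Rightarrow> 'w cpoly) \<Rightarrow> bool" where
  "alg_hom h \<longleftrightarrow> (\<forall>F G. h (F + G) = h F + h G) \<and> (\<forall>F G. h (F * G) = h F * h G) \<and>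
     (\<forall>c. h (Const c) = Const c)"

lemma alg_hom_add: "alg_hom h \<Longrightarrow> h (F + G) = h F + h G"
  and alg_hom_mult: "alg_hom h \<Longrightarrow> h (F * G) = h F * h G"
  and alg_hom_Const: "alg_hom h \<Longrightarrow> h (Const c) = Const c"
  by (auto simp: alg_hom_def)

lemma alg_hom_linear: "alg_hom h \<Longrightarrow> linear_op h"
  by (auto simp: alg_hom_def linear_op_def)

lemma alg_hom_fixing_Var:
  assumes "alg_hom h" "\<And>v. h (Var v) = Var v"
  shows "h F = F"
  by (induction F rule: cpoly_induct)
    (auto simp: alg_hom_Const alg_hom_add alg_hom_mult assms)

lemma alg_hom_comp: "alg_hom g \<Longrightarrow> alg_hom h \<Longrightarrow> alg_hom (\<lambda>F. g (h F))"
  by (simp add: alg_hom_def)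

lemma derivation_transport:
  assumes "alg_hom g" "alg_hom h" "derivation \<delta>" "\<And>F. g (h F) = F"
  shows "derivation (\<lambda>F. g (\<delta> (h F)))"
proof -
  have "linear_op (\<lambda>F. g (\<delta> (h F)))"
    unfolding linear_op_def
    by (simp add: linear_op_add[OF alg_hom_linear] linear_op_scale[OF alg_hom_linear]
        linear_op_add[OF derivation_linear] linear_op_scale[OF derivation_linear] assms(1-3))
  then show ?thesis
    using assms by (simp add: derivation_def alg_hom_add alg_hom_mult)
qed

lemma subst_expand:
  assumes "finite A" "Poly_Mapping.keys F \<subseteq> A"
  shows "subst g F = (\<Sum>m\<in>A. Const (Poly_Mapping.lookup F m) *
     (\<Prod>w\<in>Poly_Mapping.keys m. g w ^ Poly_Mapping.lookup m w))"
  unfolding subst_def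
  using assms by (intro sum.mono_neutral_left) (auto simp: in_keys_iff)

lemma subst_add: "subst g (F + G) = subst g F + subst g G"
proof -
  let ?A = "Poly_Mapping.keys F \<union> Poly_Mapping.keys G"
  have "Poly_Mapping.keys (F + G) \<subseteq> ?A" by (rule keys_add)
  then show ?thesis
    by (simp add: subst_expand[of ?A] lookup_add Const_add algebra_simps sum.distrib)
qed

lemma subst_single:
  "subst g (Poly_Mapping.single m c) =
     Const c * (\<Prod>w\<in>Poly_Mapping.keys m. g w ^ Poly_Mapping.lookup m w)"
  by (subst subst_expand[of "{m}"]) auto

lemma subst_mult: "subst g (F * G) = subst g F * subst g G"
proof (induction F rule: cpoly_monomial_induct)
  case (add F F')
  then show ?case by (simp add: subst_add algebra_simps)
next
  case (monomial m a)
  show ?case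
  proof (induction G rule: cpoly_monomial_induct)
    case (add G G')
    then show ?case by (simp add: subst_add algebra_simps)
  next
    case (monomial n b)
    let ?A = "Poly_Mapping.keys m \<union> Poly_Mapping.keys n"
    have expand: "(\<Prod>w\<in>Poly_Mapping.keys k. g w ^ Poly_Mapping.lookup k w) =
        (\<Prod>w\<in>?A. g w ^ Poly_Mapping.lookup k w)" if "Poly_Mapping.keys k \<subseteq> ?A" for k
      using that by (intro prod.mono_neutral_left) (auto simp: in_keys_iff)
    have "(\<Prod>w\<in>Poly_Mapping.keys (m + n). g w ^ Poly_Mapping.lookup (m + n) w) =
        (\<Prod>w\<in>?A. g w ^ Poly_Mapping.lookup (m + n) w)"
      by (rule expand) (rule keys_add)
    then show ?case
      unfolding mult_single subst_single lookup_add power_add prod.distrib Const_mult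
      by (simp add: expand[of m] expand[of n] mult_ac)
  qed
qed

lemma subst_hom: "alg_hom (subst g)"
proof -
  have "subst g (Const c) = Const c" for c
    by (simp add: Const_def subst_single)
  then show ?thesis by (simp add: alg_hom_def subst_add subst_mult)
qed

lemma subst_Var: "subst g (Var v) = g v"
  by (simp add: Var_def subst_single)

section \<open>Exponentials of series of commuting operators\<close>

text \<open>The coefficient of the exponential, with index in the integers so that shifts of the index need no
  side conditions.\<close>

definition exp_coeffZ :: "(nat \<Rightarrow> 'v cpoly \<Rightarrow> 'v cpoly) \<Rightarrow> int \<Rightarrow> 'v cpoly \<Rightarrow> 'v cpoly" where
  "exp_coeffZ a j F = (if j < 0 then 0 else exp_coeff a (nat j) F)"

definition words :: "nat \<Rightarrow> nat \<Rightarrow> nat list set" where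
  "words m n = {ks. length ks = m \<and> (\<forall>k\<in>set ks. 1 \<le> k) \<and> sum_list ks = n}"

lemma words_0: "words 0 n = (if n = 0 then {[]} else {})"
  by (auto simp: words_def)

lemma words_Suc: "words (Suc m) n = (\<Union>k\<in>{1..n}. (#) k ` words m (n - k))"
proof (intro Set.set_eqI iffI)
  fix ks assume "ks \<in> words (Suc m) n"
  then show "ks \<in> (\<Union>k\<in>{1..n}. (#) k ` words m (n - k))"
    by (cases ks) (auto simp: words_def intro!: bexI[of _ "hd ks"])
qed (auto simp: words_def)

lemma finite_words [simp]: "finite (words m n)"
  by (induction m arbitrary: n) (auto simp: words_0 words_Suc)

lemma words_empty: "n < m \<Longrightarrow> words m n = {}"
  by (induction m arbitrary: n) (auto simp: words_Suc)

locale commuting_ops =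
  fixes a :: "nat \<Rightarrow> 'v cpoly \<Rightarrow> 'v cpoly"
  assumes linear: "linear_op (a k)" and commute: "a k (a l F) = a l (a k F)"
begin

definition word_sum :: "nat \<Rightarrow> nat \<Rightarrow> 'v cpoly \<Rightarrow> 'v cpoly" where
  "word_sum m n F = (\<Sum>ks\<in>words m n. foldr a ks F)"

lemma word_sum_Suc: "word_sum (Suc m) n F = (\<Sum>k=1..n. a k (word_sum m (n - k) F))"
proof -
  have "word_sum (Suc m) n F = (\<Sum>k=1..n. \<Sum>ks\<in>(#) k ` words m (n - k). foldr a ks F)"
    unfolding word_sum_def words_Suc by (rule sum.UNION_disjoint) auto
  also have "\<dots> = (\<Sum>k=1..n. a k (word_sum m (n - k) F))"
    by (simp add: word_sum_def linear_op_sum[OF linear] sum.reindex)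
  finally show ?thesis .
qed

text \<open>By commutativity each of the \<open>m\<close> letters of a word contributes to \<open>n = k\<^sub>1 + \<dots> + k\<^sub>m\<close> as much as the
  first one.\<close>

lemma weighted_word_sum:
  "of_nat n * word_sum m n F = of_nat m * (\<Sum>k=1..n. of_nat k * a k (word_sum (m - 1) (n - k) F))"
proof (induction m arbitrary: n)
  case 0
  show ?case by (simp add: word_sum_def words_0)
next
  case (Suc m)
  have nat_scale: "a k (of_nat i * G) = of_nat i * a k G" for k i G
    using linear_op_scale[OF linear, of k "of_nat i" G] by (simp add: Const_of_nat)
  let ?S = "\<Sum>k=1..n. of_nat k * a k (word_sum m (n - k) F)"
  have "of_nat n * word_sum (Suc m) n F = (\<Sum>k=1..n. of_nat (k + (n - k)) * a k (word_sum m (n - k) F))"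
    by (simp add: word_sum_Suc sum_distrib_left)
  also have "\<dots> = ?S + (\<Sum>k=1..n. a k (of_nat (n - k) * word_sum m (n - k) F))"
    unfolding of_nat_add by (simp only: distrib_right sum.distrib nat_scale)
  also have "(\<Sum>k=1..n. a k (of_nat (n - k) * word_sum m (n - k) F)) = of_nat m * ?S"
  proof (cases m)
    case 0
    then show ?thesis
      by (auto simp: word_sum_def words_0 linear_op_0[OF linear] intro!: sum.neutral)
  next
    case (Suc m')
    have "(\<Sum>k=1..n. a k (of_nat (n - k) * word_sum m (n - k) F)) =
        (\<Sum>k=1..n. of_nat m * (\<Sum>l=1..n - k. of_nat l * a k (a l (word_sum m' (n - k - l) F))))"
      unfolding Suc.IH nat_scale by (simp add: nat_scale linear_op_sum[OF linear] Suc)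
    also have "\<dots> = of_nat m * (\<Sum>k=1..n. \<Sum>l=1..n - k. of_nat l * a l (a k (word_sum m' (n - l - k) F)))"
      by (simp add: sum_distrib_left commute[of _ _ "word_sum _ _ _"] add.commute)
    also have "(\<Sum>k=1..n. \<Sum>l=1..n - k. of_nat l * a l (a k (word_sum m' (n - l - k) F))) =
        (\<Sum>l=1..n. \<Sum>k=1..n - l. of_nat l * a l (a k (word_sum m' (n - l - k) F)))"
    proof -
      have "{1..n - k} = {l \<in> {1..n}. k + l \<le> n}" if "k \<le> n" for k
        using that by auto
      moreover have "{1..n - l} = {k \<in> {1..n}. k + l \<le> n}" if "l \<le> n" for l
        using that by auto
      ultimately show ?thesis
        using sum.swap_restrict[of "{1..n}" "{1..n}"
            "\<lambda>k l. of_nat l * a l (a k (word_sum m' (n - l - k) F))" "\<lambda>k l. k + l \<le> n"] by simp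
    qed
    also have "\<dots> = ?S"
      by (simp add: Suc word_sum_Suc linear_op_sum[OF linear] sum_distrib_left)
    finally show ?thesis .
  qed
  finally show ?case
    by (simp add: algebra_simps)
qed

lemma exp_coeff_word_sum:
  assumes "n \<le> N"
  shows "exp_coeff a n F = (\<Sum>m\<le>N. Const (1 / fact m) * word_sum m n F)"
proof -
  have "exp_coeff a n F = (\<Sum>m\<le>n. Const (1 / fact m) * word_sum m n F)"
    by (simp add: exp_coeff_def word_sum_def words_def)
  also have "\<dots> = (\<Sum>m\<le>N. Const (1 / fact m) * word_sum m n F)"
    using assms by (intro sum.mono_neutral_left) (auto simp: word_sum_def words_empty)
  finally show ?thesis .
qed

text \<open>Applying \<open>z d/dz\<close> to \<open>exp (\<Sum>\<^sub>k a\<^sub>k z\<^sup>k)\<close> multiplies it by \<open>\<Sum>\<^sub>k k a\<^sub>k z\<^sup>k\<close>.\<close>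

lemma exp_coeff_recurrence:
  "of_nat n * exp_coeff a n F = (\<Sum>k=1..n. of_nat k * a k (exp_coeff a (n - k) F))"
proof (cases n)
  case (Suc n')
  have "of_nat n * exp_coeff a n F = (\<Sum>m\<le>n. Const (1 / fact m) * (of_nat n * word_sum m n F))"
    by (simp add: exp_coeff_word_sum[of n n] sum_distrib_left mult_ac)
  also have "\<dots> = (\<Sum>m\<le>n'. Const (1 / fact (Suc m)) * (of_nat (Suc m) *
      (\<Sum>k=1..n. of_nat k * a k (word_sum m (n - k) F))))"
    unfolding weighted_word_sum Suc
    by (subst sum.atMost_Suc_shift) simp
  also have "\<dots> = (\<Sum>m\<le>n'. Const (1 / fact m) * (\<Sum>k=1..n. of_nat k * a k (word_sum m (n - k) F)))"
  proof (intro sum.cong refl)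
    fix m
    have "complex_of_nat (Suc m) \<noteq> 0"
      unfolding of_nat_eq_0_iff by simp
    then have "1 / fact (Suc m) * of_nat (Suc m) = (1 / fact m :: complex)"
      by (simp del: of_nat_Suc add: fact_Suc)
    then show "Const (1 / fact (Suc m)) * (of_nat (Suc m) * G) = Const (1 / fact m) * G"
      for G :: "'v cpoly"
      by (simp only: Const_mult_assoc flip: Const_of_nat)
  qed
  also have "\<dots> = (\<Sum>k=1..n. of_nat k * (\<Sum>m\<le>n'. a k (Const (1 / fact m) * word_sum m (n - k) F)))"
    unfolding sum_distrib_left
    by (subst sum.swap) (simp add: linear_op_scale[OF linear] mult_ac)
  also have "\<dots> = (\<Sum>k=1..n. of_nat k * a k (exp_coeff a (n - k) F))"
    by (intro sum.cong refl)
      (auto simp: exp_coeff_word_sum[of _ n'] Suc linear_op_sum[OF linear])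
  finally show ?thesis .
qed simp

lemma exp_coeffZ_recurrence:
  assumes "j \<le> int N"
  shows "Const (of_int j) * exp_coeffZ a j F =
    (\<Sum>k=1..N. Const (of_nat k) * a k (exp_coeffZ a (j - int k) F))"
proof (cases "j < 0")
  case True
  then show ?thesis
    by (simp add: exp_coeffZ_def linear_op_0[OF linear])
next
  case False
  then obtain n where n: "j = int n" using nonneg_int_cases[of j] by auto
  have "(\<Sum>k=1..N. Const (of_nat k) * a k (exp_coeffZ a (j - int k) F)) =
      (\<Sum>k=1..n. Const (of_nat k) * a k (exp_coeffZ a (j - int k) F))"
    using assms n
    by (intro sum.mono_neutral_right) (auto simp: exp_coeffZ_def linear_op_0[OF linear])
  also have "\<dots> = (\<Sum>k=1..n. of_nat k * a k (exp_coeff a (n - k) F))"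
    by (intro sum.cong refl) (auto simp: exp_coeffZ_def Const_of_nat n nat_diff_distrib)
  also have "\<dots> = Const (of_int j) * exp_coeffZ a j F"
    by (simp add: n exp_coeffZ_def Const_of_nat exp_coeff_recurrence)
  finally show ?thesis by (rule sym)
qed

lemma exp_coeff_0 [simp]: "exp_coeff a 0 F = F"
  by (simp add: exp_coeff_word_sum[of 0 0] word_sum_def words_0)

lemma exp_coeffZ_0 [simp]: "exp_coeffZ a 0 F = F"
  by (simp add: exp_coeffZ_def)

lemma exp_coeff_linear: "linear_op (exp_coeff a n)"
proof -
  have "linear_op (\<lambda>F. foldr a ks F)" for ks
    by (induction ks) (auto simp: linear_op_def linear_op_add[OF linear] linear_op_scale[OF linear])
  then show ?thesis
    unfolding exp_coeff_def linear_op_def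
    by (auto simp: sum.distrib sum_distrib_left algebra_simps)
qed

lemma exp_coeffZ_linear: "linear_op (exp_coeffZ a j)"
  using exp_coeff_linear[of "nat j"] by (simp add: linear_op_def exp_coeffZ_def)

text \<open>Suppose that the commutators of the exponents \<open>a n\<close> with the coefficients \<open>B i\<close> of another series contain
  the coefficients of \<open>log (1 - c w\<^sup>d y\<^sup>e)\<close>, where \<open>w\<close> and \<open>y\<close> record the indices \<open>n\<close> and \<open>i\<close>. Then the
  exponential of the \<open>a n\<close> is exchanged with the other series up to the factor \<open>1 - c w\<^sup>d y\<^sup>e\<close>, which has only two
  terms. In the proof, both sides satisfy the recurrence of the exponential; the contributions of the
  commutators form a telescoping sum.\<close>

lemma exp_commutation:
  fixes B :: "int \<Rightarrow> 'v cpoly \<Rightarrow> 'v cpoly"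
  assumes d: "d > 0"
    and B: "\<And>i. linear_op (B i)"
    and comm: "\<And>n i F. n \<ge> 1 \<Longrightarrow> a n (B i F) = B i (a n F) -
       (if d dvd n then Const (c ^ (n div d) / of_nat (n div d)) * B (i - e * int (n div d)) F else 0)"
  shows "exp_coeffZ a j (B i F) =
     B i (exp_coeffZ a j F) - Const c * B (i - e) (exp_coeffZ a (j - int d) F)"
proof (induction "nat j" arbitrary: j i rule: less_induct)
  case less
  let ?X = "exp_coeffZ a"
  have neg: "?X k G = 0" if "k < 0" for k G
    using that by (simp add: exp_coeffZ_def)
  consider "j < 0" | "j = 0" | "j > 0" by linarith
  then show ?case
  proof cases
    case 1
    then show ?thesis using d by (simp add: neg linear_op_0[OF B])
  next
    case 2
    then show ?thesis using d by (simp add: neg linear_op_0[OF B])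
  next
    case 3
    define K where "K = nat j"
    let ?N = "d * K"
    have K: "j = int K" using 3 by (simp add: K_def)
    have "K \<le> ?N" using d by simp
    then have N: "j \<le> int ?N" by (simp only: K of_nat_le_iff)
    have IH: "?X (j - int n) (B i F) =
        B i (?X (j - int n) F) - Const c * B (i - e) (?X (j - int n - int d) F)" if "n \<ge> 1" for n i
      using less[of "j - int n" i] that 3 by simp
    define T where "T k = Const (c ^ k) * B (i - e * int k) (?X (j - int d * int k) F)" for k
    define t where "t n = (if d dvd n then T (n div d) - T (n div d + 1) else 0)" for n
    have term_n: "Const (of_nat n) * a n (?X (j - int n) (B i F)) =
        B i (Const (of_nat n) * a n (?X (j - int n) F)) -
        Const c * B (i - e) (Const (of_nat n) * a n (?X (j - int d - int n) F)) - of_nat d * t n"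
      if n: "n \<ge> 1" for n
    proof (cases "d dvd n")
      case True
      then obtain k where k: "n = d * k" by blast
      with n d have k0: "k > 0" by (cases k) auto
      then have "of_nat n * (c ^ k / of_nat k) = of_nat d * c ^ k"
        by (simp add: k)
      then have scal: "Const (of_nat n) * (Const (c ^ k / of_nat k) * G) = of_nat d * (Const (c ^ k) * G)" for G
        by (simp only: Const_mult_assoc flip: Const_of_nat)
      have "Const (of_nat n) * a n (?X (j - int n) (B i F)) =
        Const (of_nat n) * (B i (a n (?X (j - int n) F)) - Const (c ^ k / of_nat k) * B (i - e * int k) (?X (j - int n) F)
         - Const c * (B (i - e) (a n (?X (j - int n - int d) F)) -
              Const (c ^ k / of_nat k) * B (i - e - e * int k) (?X (j - int n - int d) F)))"
        unfolding IH[OF n] linear_op_diff[OF linear] linear_op_scale[OF linear] comm[OF n]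
        using d by (simp add: k)
      also have "\<dots> = B i (Const (of_nat n) * a n (?X (j - int n) F)) -
          Const c * B (i - e) (Const (of_nat n) * a n (?X (j - int d - int n) F))
          - of_nat d * (Const (c ^ k) * B (i - e * int k) (?X (j - int n) F))
          + of_nat d * (Const (c ^ k) * (Const c * B (i - e - e * int k) (?X (j - int n - int d) F)))"
        unfolding linear_op_scale[OF B] right_diff_distrib scal[symmetric]
        by (simp add: algebra_simps)
      also have "Const (c ^ k) * (Const c * B (i - e - e * int k) (?X (j - int n - int d) F)) = T (k + 1)"
        by (simp add: T_def k Const_mult_assoc algebra_simps)
      also have "Const (c ^ k) * B (i - e * int k) (?X (j - int n) F) = T k"
        by (simp add: T_def k)
      finally show ?thesis
        using d by (simp add: t_def k algebra_simps)
    next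
      case False
      then show ?thesis
        unfolding IH[OF n] linear_op_diff[OF linear] linear_op_scale[OF linear] comm[OF n]
          linear_op_scale[OF B]
        by (simp add: t_def algebra_simps)
    qed
    have telescope: "(\<Sum>n=1..?N. t n) = Const c * B (i - e) (?X (j - int d) F)"
    proof -
      have "(\<Sum>n=1..?N. t n) = (\<Sum>n\<in>(\<lambda>k. d * k) ` {1..K}. t n)"
        using d by (intro sum.mono_neutral_right) (auto simp: t_def elim!: dvdE)
      also have "\<dots> = (\<Sum>k=1..K. T k - T (Suc k))"
        using d by (subst sum.reindex) (auto simp: inj_on_def t_def)
      also have "\<dots> = T 1 - T (Suc K)"
        using sum_Suc_diff[of 1 K "\<lambda>k. - T k"] by simp
      also have "T (Suc K) = 0"
      proof -
        have "1 * Suc K \<le> d * Suc K" using d by (intro mult_le_mono) auto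
        then have "K < d * Suc K" by (simp only: nat_mult_1 Suc_le_eq)
        then have "j - int d * int (Suc K) < 0" unfolding K of_nat_mult[symmetric] by linarith
        then show ?thesis by (simp only: T_def neg linear_op_0[OF B] mult_zero_right)
      qed
      finally show ?thesis by (simp add: T_def)
    qed
    have "Const (of_int j) * ?X j (B i F) =
        B i (\<Sum>n=1..?N. Const (of_nat n) * a n (?X (j - int n) F)) -
        Const c * B (i - e) (\<Sum>n=1..?N. Const (of_nat n) * a n (?X (j - int d - int n) F))
        - of_nat d * (\<Sum>n=1..?N. t n)"
      unfolding exp_coeffZ_recurrence[OF N]
      by (simp add: term_n sum_subtractf linear_op_sum[OF B] sum_distrib_left)
    also have "\<dots> = B i (Const (of_int j) * ?X j F) -
        Const c * B (i - e) (Const (of_int (j - int d)) * ?X (j - int d) F)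
        - of_nat d * (Const c * B (i - e) (?X (j - int d) F))"
    proof -
      have "j - int d \<le> int ?N" using N by linarith
      then show ?thesis
        by (simp only: exp_coeffZ_recurrence[OF N] exp_coeffZ_recurrence[of "j - int d" ?N] telescope)
    qed
    also have "\<dots> = Const (of_int j) * (B i (?X j F) - Const c * B (i - e) (?X (j - int d) F))"
      unfolding linear_op_scale[OF B] by (simp add: Const_diff Const_of_nat algebra_simps)
    finally show ?thesis
      using 3 Const_cancel by (metis of_int_eq_0_iff less_irrefl)
  qed
qed

end

lemma exp_coeffZ_commute:
  assumes "commuting_ops a" "commuting_ops b" "\<And>k l F. a k (b l F) = b l (a k F)"
  shows "exp_coeffZ a i (exp_coeffZ b j F) = exp_coeffZ b j (exp_coeffZ a i F)"
proof -
  interpret a: commuting_ops a by fact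
  interpret b: commuting_ops b by fact
  have "exp_coeffZ a i (b l F) = b l (exp_coeffZ a i F)" for l F
    using a.exp_commutation[of 1 "\<lambda>_. b l" 0 0 i 0 F] assms(3) b.linear by (simp add: power_0_left)
  then show ?thesis
    using b.exp_commutation[of 1 "\<lambda>_. exp_coeffZ a i" 0 0 j 0 F] a.exp_coeffZ_linear by (simp add: power_0_left)
qed

lemma exp_coeffZ_commute_op:
  assumes "commuting_ops a" "linear_op T" "\<And>k F. k \<ge> 1 \<Longrightarrow> a k (T F) = T (a k F)"
  shows "exp_coeffZ a i (T F) = T (exp_coeffZ a i F)"
  using commuting_ops.exp_commutation[OF assms(1), of 1 "\<lambda>_. T" 0 0 i 0 F] assms(2,3) by (simp add: power_0_left)

subsection \<open>Exponentials of multiplication operators\<close>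

definition exp_poly :: "(nat \<Rightarrow> 'v cpoly) \<Rightarrow> int \<Rightarrow> 'v cpoly" where
  "exp_poly M i = exp_coeffZ (\<lambda>k F. M k * F) i 1"

lemma commuting_ops_mult: "commuting_ops (\<lambda>k F. M k * F)"
  by unfold_locales (rule linear_op_mult, simp add: mult_ac)

lemma exp_coeffZ_mult: "exp_coeffZ (\<lambda>k F. M k * F) i F = exp_poly M i * F"
  using exp_coeffZ_commute_op[OF commuting_ops_mult[of M] linear_op_mult[of F], of i 1]
  by (simp add: exp_poly_def mult_ac)

lemma exp_poly_neg: "i < 0 \<Longrightarrow> exp_poly M i = 0"
  by (simp add: exp_poly_def exp_coeffZ_def)

text \<open>A derivation multiplies the exponential by the derivative of the exponent.\<close>

lemma derivation_exp_poly:
  assumes \<delta>: "derivation \<delta>" and w: "w \<ge> 1"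
    and M: "\<And>k. k \<ge> 1 \<Longrightarrow> \<delta> (M k) = (if k = w then Const g else 0)"
  shows "\<delta> (exp_poly M i) = Const g * exp_poly M (i - int w)"
proof (induction "nat i" arbitrary: i rule: less_induct)
  case less
  interpret commuting_ops "\<lambda>k F. M k * F" by (rule commuting_ops_mult)
  note lin = derivation_linear[OF \<delta>]
  consider "i < 0" | "i = 0" | "i > 0" by linarith
  then show ?case
  proof cases
    case 1
    then show ?thesis by (simp add: exp_poly_neg linear_op_0[OF lin])
  next
    case 2
    then show ?thesis using w by (simp add: exp_poly_def exp_coeffZ_def derivation_1[OF \<delta>])
  next
    case 3
    define N where "N = max (nat i) w"
    have N: "i \<le> int N" "i - int w \<le> int N" "w \<le> N" by (auto simp: N_def)
    have rec: "Const (of_int j) * exp_poly M j = (\<Sum>k=1..N. Const (of_nat k) * (M k * exp_poly M (j - int k)))"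
      if "j \<le> int N" for j
      unfolding exp_poly_def by (rule exp_coeffZ_recurrence[OF that])
    have IH: "\<delta> (exp_poly M (i - int k)) = Const g * exp_poly M (i - int w - int k)" if "k \<ge> 1" for k
      using less[of "i - int k"] that 3 by (simp add: algebra_simps)
    have term_k: "\<delta> (Const (of_nat k) * (M k * exp_poly M (i - int k))) =
        (if k = w then Const (of_nat w) * (Const g * exp_poly M (i - int w)) else 0) +
        Const g * (Const (of_nat k) * (M k * exp_poly M (i - int w - int k)))" if "k \<ge> 1" for k
      using that by (simp add: linear_op_scale[OF lin] derivation_mult[OF \<delta>] derivation_Const[OF \<delta>] IH M algebra_simps)
    have "Const (of_int i) * \<delta> (exp_poly M i) = \<delta> (Const (of_int i) * exp_poly M i)"
      by (simp add: linear_op_scale[OF lin])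
    also have "\<dots> = (\<Sum>k=1..N. (if k = w then Const (of_nat w) * (Const g * exp_poly M (i - int w)) else 0) +
        Const g * (Const (of_nat k) * (M k * exp_poly M (i - int w - int k))))"
      by (simp add: rec N linear_op_sum[OF lin] term_k)
    also have "\<dots> = Const (of_nat w) * (Const g * exp_poly M (i - int w)) +
        Const g * (Const (of_int (i - int w)) * exp_poly M (i - int w))"
      using w N by (simp add: sum.distrib rec[OF N(2)] del: of_int_diff flip: sum_distrib_left)
    also have "\<dots> = Const (of_int i) * (Const g * exp_poly M (i - int w))"
      by (simp add: Const_diff algebra_simps)
    finally show ?thesis
      using 3 Const_cancel by (metis of_int_eq_0_iff less_irrefl)
  qed
qed

section \<open>Vertex operators\<close>

text \<open>The polynomials \<open>M k\<close> are the exponents of the creation half, the derivations \<open>a k\<close> those of the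
  annihilation half. Each generator is moved by a constant in at most one degree. This makes every given
  polynomial vanish under all but finitely many coefficients of the annihilation half.\<close>

locale vertex_operator =
  fixes M :: "nat \<Rightarrow> 'v cpoly" and a :: "nat \<Rightarrow> 'v cpoly \<Rightarrow> 'v cpoly"
  assumes derivation: "derivation (a k)" and commute: "a k (a l F) = a l (a k F)"
    and constant_on_Var: "\<exists>w c. \<forall>k\<ge>1. a k (Var v) = (if k = w then Const c else 0)"
begin

sublocale commuting_ops a
  by unfold_locales (simp_all add: derivation_linear[OF derivation] commute)

lemma exp_coeffZ_Const: "j \<noteq> 0 \<Longrightarrow> exp_coeffZ a j (Const c) = 0"
proof (induction "nat j" arbitrary: j rule: less_induct)
  case less
  show ?case
  proof (cases "j < 0")
    case False
    have "a k (exp_coeffZ a (j - int k) (Const c)) = 0" if "k \<ge> 1" for k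
      using less(1)[of "j - int k"] less(2) that False
      by (cases "j = int k") (simp_all add: linear_op_0[OF linear] derivation_Const[OF derivation])
    then have "Const (of_int j) * exp_coeffZ a j (Const c) = Const (of_int j) * 0"
      by (simp add: exp_coeffZ_recurrence[of j "nat j"] linear_op_0[OF linear])
    then show ?thesis
      using less(2) by (metis Const_cancel of_int_eq_0_iff)
  qed (simp add: exp_coeffZ_def)
qed

text \<open>The exponential of the derivations \<open>a k z\<^sup>k\<close> is a homomorphism that maps a generator \<open>x\<close> to
  \<open>x + c z\<^sup>w\<close>. Here this is stated for products with a generator.\<close>

lemma exp_coeffZ_Var_mult:
  "\<exists>w c. \<forall>j F. exp_coeffZ a j (Var v * F) = Var v * exp_coeffZ a j F + Const c * exp_coeffZ a (j - int w) F"
proof -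
  obtain w c where w: "w \<ge> 1" and wc: "\<And>k. k \<ge> 1 \<Longrightarrow> a k (Var v) = (if k = w then Const c else 0)"
  proof -
    obtain w c where *: "\<And>k. k \<ge> 1 \<Longrightarrow> a k (Var v) = (if k = w then Const c else 0)"
      using constant_on_Var[of v] by blast
    show ?thesis
    proof (cases "w = 0")
      case True
      then show ?thesis using that[of 1 0] * by simp
    qed (use that[of w c] * in simp)
  qed
  let ?X = "exp_coeffZ a"
  have "?X j (Var v * F) = Var v * ?X j F + Const c * ?X (j - int w) F" for j F
  proof (induction "nat j" arbitrary: j rule: less_induct)
    case less
    have neg: "?X k G = 0" if "k < 0" for k G
      using that by (simp add: exp_coeffZ_def)
    consider "j < 0" | "j = 0" | "j > 0" by linarith
    then show ?case
    proof cases
      case 3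
      define N where "N = max (nat j) w"
      have N: "j \<le> int N" "j - int w \<le> int N" "w \<le> N" by (auto simp: N_def)
      have IH: "?X (j - int k) (Var v * F) =
          Var v * ?X (j - int k) F + Const c * ?X (j - int w - int k) F" if "k \<ge> 1" for k
        using less[of "j - int k"] that 3 by (simp add: algebra_simps)
      have "Const (of_int j) * ?X j (Var v * F) =
          (\<Sum>k=1..N. (if k = w then Const (of_nat w) * (Const c * ?X (j - int w) F) else 0) +
             Var v * (Const (of_nat k) * a k (?X (j - int k) F)) +
             Const c * (Const (of_nat k) * a k (?X (j - int w - int k) F)))"
        unfolding exp_coeffZ_recurrence[OF N(1)]
      proof (intro sum.cong refl)
        fix k assume "k \<in> {1..N}"
        then have k: "k \<ge> 1" by simp
        show "Const (of_nat k) * a k (?X (j - int k) (Var v * F)) =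
            (if k = w then Const (of_nat w) * (Const c * ?X (j - int w) F) else 0) +
             Var v * (Const (of_nat k) * a k (?X (j - int k) F)) +
             Const c * (Const (of_nat k) * a k (?X (j - int w - int k) F))"
          unfolding IH[OF k] linear_op_add[OF linear] linear_op_scale[OF linear]
            derivation_mult[OF derivation] derivation_Const[OF derivation] wc[OF k]
          by (simp add: algebra_simps)
      qed
      also have "\<dots> = Const (of_nat w) * (Const c * ?X (j - int w) F) +
          Var v * (Const (of_int j) * ?X j F) + Const c * (Const (of_int (j - int w)) * ?X (j - int w) F)"
        using w N by (simp add: sum.distrib exp_coeffZ_recurrence[OF N(1)] exp_coeffZ_recurrence[OF N(2)]
            del: of_int_diff flip: sum_distrib_left)
      also have "\<dots> = Const (of_int j) * (Var v * ?X j F + Const c * ?X (j - int w) F)"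
        by (simp add: Const_diff algebra_simps)
      finally show ?thesis
        using 3 Const_cancel by (metis of_int_eq_0_iff less_irrefl)
    qed (use w in \<open>simp_all add: neg\<close>)
  qed
  then show ?thesis by blast
qed

lemma finite_support: "finite {j. exp_coeffZ a j F \<noteq> 0}"
proof (induction F rule: cpoly_induct)
  case (Const c)
  have "{j. exp_coeffZ a j (Const c) \<noteq> 0} \<subseteq> {0}"
    using exp_coeffZ_Const by blast
  then show ?case by (rule finite_subset) simp
next
  case (add F G)
  have "{j. exp_coeffZ a j (F + G) \<noteq> 0} \<subseteq> {j. exp_coeffZ a j F \<noteq> 0} \<union> {j. exp_coeffZ a j G \<noteq> 0}"
    by (auto simp: linear_op_add[OF exp_coeffZ_linear])
  then show ?case by (rule finite_subset) (use add in simp)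
next
  case (Var v F)
  obtain w c where wc: "\<And>j F. exp_coeffZ a j (Var v * F) =
      Var v * exp_coeffZ a j F + Const c * exp_coeffZ a (j - int w) F"
    using exp_coeffZ_Var_mult by blast
  have "{j. exp_coeffZ a j (Var v * F) \<noteq> 0} \<subseteq>
      {j. exp_coeffZ a j F \<noteq> 0} \<union> (\<lambda>j. j + int w) ` {j. exp_coeffZ a j F \<noteq> 0}"
  proof safe
    fix j assume "exp_coeffZ a j (Var v * F) \<noteq> 0"
      and *: "j \<notin> (\<lambda>j. j + int w) ` {j. exp_coeffZ a j F \<noteq> 0}" and **: "exp_coeffZ a j F = 0"
    then have "exp_coeffZ a (j - int w) F \<noteq> 0" by (auto simp: wc)
    then have "j - int w + int w \<in> (\<lambda>j. j + int w) ` {j. exp_coeffZ a j F \<noteq> 0}" by blast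
    with * show False by simp
  qed
  then show ?case by (rule finite_subset) (use Var in simp)
qed

lemma finite_support_mult: "finite {j. G j * exp_coeffZ a j F \<noteq> 0}"
  by (rule finite_subset[OF _ finite_support[of F]]) auto

definition vop :: "int \<Rightarrow> 'v cpoly \<Rightarrow> 'v cpoly" where
  "vop n = product_coeff (exp_coeff (\<lambda>k F. M k * F)) (exp_coeff a) n"

lemma vop_eq: "vop n F = Sum_any (\<lambda>j. exp_poly M (n + j) * exp_coeffZ a j F)"
proof -
  define J where "J = {j. exp_coeff a j F \<noteq> 0 \<and> n + int j \<ge> 0}"
  have "int ` J \<subseteq> {j. exp_coeffZ a j F \<noteq> 0}"
    by (auto simp: J_def exp_coeffZ_def)
  then have J: "finite J"
    using finite_support finite_subset finite_imageD[of int J] by (metis inj_on_of_nat)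
  have mult: "exp_coeff (\<lambda>k F. M k * F) i G = exp_poly M (int i) * G" for i G
    using exp_coeffZ_mult[of M "int i" G] by (simp add: exp_coeffZ_def)
  have "vop n F = Sum_any (\<lambda>(i, j). if int i - int j = n then exp_poly M (int i) * exp_coeff a j F else 0)"
    unfolding vop_def product_coeff_def mult ..
  also have "\<dots> = (\<Sum>(i, j)\<in>(\<lambda>j. (nat (n + int j), j)) ` J.
      if int i - int j = n then exp_poly M (int i) * exp_coeff a j F else 0)"
    using J by (intro Sum_any.expand_superset) (auto simp: J_def image_iff split: if_splits)
  also have "\<dots> = (\<Sum>j\<in>J. exp_poly M (n + int j) * exp_coeff a j F)"
    by (subst sum.reindex) (auto simp: inj_on_def J_def intro!: sum.cong)
  also have "\<dots> = (\<Sum>j\<in>int ` J. exp_poly M (n + j) * exp_coeffZ a j F)"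
    by (subst sum.reindex) (auto simp: exp_coeffZ_def)
  also have "\<dots> = Sum_any (\<lambda>j. exp_poly M (n + j) * exp_coeffZ a j F)"
  proof (intro Sum_any.expand_superset[symmetric])
    show "{j. exp_poly M (n + j) * exp_coeffZ a j F \<noteq> 0} \<subseteq> int ` J"
    proof safe
      fix j assume j: "exp_poly M (n + j) * exp_coeffZ a j F \<noteq> 0"
      then have "n + j \<ge> 0" "j \<ge> 0"
        by (auto simp: exp_coeffZ_def exp_poly_neg not_less[symmetric])
      with j show "j \<in> int ` J"
        by (auto simp: J_def exp_coeffZ_def image_iff intro!: exI[of _ "nat j"])
    qed
  qed (use J in simp)
  finally show ?thesis .
qed

lemma vop_linear: "linear_op (vop n)"
  unfolding linear_op_def vop_eq linear_op_add[OF exp_coeffZ_linear] linear_op_scale[OF exp_coeffZ_linear]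
    distrib_left
  by (simp add: Sum_any.distrib finite_support_mult Sum_any_right_distrib mult.left_commute)

text \<open>This passes another annihilation half (with the correction term) or a vertex operator of another color
  (with \<open>c = 0\<close>) through a vertex operator, where only the creation half matters for the correction.\<close>

lemma vop_exchange:
  assumes T: "\<And>i. linear_op (T i)"
    and creation: "\<And>i n F. T i (exp_poly M n * F) =
      exp_poly M n * T i F - Const c * (exp_poly M (n - e) * T (i - d) F)"
    and annihilation: "\<And>i j F. T i (exp_coeffZ a j F) = exp_coeffZ a j (T i F)"
  shows "T i (vop n F) = vop n (T i F) - Const c * vop (n - e) (T (i - d) F)"
proof -
  have "T i (vop n F) = Sum_any (\<lambda>j. T i (exp_poly M (n + j) * exp_coeffZ a j F))"
    unfolding vop_eq by (rule linear_op_Sum_any[OF T finite_support_mult])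
  also have "\<dots> = Sum_any (\<lambda>j. exp_poly M (n + j) * exp_coeffZ a j (T i F) +
      Const (- c) * (exp_poly M (n - e + j) * exp_coeffZ a j (T (i - d) F)))"
  proof -
    have "n + j - e = n - e + j" for j by simp
    then show ?thesis
      unfolding creation annihilation by (simp only: Const_uminus) (simp add: algebra_simps)
  qed
  also have "\<dots> = vop n (T i F) + Const (- c) * vop (n - e) (T (i - d) F)"
    unfolding vop_eq
    using finite_support_mult[of _ "T i F"] finite_support_mult[of _ "T (i - d) F"]
    by (subst Sum_any.distrib) (auto simp: Sum_any_right_distrib mult.assoc[symmetric])
  finally show ?thesis by (simp add: Const_uminus)
qed

text \<open>\<open>vop n\<close> creates degree \<open>n + j\<close> after annihilating degree \<open>j\<close>.\<close>

lemma vop_eq_0: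
  assumes "\<And>j. j > r \<Longrightarrow> exp_coeffZ a j F = 0" "n < - r"
  shows "vop n F = 0"
proof -
  have "exp_poly M (n + j) * exp_coeffZ a j F = 0" for j
    using assms by (cases "j > r") (auto simp: exp_poly_neg)
  then show ?thesis by (simp add: vop_eq)
qed

end

subsection \<open>Exchanging two vertex operators\<close>

text \<open>The situation of the two operators of the theorem, for one color. With \<open>w\<close> and \<open>u\<close> as the variables of the
  two generating series \<open>S\<close> and \<open>Q\<close>, the annihilation half of \<open>S\<close> passes the creation half of \<open>Q\<close> with the factor
  \<open>1 - (\<sigma>/q) u\<^sup>d / w\<close>, and the annihilation half of \<open>Q\<close> passes the creation half of \<open>S\<close> with the factor
  \<open>1 - \<sigma> w / u\<^sup>d\<close>.\<close>

locale vertex_pair =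
  S: vertex_operator M a + Q: vertex_operator N b
  for M :: "nat \<Rightarrow> 'v cpoly" and a and N :: "nat \<Rightarrow> 'v cpoly" and b +
  fixes d :: nat and \<sigma> q :: complex
  assumes d: "d > 0" and \<sigma>: "\<sigma> * \<sigma> = 1" and q: "q \<noteq> 0"
    and a_N: "k \<ge> 1 \<Longrightarrow> n \<ge> 1 \<Longrightarrow> a k (N n) = (if n = d * k then Const (- ((\<sigma> / q) ^ k / of_nat k)) else 0)"
    and b_M: "k \<ge> 1 \<Longrightarrow> n \<ge> 1 \<Longrightarrow> b n (M k) = (if n = d * k then Const (- (\<sigma> ^ k / of_nat k)) else 0)"
    and a_b: "a k (b n F) = b n (a k F)"
begin

lemma a_exp_poly_N: "exp_coeffZ a j (exp_poly N i * F) =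
    exp_poly N i * exp_coeffZ a j F - Const (\<sigma> / q) * (exp_poly N (i - int d) * exp_coeffZ a (j - 1) F)"
proof -
  have "a k (exp_poly N i * F) = exp_poly N i * a k F -
      Const ((\<sigma> / q) ^ k / of_nat k) * (exp_poly N (i - int d * int k) * F)" if "k \<ge> 1" for k i F
  proof -
    have "a k (exp_poly N i) = Const (- ((\<sigma> / q) ^ k / of_nat k)) * exp_poly N (i - int (d * k))"
      using that d by (intro derivation_exp_poly[OF S.derivation]) (auto simp: a_N)
    then show ?thesis
      by (simp add: derivation_mult[OF S.derivation] Const_uminus algebra_simps)
  qed
  then show ?thesis
    using S.exp_commutation[of 1 "\<lambda>i F. exp_poly N i * F" "\<sigma> / q" "int d" j i F]
    by (simp add: linear_op_mult)
qed

lemma b_exp_poly_M: "exp_coeffZ b j (exp_poly M i * F) =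
    exp_poly M i * exp_coeffZ b j F - Const \<sigma> * (exp_poly M (i - 1) * exp_coeffZ b (j - int d) F)"
proof -
  have "b n (exp_poly M i * F) = exp_poly M i * b n F - (if d dvd n then
      Const (\<sigma> ^ (n div d) / of_nat (n div d)) * (exp_poly M (i - int (n div d)) * F) else 0)"
    if n: "n \<ge> 1" for n i F
  proof (cases "d dvd n")
    case True
    then obtain k where k: "n = d * k" by blast
    then have k1: "k \<ge> 1" using n by (cases k) auto
    have "b n (exp_poly M i) = Const (- (\<sigma> ^ k / of_nat k)) * exp_poly M (i - int k)"
      using n k1 d k by (intro derivation_exp_poly[OF Q.derivation]) (auto simp: b_M)
    then show ?thesis
      using k d by (simp add: derivation_mult[OF Q.derivation] Const_uminus algebra_simps)
  next
    case False
    have "b n (exp_poly M i) = Const 0 * exp_poly M (i - int 1)"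
      using n False by (intro derivation_exp_poly[OF Q.derivation]) (auto simp: b_M)
    then show ?thesis
      using False by (simp add: derivation_mult[OF Q.derivation])
  qed
  then show ?thesis
    using Q.exp_commutation[of d "\<lambda>i F. exp_poly M i * F" \<sigma> 1 j i F] d
    by (simp add: linear_op_mult)
qed

lemma annihilations_commute: "exp_coeffZ a i (exp_coeffZ b j F) = exp_coeffZ b j (exp_coeffZ a i F)"
  by (rule exp_coeffZ_commute) (unfold_locales, rule a_b)

text \<open>The product in normal order: both annihilation halves act before the creation halves.\<close>

definition normal_ordered :: "int \<Rightarrow> int \<Rightarrow> 'v cpoly \<Rightarrow> 'v cpoly" where
  "normal_ordered i n F = Sum_any (\<lambda>j. exp_poly N (i + j) * S.vop n (exp_coeffZ b j F))"

lemma finite_support_normal_ordered: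
  "finite {j. G j * S.vop n (exp_coeffZ b (j + l) F) \<noteq> 0}"
proof (rule finite_subset)
  show "{j. G j * S.vop n (exp_coeffZ b (j + l) F) \<noteq> 0} \<subseteq> (\<lambda>j. j - l) ` {j. exp_coeffZ b j F \<noteq> 0}"
  proof
    fix j assume "j \<in> {j. G j * S.vop n (exp_coeffZ b (j + l) F) \<noteq> 0}"
    then have "exp_coeffZ b (j + l) F \<noteq> 0"
      using linear_op_0[OF S.vop_linear] by auto
    then show "j \<in> (\<lambda>j. j - l) ` {j. exp_coeffZ b j F \<noteq> 0}"
      by (intro image_eqI[of _ _ "j + l"]) auto
  qed
qed (use Q.finite_support in blast)

lemma Q_vop_S_vop:
  "Q.vop i (S.vop n F) = normal_ordered i n F - Const \<sigma> * normal_ordered (i + int d) (n - 1) F"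
proof -
  have "exp_coeffZ b j (S.vop n F) = S.vop n (exp_coeffZ b j F) -
      Const \<sigma> * S.vop (n - 1) (exp_coeffZ b (j - int d) F)" for j
    using S.vop_exchange[of "exp_coeffZ b", OF Q.exp_coeffZ_linear b_exp_poly_M] annihilations_commute
    by simp
  then have "Q.vop i (S.vop n F) = Sum_any (\<lambda>j. exp_poly N (i + j) * S.vop n (exp_coeffZ b j F) +
      Const (- \<sigma>) * (exp_poly N (i + j) * S.vop (n - 1) (exp_coeffZ b (j - int d) F)))"
    by (simp add: Q.vop_eq Const_uminus right_diff_distrib mult.left_commute)
  also have "\<dots> = normal_ordered i n F +
      Const (- \<sigma>) * Sum_any (\<lambda>j. exp_poly N (i + j) * S.vop (n - 1) (exp_coeffZ b (j - int d) F))"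
    unfolding normal_ordered_def
    using finite_support_normal_ordered[of _ n 0 F] finite_support_normal_ordered[of _ "n - 1" "- int d" F]
    by (subst Sum_any.distrib) (auto simp: Sum_any_right_distrib mult.assoc[symmetric])
  also have "Sum_any (\<lambda>j. exp_poly N (i + j) * S.vop (n - 1) (exp_coeffZ b (j - int d) F)) =
      normal_ordered (i + int d) (n - 1) F"
    unfolding normal_ordered_def
    by (rule Sum_any.reindex_cong[of "\<lambda>j. j + int d"])
      (auto simp: fun_eq_iff add_ac intro!: bij_betw_byWitness[where f' = "\<lambda>j. j - int d"])
  finally show ?thesis by (simp add: Const_uminus)
qed

lemma S_vop_Q_vop:
  "S.vop n (Q.vop i F) = normal_ordered i n F - Const (\<sigma> / q) * normal_ordered (i - int d) (n + 1) F"
proof -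
  have mult: "S.vop n (exp_poly N i * F) =
      exp_poly N i * S.vop n F - Const (\<sigma> / q) * (exp_poly N (i - int d) * S.vop (n + 1) F)" for i F
  proof -
    have "S.vop n (exp_poly N i * F) = Sum_any (\<lambda>j. exp_poly N i * (exp_poly M (n + j) * exp_coeffZ a j F) +
        Const (- (\<sigma> / q)) * (exp_poly N (i - int d) * (exp_poly M (n + j) * exp_coeffZ a (j - 1) F)))"
      unfolding S.vop_eq a_exp_poly_N by (simp only: Const_uminus) (simp add: algebra_simps)
    also have "\<dots> = exp_poly N i * S.vop n F + Const (- (\<sigma> / q)) * (exp_poly N (i - int d) *
        Sum_any (\<lambda>j. exp_poly M (n + j) * exp_coeffZ a (j - 1) F))"
    proof -
      have "{j. G j * exp_coeffZ a (j - 1) F \<noteq> 0} \<subseteq> (\<lambda>j. j + 1) ` {j. exp_coeffZ a j F \<noteq> 0}" for G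
        by (auto intro!: image_eqI[of _ _ "_ - 1"])
      then have "finite {j. G j * exp_coeffZ a (j - 1) F \<noteq> 0}" for G
        using finite_subset S.finite_support by blast
      then show ?thesis
        using S.finite_support_mult[of _ F]
        unfolding S.vop_eq
        by (subst Sum_any.distrib) (auto simp: Sum_any_right_distrib mult.assoc[symmetric])
    qed
    also have "Sum_any (\<lambda>j. exp_poly M (n + j) * exp_coeffZ a (j - 1) F) = S.vop (n + 1) F"
      unfolding S.vop_eq
      by (rule Sum_any.reindex_cong[of "\<lambda>j. j + 1"])
        (auto simp: fun_eq_iff add_ac intro!: bij_betw_byWitness[where f' = "\<lambda>j. j - 1"])
    finally show ?thesis by (simp add: Const_uminus)
  qed
  have "S.vop n (Q.vop i F) = Sum_any (\<lambda>j. S.vop n (exp_poly N (i + j) * exp_coeffZ b j F))"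
    unfolding Q.vop_eq by (rule linear_op_Sum_any[OF S.vop_linear Q.finite_support_mult])
  also have "\<dots> = Sum_any (\<lambda>j. exp_poly N (i + j) * S.vop n (exp_coeffZ b j F) +
      Const (- (\<sigma> / q)) * (exp_poly N (i - int d + j) * S.vop (n + 1) (exp_coeffZ b j F)))"
  proof -
    have "i + j - int d = i - int d + j" for j by simp
    then show ?thesis unfolding mult by (simp only: Const_uminus) (simp add: algebra_simps)
  qed
  also have "\<dots> = normal_ordered i n F + Const (- (\<sigma> / q)) * normal_ordered (i - int d) (n + 1) F"
    unfolding normal_ordered_def
    using finite_support_normal_ordered[of _ n 0 F] finite_support_normal_ordered[of _ "n + 1" 0 F]
    by (subst Sum_any.distrib) (auto simp: Sum_any_right_distrib mult.assoc[symmetric])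
  finally show ?thesis by (simp add: Const_uminus)
qed

text \<open>With \<open>y = \<sigma> w / u\<^sup>d\<close>, the two orders of the operators differ by the factor
  \<open>(1 - y) / (1 - 1 / (q y)) = \<Sum>\<^sub>t A(q; t) y\<^sup>t\<close>, expanded in positive powers of \<open>y\<close>. In terms of normal
  ordered products the partial sums of this series telescope. The remainder contains \<open>S.vop (n - L)\<close>, whose
  index is so negative that it annihilates everything obtained from \<open>F\<close> by the annihilation half of \<open>Q\<close>.\<close>

lemma Q_S_exchange:
  assumes bounded: "\<And>j. j > r \<Longrightarrow> exp_coeffZ a j F = 0"
    and L: "int L > n + r" "L \<ge> 1"
  shows "Q.vop i (S.vop n F) =
    (\<Sum>t=1..L. Const (A_factor q t * \<sigma> ^ t) * S.vop (n - int t) (Q.vop (i + int d * int t) F))"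
proof -
  define T where "T t = Const (\<sigma> ^ t) * normal_ordered (i + int d * int t) (n - int t) F" for t
  have SQ: "Const (\<sigma> ^ Suc t) * S.vop (n - int (Suc t)) (Q.vop (i + int d * int (Suc t)) F) =
      T (Suc t) - Const (1 / q) * T t" for t
  proof -
    have "\<sigma> ^ Suc t * (\<sigma> / q) = (\<sigma> * \<sigma>) * \<sigma> ^ t / q" by simp
    also have "\<dots> = 1 / q * \<sigma> ^ t" by (simp only: \<sigma>) simp
    finally have "Const (\<sigma> ^ Suc t) * (Const (\<sigma> / q) * G) = Const (1 / q) * (Const (\<sigma> ^ t) * G)"
      for G :: "'v cpoly"
      by (simp only: Const_mult_assoc)
    moreover have "i + int d * int (Suc t) - int d = i + int d * int t" "n - int (Suc t) + 1 = n - int t"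
      by (simp_all add: algebra_simps)
    ultimately show ?thesis
      by (simp only: S_vop_Q_vop T_def right_diff_distrib)
  qed
  have partial_sum: "(\<Sum>t=1..L. Const (A_factor q t * \<sigma> ^ t) * S.vop (n - int t) (Q.vop (i + int d * int t) F))
      = T 0 - T 1 + Const (q ^ (L - 1) - q ^ L) * T L"
    using L(2)
  proof (induction L rule: dec_induct)
    case base
    have "Const (A_factor q 1 * \<sigma> ^ 1) * S.vop (n - int 1) (Q.vop (i + int d * int 1) F) =
        Const (- q) * (T 1 - Const (1 / q) * T 0)"
      using arg_cong[OF SQ[of 0], of "\<lambda>G. Const (- q) * G"] by (simp add: A_factor_def Const_mult_assoc)
    also have "\<dots> = T 0 - Const q * T 1"
      using q by (simp add: right_diff_distrib Const_mult_assoc Const_uminus)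
    finally show ?case
      by (simp add: Const_diff algebra_simps)
  next
    case (step L)
    have A: "A_factor q (Suc L) = q ^ L - q ^ Suc L"
      using step(1) q by (simp add: A_factor_def field_simps)
    have q': "(q ^ L - q ^ Suc L) * (1 / q) = q ^ (L - 1) - q ^ L"
      using step(1) q by (cases L) (simp_all add: field_simps)
    have "Const (A_factor q (Suc L) * \<sigma> ^ Suc L) * S.vop (n - int (Suc L)) (Q.vop (i + int d * int (Suc L)) F)
        = Const (q ^ L - q ^ Suc L) * (T (Suc L) - Const (1 / q) * T L)"
      by (simp only: A Const_mult mult.assoc SQ[unfolded Const_mult])
    also have "\<dots> = Const (q ^ L - q ^ Suc L) * T (Suc L) - Const (q ^ (L - 1) - q ^ L) * T L"
      by (simp only: right_diff_distrib Const_mult_assoc q')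
    finally show ?case
      using step by simp
  qed
  have "T L = 0"
  proof -
    have "exp_coeffZ a k (exp_coeffZ b j F) = 0" if "k > r" for k j
      using bounded[OF that] by (simp add: annihilations_commute linear_op_0[OF Q.exp_coeffZ_linear])
    then have "S.vop (n - int L) (exp_coeffZ b j F) = 0" for j
      using L(1) by (intro S.vop_eq_0[of r]) auto
    then show ?thesis by (simp add: T_def normal_ordered_def)
  qed
  then show ?thesis
    unfolding partial_sum by (simp add: T_def Q_vop_S_vop)
qed

end

section \<open>Orbits of periodic points\<close>

lemma
  assumes n: "n > 0" "(f ^^ n) x = x"
  shows card_periodic_orbit_pos: "card (orbit_of f x) > 0"
    and card_periodic_orbit_dvd: "card (orbit_of f x) dvd n"
    and funpow_card_periodic_orbit: "(f ^^ card (orbit_of f x)) x = x"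
proof -
  define d where "d = (LEAST d. d > 0 \<and> (f ^^ d) x = x)"
  have d: "d > 0" "(f ^^ d) x = x"
    using LeastI[of "\<lambda>d. d > 0 \<and> (f ^^ d) x = x" n] n by (auto simp: d_def)
  have least: "(f ^^ i) x \<noteq> x" if "0 < i" "i < d" for i
    using not_less_Least[of i "\<lambda>d. d > 0 \<and> (f ^^ d) x = x"] that by (auto simp: d_def)
  have orbit: "orbit_of f x = (\<lambda>i. (f ^^ i) x) ` {..<d}"
  proof -
    have "(f ^^ i) x = (f ^^ (i mod d)) x" for i
      using funpow_mod_eq[OF d(2)] by simp
    then show ?thesis using d(1) by (force simp: orbit_of_def)
  qed
  have "(f ^^ i) x \<noteq> (f ^^ j) x" if "i < j" "j < d" for i j
  proof
    assume "(f ^^ i) x = (f ^^ j) x"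
    then have "(f ^^ (d - j)) ((f ^^ i) x) = (f ^^ (d - j)) ((f ^^ j) x)" by simp
    then have "(f ^^ (d - j + i)) x = (f ^^ (d - j + j)) x"
      unfolding funpow_add by simp
    then have "(f ^^ (d - j + i)) x = x" using that d(2) by simp
    moreover have "0 < d - j + i" "d - j + i < d" using that by auto
    ultimately show False using least[of "d - j + i"] by simp
  qed
  then have "inj_on (\<lambda>i. (f ^^ i) x) {..<d}"
    by (intro linorder_inj_onI') auto
  then have card: "card (orbit_of f x) = d"
    by (simp add: orbit card_image)
  show "card (orbit_of f x) > 0" "(f ^^ card (orbit_of f x)) x = x"
    using d by (auto simp: card)
  have "(f ^^ (n mod d)) x = x"
    using funpow_mod_eq[OF d(2), of n] n(2) by simp
  then have "\<not> 0 < n mod d"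
    using least[of "n mod d"] d(1) by auto
  then show "card (orbit_of f x) dvd n"
    by (simp add: card dvd_eq_mod_eq_0)
qed

lemma orbit_of_funpow:
  assumes "n > 0" "(f ^^ n) x = x"
  shows "orbit_of f ((f ^^ i) x) = orbit_of f x"
proof
  show "orbit_of f ((f ^^ i) x) \<subseteq> orbit_of f x"
    unfolding orbit_of_def by (auto simp flip: funpow_add comp_apply[of "_ ^^ _"])
  have "(f ^^ (n * i)) x = x"
    using funpow_mod_eq[OF assms(2), of "n * i"] by simp
  then have "(f ^^ (j + n * i)) x = (f ^^ j) x" for j
    by (simp add: funpow_add)
  moreover have "i \<le> n * i" using assms(1) by simp
  then have "j + n * i = (j + (n * i - i)) + i" for j by linarith
  ultimately have "(f ^^ ((j + (n * i - i)) + i)) x = (f ^^ j) x" for j by metis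
  then have eq: "(f ^^ (j + (n * i - i))) ((f ^^ i) x) = (f ^^ j) x" for j
    by (simp only: funpow_add comp_apply)
  show "orbit_of f x \<subseteq> orbit_of f ((f ^^ i) x)"
  proof
    fix y assume "y \<in> orbit_of f x"
    then obtain j where "y = (f ^^ j) x" by (auto simp: orbit_of_def)
    then show "y \<in> orbit_of f ((f ^^ i) x)"
      unfolding orbit_of_def by (auto simp: eq[of j] intro!: exI[of _ "j + (n * i - i)"])
  qed
qed

lemma orbit_of_refl: "x \<in> orbit_of f x"
  by (auto simp: orbit_of_def intro!: exI[of _ 0])

lemma orbit_of_eq:
  assumes "n > 0" "(f ^^ n) x = x" "y \<in> orbit_of f x"
  shows "orbit_of f y = orbit_of f x"
  using assms orbit_of_funpow[OF assms(1,2)] by (auto simp: orbit_of_def[of f x])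

section \<open>The finite subfields of the algebraic closure\<close>

lemma CARD_finite_field_gt_1: "CARD('a::finite_field) > 1"
proof -
  have "card {0, 1 :: 'a} \<le> CARD('a)" by (rule card_mono) auto
  then show ?thesis by simp
qed

lemma CARD_power_gt_1: "n > 0 \<Longrightarrow> CARD('a::finite_field) ^ n > 1"
  using CARD_finite_field_gt_1 by (rule one_less_power)

lemma of_nat_CARD_alg_closure: "of_nat CARD('a) = (0 :: 'a::finite_field alg_closure)"
proof -
  have "(\<Sum>x\<in>(UNIV::'a set). x + 1) = (\<Sum>x\<in>UNIV. x)"
    by (rule sum.reindex_bij_witness[of _ "\<lambda>x. x - 1" "\<lambda>x. x + 1"]) auto
  then have "of_nat CARD('a) = (0 :: 'a)" by (simp add: sum.distrib)
  then show ?thesis by (metis to_ac_0 to_ac_of_nat)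
qed

text \<open>The binomial coefficients that would spoil additivity vanish because \<open>(1 + x) ^ q - x ^ q - 1\<close> has
  degree less than \<open>q\<close> but vanishes on all \<open>q\<close> elements of the finite field.\<close>

lemma frobenius_add:
  fixes x y :: "'a::finite_field alg_closure"
  shows "(x + y) ^ CARD('a) = x ^ CARD('a) + y ^ CARD('a)"
proof -
  let ?q = "CARD('a)"
  have q: "?q > 1" by (rule CARD_finite_field_gt_1)
  define p where "p = (\<Sum>k\<in>{0<..<?q}. monom (of_nat (?q choose k)) k :: 'a poly)"
  have split: "(\<Sum>k\<le>?q. h k) = h 0 + (\<Sum>k\<in>{0<..<?q}. h k) + h ?q" for h :: "nat \<Rightarrow> 'b::comm_monoid_add"
  proof -
    have "{..?q} = insert 0 (insert ?q {0<..<?q})" using q by auto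
    then show ?thesis using q by (simp add: add_ac)
  qed
  have "poly p z = 0" for z
  proof -
    have "(z + 1) ^ ?q = (\<Sum>k\<le>?q. of_nat (?q choose k) * z ^ k * 1 ^ (?q - k))"
      by (rule binomial_ring)
    also have "\<dots> = 1 + poly p z + z ^ ?q"
      by (simp add: split p_def poly_sum poly_monom)
    finally show ?thesis
      by (simp add: finite_field_power_card_eq_same)
  qed
  moreover have "degree p < ?q"
  proof -
    have "degree p \<le> ?q - 1"
      unfolding p_def by (rule degree_sum_le) (auto intro: order.trans[OF degree_monom_le])
    then show ?thesis using q by simp
  qed
  ultimately have "p = 0"
    using card_poly_roots_bound[of p] by (cases "p = 0") auto
  have "of_nat (?q choose k) = (0 :: 'a alg_closure)" if "0 < k" "k < ?q" for k
  proof -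
    have "coeff p k = of_nat (?q choose k)"
      using that unfolding p_def by (simp add: coeff_sum)
    then show ?thesis
      using \<open>p = 0\<close> by (metis coeff_0 to_ac_0 to_ac_of_nat)
  qed
  then have "(\<Sum>k\<in>{0<..<?q}. of_nat (?q choose k) * x ^ k * y ^ (?q - k)) = 0"
    by (intro sum.neutral) auto
  then show ?thesis
    unfolding binomial_ring split by (simp add: add.commute)
qed

lemma frob_power: "(frob ^^ i) x = x ^ (CARD('a) ^ i)" for x :: "'a::finite_field alg_closure"
  by (induction i) (simp_all add: frob_def mult.commute flip: power_mult)

lemma frob_power_add: "(frob ^^ i) (x + y) = (frob ^^ i) x + (frob ^^ i) y"
  for x y :: "'a::finite_field alg_closure"
  by (induction i) (simp_all add: frob_def frobenius_add)

lemma inj_frob: "inj (frob :: 'a::finite_field alg_closure \<Rightarrow> _)"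
proof (rule injI)
  fix x y :: "'a alg_closure" assume "frob x = frob y"
  then have "(x - y) ^ CARD('a) = 0"
    using frobenius_add[of "x - y" y] by (simp add: frob_def)
  then show "x = y" by simp
qed

text \<open>The powers of an element \<open>x\<close> lie in the finite set of values at \<open>x\<close> of the polynomials of bounded
  degree, so two of the iterates of \<open>x\<close> under the injective Frobenius map coincide.\<close>

lemma alg_closure_periodic:
  fixes x :: "'a::finite_field alg_closure"
  obtains n where "n > 0" "(frob ^^ n) x = x"
proof -
  obtain p :: "'a poly" where p: "p \<noteq> 0" "poly (map_poly to_ac p) x = 0"
    using alg_closure_algebraic by blast
  have deg: "degree p > 0"
  proof (rule ccontr)
    assume "\<not> degree p > 0"
    then obtain c where "p = [:c:]" using degree_eq_zeroE by blast
    then show False using p by (auto simp: map_poly_pCons)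
  qed
  let ?V = "(\<lambda>r. poly (map_poly to_ac r) x) ` {r :: 'a poly. degree r \<le> degree p}"
  have "finite {r :: 'a poly. degree r \<le> degree p}"
  proof (rule finite_subset)
    show "{r :: 'a poly. degree r \<le> degree p} \<subseteq> Poly ` {xs. set xs \<subseteq> UNIV \<and> length xs \<le> Suc (degree p)}"
    proof
      fix r :: "'a poly" assume "r \<in> {r. degree r \<le> degree p}"
      moreover have "length (coeffs r) \<le> Suc (degree r)"
        by (cases "r = 0") (auto simp: length_coeffs_degree)
      ultimately show "r \<in> Poly ` {xs. set xs \<subseteq> UNIV \<and> length xs \<le> Suc (degree p)}"
        by (intro image_eqI[of _ _ "coeffs r"]) auto
    qed
    show "finite (Poly ` {xs :: 'a list. set xs \<subseteq> UNIV \<and> length xs \<le> Suc (degree p)})"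
      by (intro finite_imageI finite_lists_length_le) simp
  qed
  then have fin: "finite ?V" by simp
  have "x ^ m \<in> ?V" for m
  proof -
    define r where "r = monom 1 m mod p"
    have "monom 1 m = p * (monom 1 m div p) + r" by (simp add: r_def)
    then have "map_poly to_ac (monom 1 m) = map_poly to_ac (p * (monom 1 m div p) + r)" by simp
    also have "\<dots> = map_poly to_ac p * map_poly to_ac (monom 1 m div p) + map_poly to_ac r"
      by (intro poly_eqI) (simp add: coeff_map_poly coeff_mult to_ac_sum)
    finally have "poly (map_poly to_ac (monom 1 m)) x = poly (map_poly to_ac r) x"
      using p(2) by simp
    moreover have "map_poly to_ac (monom (1::'a) m) = monom 1 m"
      by (intro poly_eqI) (simp add: coeff_map_poly)
    moreover have "degree r \<le> degree p"
      using degree_mod_less[OF p(1), of "monom 1 m"] by (auto simp: r_def)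
    ultimately show ?thesis by (auto simp: poly_monom)
  qed
  then have "range (\<lambda>i. (frob ^^ i) x) \<subseteq> ?V"
    by (auto simp: frob_power)
  then have "finite (range (\<lambda>i. (frob ^^ i) x))"
    using fin finite_subset by blast
  then have "\<not> inj (\<lambda>i. (frob ^^ i) x)"
    using finite_imageD infinite_UNIV_nat by blast
  then obtain i j where ij: "i < j" "(frob ^^ i) x = (frob ^^ j) x"
    unfolding inj_def by (metis linorder_neqE_nat)
  have "(frob ^^ i) ((frob ^^ (j - i)) x) = (frob ^^ (i + (j - i))) x"
    by (simp only: funpow_add comp_apply)
  then have "(frob ^^ i) ((frob ^^ (j - i)) x) = (frob ^^ i) x"
    using ij by simp
  then have "(frob ^^ (j - i)) x = x"
    by (rule injD[OF inj_fn[OF inj_frob]])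
  then show ?thesis using that[of "j - i"] ij by simp
qed

lemma units_level_iff_frob: "x \<in> units_level n \<longleftrightarrow> x \<noteq> 0 \<and> (frob ^^ n) x = x"
  by (simp add: units_level_def frob_power)

lemma units_level_iff_root:
  fixes x :: "'a::finite_field alg_closure"
  assumes "n > 0"
  shows "x \<in> units_level n \<longleftrightarrow> x ^ (CARD('a) ^ n - 1) = 1"
proof -
  have "x ^ (CARD('a) ^ n) = x * x ^ (CARD('a) ^ n - 1)"
    using CARD_power_gt_1[OF assms, where 'a = 'a] by (simp flip: power_Suc)
  then show ?thesis
    using CARD_power_gt_1[OF assms, where 'a = 'a]
    by (auto simp: units_level_def power_0_left)
qed

text \<open>The units of level \<open>n\<close> are the roots of \<open>x ^ m - 1\<close> with \<open>m = q ^ n - 1\<close>. They are simple, because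
  \<open>m = - 1\<close> in the field, so that the derivative \<open>- x ^ (m - 1)\<close> vanishes at \<open>0\<close> only.\<close>

lemma
  fixes n :: nat
  assumes n: "n > 0"
  shows card_units_level: "card (units_level n :: 'a::finite_field alg_closure set) = CARD('a) ^ n - 1"
    and finite_units_level: "finite (units_level n :: 'a alg_closure set)"
proof -
  define m where "m = CARD('a) ^ n - 1"
  have m: "m > 0" using CARD_power_gt_1[OF n, where 'a = 'a] by (simp add: m_def)
  define p :: "'a alg_closure poly" where "p = monom 1 m - 1"
  have "coeff p m = 1" using m by (simp add: p_def)
  then have p0: "p \<noteq> 0" by auto
  have deg: "degree p = m"
  proof (rule antisym)
    show "degree p \<le> m" unfolding p_def by (intro degree_diff_le) (auto simp: degree_monom_le)
    show "m \<le> degree p" by (rule le_degree) (simp add: \<open>coeff p m = 1\<close>)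
  qed
  have roots: "{x. poly p x = 0} = units_level n"
    using n by (auto simp: p_def poly_monom units_level_iff_root m_def)
  have of_nat_m: "of_nat m = (-1 :: 'a alg_closure)"
  proof -
    have "of_nat (Suc m) = (0 :: 'a alg_closure)"
      using CARD_power_gt_1[OF n, where 'a = 'a] n
      by (simp add: m_def of_nat_CARD_alg_closure del: of_nat_Suc)
    then show ?thesis by (simp add: add_eq_0_iff)
  qed
  have simple: "order x p \<le> 1" for x
  proof (rule ccontr)
    assume "\<not> order x p \<le> 1"
    then have "[:- x, 1:] ^ 2 dvd p"
      using order_1[of x p] by (metis dvd_trans le_imp_power_dvd not_less_eq_eq numeral_2_eq_2 One_nat_def)
    then obtain r where r: "p = [:- x, 1:] ^ 2 * r" by blast
    define l where "l = [:- x, 1:]"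
    have "poly l x = 0" "p = l * (l * r)" by (simp add: l_def) (simp only: r power2_eq_square mult.assoc l_def)
    then have "poly (pderiv p) x = 0"
      by (simp add: pderiv_mult)
    then have "x ^ (m - 1) = 0"
      by (simp add: p_def pderiv_diff pderiv_monom poly_monom of_nat_m)
    then have "x = 0" by simp
    moreover have "poly p x = 0" by (simp add: r)
    ultimately show False using m by (simp add: p_def poly_monom power_0_left)
  qed
  obtain A where A: "size A = m" "p = smult (lead_coeff p) (\<Prod>x\<in>#A. [:- x, 1:])"
    using alg_closed_imp_factorization[OF p0] deg by auto
  have "proots (\<Prod>x\<in>#A. [:- x, 1:]) = A"
  proof (induction A)
    case (add x A)
    have "(\<Prod>x\<in>#A. [:- x, 1:]) \<noteq> 0" by (auto simp: prod_mset_zero_iff)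
    then show ?case
      using add by (simp add: proots_mult del: mult_pCons_left)
  qed simp
  then have proots: "proots p = A"
    using A(2) p0 by (metis leading_coeff_0_iff proots_smult)
  have "count A x = (if x \<in># A then 1 else 0)" for x
    using simple[of x] p0 order_root[of p x] by (auto simp flip: proots)
  then have "A = mset_set (set_mset A)"
    by (intro multiset_eqI) simp
  then have "card (set_mset A) = m"
    using A(1) by (metis size_mset_set)
  moreover have "set_mset A = units_level n"
    using p0 by (simp add: roots flip: proots)
  ultimately show "card (units_level n :: 'a alg_closure set) = CARD('a) ^ n - 1"
    "finite (units_level n :: 'a alg_closure set)"
    using m by (auto simp: m_def intro: card_ge_0_finite)
qed

lemma
  shows one_in_units_level: "1 \<in> units_level n"
    and mult_in_units_level: "x \<in> units_level n \<Longrightarrow> y \<in> units_level n \<Longrightarrow> x * y \<in> units_level n"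
    and power_in_units_level: "x \<in> units_level n \<Longrightarrow> x ^ i \<in> units_level n"
  by (auto simp: units_level_def power_mult_distrib simp flip: power_mult)
     (metis mult.commute power_mult)

lemma power_mod_period:
  fixes x :: "'b::monoid_mult"
  assumes "x ^ m = 1"
  shows "x ^ (i mod m) = x ^ i"
proof -
  have "x ^ i = x ^ (m * (i div m) + i mod m)" by simp
  also have "\<dots> = x ^ (i mod m)" by (simp only: power_add power_mult assms power_one mult_1)
  finally show ?thesis ..
qed

text \<open>The fixed points of the \<open>n\<close>-th power of Frobenius form a finite field, so its group of units is cyclic.\<close>

lemma units_level_cyclic:
  assumes n: "n > 0"
  obtains g :: "'a::finite_field alg_closure" where "g \<in> units_level n"
    "bij_betw (\<lambda>i. g ^ i) {..<CARD('a) ^ n - 1} (units_level n)"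
proof -
  let ?m = "CARD('a) ^ n - 1"
  have m: "?m > 0" using CARD_power_gt_1[OF n, where 'a = 'a] by simp
  let ?K = "{x :: 'a alg_closure. (frob ^^ n) x = x}"
  define K where "K = ?K"
  define R :: "'a alg_closure ring" where "R = \<lparr>carrier = K, monoid.mult = (*), one = 1, ring.zero = 0, add = (+)\<rparr>"
  have K: "K = insert 0 (units_level n)"
    using CARD_finite_field_gt_1[where 'a = 'a]
    by (auto simp: K_def units_level_iff_frob frob_power power_0_left)
  have closed: "0 \<in> K" "1 \<in> K" "x \<in> K \<Longrightarrow> y \<in> K \<Longrightarrow> x + y \<in> K" "x \<in> K \<Longrightarrow> y \<in> K \<Longrightarrow> x * y \<in> K" for x y
    using one_in_units_level[of n] mult_in_units_level[of x n y]
    by (auto simp: K) (auto simp: frob_power_add units_level_iff_frob)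
  have neg: "- x \<in> K" if "x \<in> K" for x
  proof -
    have "(frob ^^ n) (- x) + (frob ^^ n) x = 0"
      using CARD_finite_field_gt_1[where 'a = 'a]
      by (simp add: frob_power_add[symmetric]) (simp add: frob_power power_0_left)
    then have "(frob ^^ n) (- x) = - (frob ^^ n) x" by (simp add: eq_neg_iff_add_eq_0)
    then show ?thesis using that by (simp add: K_def)
  qed
  have inv: "inverse x \<in> K" if "x \<in> K" for x
    using that by (simp add: K_def frob_power power_inverse)
  have "\<exists>y\<in>K. y + x = 0 \<and> x + y = 0" if "x \<in> K" for x
    using neg[OF that] by (intro bexI[of _ "- x"]) auto
  moreover have "\<exists>y\<in>K. y * x = 1 \<and> x * y = 1" if "x \<in> K" "x \<noteq> 0" for x
    using inv[OF that(1)] that(2) by (intro bexI[of _ "inverse x"]) auto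
  ultimately have "field R"
    unfolding R_def
    by unfold_locales (auto simp: Units_def closed algebra_simps)
  then interpret R: field R .
  have "finite (carrier R)"
    using finite_units_level[OF n, where 'a = 'a] K by (simp add: R_def)
  from R.finite_field_mult_group_has_gen[OF this] obtain g where g: "g \<in> carrier (mult_of R)"
    "carrier (mult_of R) = {g [^]\<^bsub>R\<^esub> i |i::nat. i \<in> UNIV}" by (elim bexE) simp
  have pow: "x [^]\<^bsub>R\<^esub> i = x ^ i" for x and i :: nat
    by (induction i) (simp_all add: R_def mult.commute)
  have U: "carrier (mult_of R) = units_level n"
  proof -
    have "carrier (mult_of R) = insert 0 (units_level n) - {0}" by (simp add: R_def K)
    also have "\<dots> = units_level n" by (auto simp: units_level_def)
    finally show ?thesis .
  qed
  have gU: "g \<in> units_level n"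
    using g(1) by (simp only: U)
  have gen: "units_level n = range (\<lambda>i. g ^ i)"
    using g(2) unfolding U pow by blast
  have gm: "g ^ ?m = 1" using gU n by (simp add: units_level_iff_root)
  have "g ^ i = g ^ (i mod ?m)" for i
    using power_mod_period[OF gm] by simp
  then have "range (\<lambda>i. g ^ i) = (\<lambda>i. g ^ i) ` {..<?m}"
    using m by (force intro: mod_less_divisor)
  then have img: "(\<lambda>i. g ^ i) ` {..<?m} = units_level n" using gen by simp
  moreover have "inj_on (\<lambda>i. g ^ i) {..<?m}"
  proof (rule eq_card_imp_inj_on)
    show "card ((\<lambda>i. g ^ i) ` {..<?m}) = card {..<?m}"
      unfolding img by (simp add: card_units_level[OF n])
  qed simp
  ultimately show ?thesis using that gU by (auto simp: bij_betw_def)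
qed

section \<open>Characters of the unit groups\<close>

lemma character_nonzero: "\<xi> \<in> characters n \<Longrightarrow> x \<in> units_level n \<Longrightarrow> \<xi> x \<noteq> 0"
  and character_mult: "\<xi> \<in> characters n \<Longrightarrow> x \<in> units_level n \<Longrightarrow> y \<in> units_level n \<Longrightarrow>
    \<xi> (x * y) = \<xi> x * \<xi> y"
  and character_outside: "\<xi> \<in> characters n \<Longrightarrow> x \<notin> units_level n \<Longrightarrow> \<xi> x = 0"
  by (auto simp: characters_def)

lemma character_one:
  assumes "\<xi> \<in> characters n"
  shows "\<xi> 1 = 1"
  using character_mult[OF assms one_in_units_level one_in_units_level]
    character_nonzero[OF assms one_in_units_level] by simp

lemma character_power:
  assumes "\<xi> \<in> characters n" "x \<in> units_level n"
  shows "\<xi> (x ^ i) = \<xi> x ^ i"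
  by (induction i)
    (simp_all add: character_one[OF assms(1)] character_mult[OF assms(1)] assms(2) power_in_units_level)

lemma character_root_of_unity:
  fixes \<xi> :: "'a::finite_field alg_closure \<Rightarrow> complex"
  assumes "n > 0" "\<xi> \<in> characters n" "x \<in> units_level n"
  shows "\<xi> x ^ (CARD('a) ^ n - 1) = 1"
  using assms character_power[OF assms(2,3), of "CARD('a) ^ n - 1"]
  by (simp add: units_level_iff_root character_one)

lemma character_cnj:
  fixes \<xi> :: "'a::finite_field alg_closure \<Rightarrow> complex"
  assumes "n > 0" "\<xi> \<in> characters n" "x \<in> units_level n"
  shows "\<xi> x * cnj (\<xi> x) = 1"
proof -
  have "norm (\<xi> x) ^ (CARD('a) ^ n - 1) = 1"
    using character_root_of_unity[OF assms] by (metis norm_one norm_power)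
  then have "norm (\<xi> x) = 1"
    using CARD_power_gt_1[OF assms(1), where 'a = 'a]
      power_eq_imp_eq_base[of "norm (\<xi> x)" "CARD('a) ^ n - 1" 1] by simp
  then show ?thesis using complex_norm_square[of "\<xi> x"] by simp
qed

lemma characters_eqI:
  assumes "\<xi> \<in> characters n" "\<eta> \<in> characters n" "\<And>x. x \<in> units_level n \<Longrightarrow> \<xi> x = \<eta> x"
  shows "\<xi> = \<eta>"
proof
  fix x
  show "\<xi> x = \<eta> x"
    using assms(3) character_outside[OF assms(1)] character_outside[OF assms(2)]
    by (cases "x \<in> units_level n") auto
qed

lemma characters_times:
  "\<xi> \<in> characters n \<Longrightarrow> \<eta> \<in> characters n \<Longrightarrow> (\<lambda>x. \<xi> x * \<eta> x) \<in> characters n"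
  by (simp add: characters_def)

lemma characters_power:
  "\<xi> \<in> characters n \<Longrightarrow> i > 0 \<Longrightarrow> (\<lambda>x. \<xi> x ^ i) \<in> characters n"
  by (auto simp: characters_def power_mult_distrib)

text \<open>A character is given by the image, a root of unity, of a generator of the cyclic group.\<close>

lemma bij_betw_characters_roots:
  assumes n: "n > 0" and g: "g \<in> units_level n"
    "bij_betw (\<lambda>i. g ^ i) {..<CARD('a) ^ n - 1} (units_level n :: 'a::finite_field alg_closure set)"
  shows "bij_betw (\<lambda>\<xi>. \<xi> g) (characters n) {z. z ^ (CARD('a) ^ n - 1) = 1}"
proof (rule bij_betwI')
  fix \<xi> \<eta> :: "'a alg_closure \<Rightarrow> complex" assume \<xi>: "\<xi> \<in> characters n" "\<eta> \<in> characters n"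
  have "\<xi> x = \<eta> x" if eq: "\<xi> g = \<eta> g" and x: "x \<in> units_level n" for x
  proof -
    obtain i where "x = g ^ i" using x g(2) by (auto simp: bij_betw_def)
    then show ?thesis using eq \<xi> g(1) by (simp add: character_power)
  qed
  then show "\<xi> g = \<eta> g \<longleftrightarrow> \<xi> = \<eta>"
    using characters_eqI \<xi> by blast
next
  fix \<xi> :: "'a alg_closure \<Rightarrow> complex" assume "\<xi> \<in> characters n"
  then show "\<xi> g \<in> {z. z ^ (CARD('a) ^ n - 1) = 1}"
    using character_root_of_unity n g(1) by blast
next
  fix z :: complex assume "z \<in> {z. z ^ (CARD('a) ^ n - 1) = 1}"
  then have z: "z ^ (CARD('a) ^ n - 1) = 1" by simp
  let ?m = "CARD('a) ^ n - 1"
  have m: "?m > 0" using CARD_power_gt_1[OF n, where 'a = 'a] by simp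
  have gm: "g ^ ?m = 1" using g(1) n by (simp add: units_level_iff_root)
  define log where "log = the_inv_into {..<?m} (\<lambda>i. g ^ i)"
  have log: "log x < ?m" "g ^ log x = x" if "x \<in> units_level n" for x
    using that g(2) the_inv_into_into[of "\<lambda>i. g ^ i" "{..<?m}" x "{..<?m}"]
      f_the_inv_into_f[of "\<lambda>i. g ^ i" "{..<?m}" x]
    by (auto simp: log_def bij_betw_def)
  have log_eq: "log x = i" if "g ^ i = x" "i < ?m" for i x
    using that g(2) the_inv_into_f_f[of "\<lambda>i. g ^ i" "{..<?m}" i] by (auto simp: log_def bij_betw_def)
  have "z ^ log (x * y) = z ^ log x * z ^ log y" if "x \<in> units_level n" "y \<in> units_level n" for x y
  proof -
    have "g ^ ((log x + log y) mod ?m) = x * y"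
      by (simp only: power_mod_period[OF gm] power_add log(2)[OF that(1)] log(2)[OF that(2)])
    then have "log (x * y) = (log x + log y) mod ?m" using m by (intro log_eq) auto
    then show ?thesis by (simp only: power_mod_period[OF z] power_add)
  qed
  moreover have "z \<noteq> 0" using z m by (auto simp: power_0_left)
  ultimately have "(\<lambda>x. if x \<in> units_level n then z ^ log x else 0) \<in> characters n"
    by (auto simp: characters_def mult_in_units_level)
  moreover have "z ^ log g = z"
  proof (cases "?m = 1")
    case True
    then show ?thesis using z by simp
  next
    case False
    then have "log g = 1" using m by (intro log_eq) auto
    then show ?thesis by simp
  qed
  ultimately show "\<exists>\<xi>\<in>characters n. z = \<xi> g"
    using g(1) by (intro bexI[of _ "\<lambda>x. if x \<in> units_level n then z ^ log x else 0"]) auto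
qed

lemma
  fixes n :: nat
  assumes n: "n > 0"
  shows card_characters: "card (characters n :: ('a::finite_field alg_closure \<Rightarrow> complex) set) = CARD('a) ^ n - 1"
    and finite_characters: "finite (characters n :: ('a alg_closure \<Rightarrow> complex) set)"
proof -
  have m: "CARD('a) ^ n - 1 > 0" using CARD_power_gt_1[OF n, where 'a = 'a] by simp
  obtain g :: "'a alg_closure" where g: "g \<in> units_level n"
    "bij_betw (\<lambda>i. g ^ i) {..<CARD('a) ^ n - 1} (units_level n)"
    using units_level_cyclic[OF n] by blast
  show "card (characters n :: ('a alg_closure \<Rightarrow> complex) set) = CARD('a) ^ n - 1"
    using bij_betw_same_card[OF bij_betw_characters_roots[OF n g]] card_roots_unity_eq[OF m] by simp
  then show "finite (characters n :: ('a alg_closure \<Rightarrow> complex) set)"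
    using m by (metis card_ge_0_finite)
qed

lemma characters_separate:
  fixes x y :: "'a::finite_field alg_closure"
  assumes n: "n > 0" and xy: "x \<in> units_level n" "y \<in> units_level n" "x \<noteq> y"
  obtains \<xi> where "\<xi> \<in> characters n" "\<xi> x \<noteq> \<xi> y"
proof -
  let ?m = "CARD('a) ^ n - 1"
  obtain g :: "'a alg_closure" where g: "g \<in> units_level n"
    "bij_betw (\<lambda>i. g ^ i) {..<?m} (units_level n)"
    using units_level_cyclic[OF n] by blast
  have m: "?m > 0" using CARD_power_gt_1[OF n, where 'a = 'a] by simp
  obtain i j where ij: "i < ?m" "j < ?m" "x = g ^ i" "y = g ^ j"
    using xy(1,2) unfolding bij_betw_imp_surj_on[OF g(2), symmetric] by blast
  let ?z = "cis (2 * pi / ?m)"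
  have "?z ^ ?m = 1" using m by (simp add: DeMoivre)
  then obtain \<xi> where \<xi>: "\<xi> \<in> characters n" "\<xi> g = ?z"
    using bij_betw_characters_roots[OF n g] by (auto simp: bij_betw_def image_iff set_eq_iff) metis
  have "?z ^ i \<noteq> ?z ^ j"
    using bij_betw_roots_unity[OF m] ij xy(3)
    by (auto simp: bij_betw_def inj_on_def DeMoivre mult_ac)
  then show ?thesis using that[OF \<xi>(1)] \<xi> ij g(1) by (simp add: character_power)
qed

text \<open>Both orthogonality relations hold because the sum is multiplied by a number other than \<open>1\<close> when
  the summation variable is shifted.\<close>

lemma sum_characters_units:
  fixes \<xi> \<eta> :: "'a::finite_field alg_closure \<Rightarrow> complex"
  assumes n: "n > 0" and \<xi>: "\<xi> \<in> characters n" "\<eta> \<in> characters n"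
  shows "(\<Sum>x\<in>units_level n. \<xi> x * cnj (\<eta> x)) = (if \<xi> = \<eta> then of_nat (CARD('a) ^ n - 1) else 0)"
proof (cases "\<xi> = \<eta>")
  case True
  then show ?thesis
    using character_cnj[OF n \<xi>(1)] card_units_level[OF n, where 'a = 'a] by simp
next
  case False
  then obtain y where y: "y \<in> units_level n" "\<xi> y \<noteq> \<eta> y"
    using characters_eqI[OF \<xi>] by blast
  let ?S = "\<Sum>x\<in>units_level n. \<xi> x * cnj (\<eta> x)"
  have "inj_on (\<lambda>x. y * x) (units_level n)"
    using y by (auto simp: inj_on_def units_level_def)
  moreover have "(\<lambda>x. y * x) ` units_level n \<subseteq> units_level n"
    using y mult_in_units_level by blast
  ultimately have bij: "bij_betw (\<lambda>x. y * x) (units_level n) (units_level n)"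
    unfolding bij_betw_def using endo_inj_surj finite_units_level[OF n] by blast
  have "?S = (\<Sum>x\<in>units_level n. \<xi> (y * x) * cnj (\<eta> (y * x)))"
    using sum.reindex_bij_betw[OF bij, of "\<lambda>x. \<xi> x * cnj (\<eta> x)"] by simp
  also have "\<dots> = \<xi> y * cnj (\<eta> y) * ?S"
    unfolding sum_distrib_left
    by (intro sum.cong refl) (simp add: character_mult[OF \<xi>(1)] character_mult[OF \<xi>(2)] y)
  finally have "?S = 0 \<or> \<xi> y * cnj (\<eta> y) = 1" by simp
  moreover have "\<xi> y * cnj (\<eta> y) \<noteq> 1"
  proof
    assume "\<xi> y * cnj (\<eta> y) = 1"
    then have "\<xi> y * (\<eta> y * cnj (\<eta> y)) = \<eta> y" by (metis mult.assoc mult.commute mult_1)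
    then show False using y character_cnj[OF n \<xi>(2) y(1)] by simp
  qed
  ultimately show ?thesis using False by simp
qed

lemma sum_characters_dual:
  fixes x y :: "'a::finite_field alg_closure"
  assumes n: "n > 0" and x: "x \<in> units_level n" "y \<in> units_level n"
  shows "(\<Sum>\<xi>\<in>characters n. \<xi> x * cnj (\<xi> y)) = (if x = y then of_nat (CARD('a) ^ n - 1) else 0)"
proof (cases "x = y")
  case True
  then show ?thesis
    using character_cnj[OF n _ x(1)] card_characters[OF n, where 'a = 'a] by simp
next
  case False
  then obtain \<eta> where \<eta>: "\<eta> \<in> characters n" "\<eta> x \<noteq> \<eta> y"
    using characters_separate[OF n x] by blast
  let ?S = "\<Sum>\<xi>\<in>characters n. \<xi> x * cnj (\<xi> y)"
  let ?t = "\<lambda>\<xi> x. \<eta> x * \<xi> x"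
  have "inj_on ?t (characters n)"
  proof (rule inj_onI)
    fix \<xi> \<xi>' :: "'a alg_closure \<Rightarrow> complex"
    assume \<xi>: "\<xi> \<in> characters n" "\<xi>' \<in> characters n" "?t \<xi> = ?t \<xi>'"
    show "\<xi> = \<xi>'"
      using fun_cong[OF \<xi>(3)] character_nonzero[OF \<eta>(1)] by (intro characters_eqI[OF \<xi>(1,2)]) auto
  qed
  moreover have "?t ` characters n \<subseteq> characters n"
    using characters_times[OF \<eta>(1)] by blast
  ultimately have bij: "bij_betw ?t (characters n) (characters n)"
    unfolding bij_betw_def using endo_inj_surj finite_characters[OF n] by blast
  have "?S = (\<Sum>\<xi>\<in>characters n. ?t \<xi> x * cnj (?t \<xi> y))"
    using sum.reindex_bij_betw[OF bij, of "\<lambda>\<xi>. \<xi> x * cnj (\<xi> y)"] by simp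
  also have "\<dots> = \<eta> x * cnj (\<eta> y) * ?S"
    unfolding sum_distrib_left by (intro sum.cong refl) simp
  finally have "?S = 0 \<or> \<eta> x * cnj (\<eta> y) = 1" by simp
  moreover have "\<eta> x * cnj (\<eta> y) \<noteq> 1"
  proof
    assume "\<eta> x * cnj (\<eta> y) = 1"
    then have "\<eta> x * (\<eta> y * cnj (\<eta> y)) = \<eta> y" by (metis mult.assoc mult.commute mult_1)
    then show False using \<eta> character_cnj[OF n \<eta>(1) x(2)] by simp
  qed
  ultimately show ?thesis using False by simp
qed

section \<open>The norm maps\<close>

definition norm_exponent :: "'a::finite_field itself \<Rightarrow> nat \<Rightarrow> nat \<Rightarrow> nat" where
  "norm_exponent T k n = (\<Sum>i<k div n. CARD('a) ^ (n * i))"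

lemma norm_map_eq_power: "norm_map k n x = x ^ norm_exponent TYPE('a) k n"
  for x :: "'a::finite_field alg_closure"
  by (simp add: norm_map_def norm_exponent_def power_sum)

lemma norm_exponent_mult:
  assumes "n dvd k"
  shows "norm_exponent TYPE('a::finite_field) k n * (CARD('a) ^ n - 1) = CARD('a) ^ k - 1"
proof -
  let ?y = "CARD('a) ^ n"
  have "int (norm_exponent TYPE('a) k n * (?y - 1)) = (\<Sum>i<k div n. int ?y ^ i) * (int ?y - 1)"
    by (simp add: norm_exponent_def power_mult of_nat_diff)
  also have "\<dots> = int ?y ^ (k div n) - 1"
    by (subst power_diff_1_eq) (rule mult.commute)
  also have "\<dots> = int (CARD('a) ^ k - 1)"
    using assms by (simp add: of_nat_diff flip: power_mult)
  finally show ?thesis by (simp only: of_nat_eq_iff)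
qed

text \<open>In terms of a generator \<open>g\<close> of the larger cyclic group, the norm of \<open>g ^ i\<close> is \<open>g ^ (i * E)\<close>, where
  \<open>E\<close> is the quotient of the orders of the two groups.\<close>

lemma norm_map_surj:
  assumes k: "k > 0" "n dvd k"
  shows "norm_map k n ` units_level k = (units_level n :: 'a::finite_field alg_closure set)"
proof -
  have n: "n > 0" using k by (auto intro: Nat.gr0I)
  let ?m = "CARD('a) ^ n - 1" and ?E = "norm_exponent TYPE('a) k n"
  obtain g :: "'a alg_closure" where g: "g \<in> units_level k"
    "bij_betw (\<lambda>i. g ^ i) {..<CARD('a) ^ k - 1} (units_level k)"
    using units_level_cyclic[OF k(1)] by blast
  have E: "?E * ?m = CARD('a) ^ k - 1" by (rule norm_exponent_mult[OF k(2)])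
  have sub: "norm_map k n ` units_level k \<subseteq> (units_level n :: 'a alg_closure set)"
    using norm_map_in_units_level[OF k] by blast
  have "?E > 0" using E CARD_power_gt_1[OF k(1), where 'a = 'a] by (cases "?E = 0") auto
  have "inj_on (\<lambda>i. norm_map k n (g ^ i)) {..<?m}"
  proof (rule inj_onI)
    fix i j assume ij: "i \<in> {..<?m}" "j \<in> {..<?m}" "norm_map k n (g ^ i) = norm_map k n (g ^ j)"
    have "?E * l < CARD('a) ^ k - 1" if "l < ?m" for l
      using mult_strict_left_mono[OF that \<open>?E > 0\<close>] unfolding E .
    then have "?E * i \<in> {..<CARD('a) ^ k - 1}" "?E * j \<in> {..<CARD('a) ^ k - 1}"
      using ij(1,2) by simp_all
    moreover have "g ^ (?E * i) = g ^ (?E * j)"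
      using ij(3) by (simp add: norm_map_eq_power mult.commute flip: power_mult)
    ultimately have "?E * i = ?E * j"
      using g(2) unfolding bij_betw_def inj_on_def by blast
    then show "i = j" using \<open>?E > 0\<close> by simp
  qed
  moreover have "(\<lambda>i. norm_map k n (g ^ i)) ` {..<?m} \<subseteq> norm_map k n ` units_level k"
    using g(1) power_in_units_level by blast
  ultimately have "card {..<?m} \<le> card (norm_map k n ` units_level k :: 'a alg_closure set)"
    using finite_units_level[OF k(1)] by (intro card_inj_on_le) auto
  then show ?thesis
    using sub finite_units_level[OF n, where 'a = 'a] card_units_level[OF n, where 'a = 'a]
    by (intro card_seteq) auto
qed

text \<open>Hilbert 90 for finite fields, with \<open>y ^ (q ^ n - 1)\<close> as the quotient of \<open>y ^ (q ^ n)\<close> by \<open>y\<close>.\<close>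

lemma norm_map_eq_1:
  fixes x :: "'a::finite_field alg_closure"
  assumes k: "k > 0" "n dvd k" and x: "x \<in> units_level k" "norm_map k n x = 1"
  obtains y where "y \<in> units_level k" "x = y ^ (CARD('a) ^ n - 1)"
proof -
  have n: "n > 0" using k by (auto intro: Nat.gr0I)
  let ?m = "CARD('a) ^ n - 1" and ?E = "norm_exponent TYPE('a) k n" and ?M = "CARD('a) ^ k - 1"
  obtain g :: "'a alg_closure" where g: "g \<in> units_level k"
    "bij_betw (\<lambda>i. g ^ i) {..<?M} (units_level k)"
    using units_level_cyclic[OF k(1)] by blast
  have E: "?E * ?m = ?M" by (rule norm_exponent_mult[OF k(2)])
  have M: "?M > 0" using CARD_power_gt_1[OF k(1), where 'a = 'a] by simp
  obtain i where i: "x = g ^ i" using x(1) g(2) by (auto simp: bij_betw_def)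
  have "g ^ (i * ?E) = 1" using x(2) by (simp add: i norm_map_eq_power power_mult)
  moreover have "g ^ ?M = 1" using g(1) k(1) by (simp add: units_level_iff_root)
  then have "g ^ (i * ?E mod ?M) = g ^ (i * ?E)"
    by (rule power_mod_period)
  ultimately have "g ^ (i * ?E mod ?M) = g ^ 0" by simp
  then have "i * ?E mod ?M = 0"
    using g(2) M mod_less_divisor[OF M, of "i * ?E"] unfolding bij_betw_def inj_on_def by blast
  then have "?E * ?m dvd ?E * i" by (simp only: E mult.commute dvd_eq_mod_eq_0)
  moreover have "?E > 0" using E M by (cases "?E = 0") auto
  ultimately have "?m dvd i" by simp
  then obtain l where "i = ?m * l" by blast
  then have "x = (g ^ l) ^ ?m" by (simp add: i mult.commute flip: power_mult)
  then show ?thesis using that g(1) power_in_units_level by blast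
qed

section \<open>The direct limit of the character groups\<close>

lemma same_character_refl:
  "n > 0 \<Longrightarrow> \<xi> \<in> characters n \<Longrightarrow> same_character (n, \<xi>) (n, \<xi>)"
  by auto

lemma abs_dual_eq_iff:
  assumes "m > 0" "\<xi> \<in> characters m" "n > 0" "\<eta> \<in> characters n"
  shows "abs_dual (m, \<xi>) = abs_dual (n, \<eta>) \<longleftrightarrow> same_character (m, \<xi>) (n, \<eta>)"
  using Quotient3_rel[OF Quotient3_dual, of "(m, \<xi>)" "(n, \<eta>)"] assms same_character_refl by blast

lemma dual_cases:
  obtains n \<xi> where "n > 0" "\<xi> \<in> characters n" "c = abs_dual (n, \<xi>)"
proof -
  have "same_character (rep_dual c) (rep_dual c)" "abs_dual (rep_dual c) = c"
    using Quotient3_rep_reflp[OF Quotient3_dual] Quotient3_abs_rep[OF Quotient3_dual] by blast+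
  then show ?thesis
    using that by (cases "rep_dual c") auto
qed

text \<open>Inflation is injective because the norm maps are surjective.\<close>

lemma abs_dual_inj:
  assumes "n > 0" "\<xi> \<in> characters n" "\<eta> \<in> characters n" "abs_dual (n, \<xi>) = abs_dual (n, \<eta>)"
  shows "\<xi> = \<eta>"
proof -
  have "same_character (n, \<xi>) (n, \<eta>)"
    using assms abs_dual_eq_iff by blast
  then obtain k where k: "k > 0" "n dvd k" "\<forall>x\<in>units_level k. \<xi> (norm_map k n x) = \<eta> (norm_map k n x)"
    by auto
  have "\<xi> y = \<eta> y" if "y \<in> units_level n" for y
    using that k(3) unfolding norm_map_surj[OF k(1,2), symmetric] by blast
  then show ?thesis using assms characters_eqI by blast
qed

lemma frob_dual_abs:
  fixes \<xi> :: "'a::finite_field alg_closure \<Rightarrow> complex"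
  assumes "n > 0" "\<xi> \<in> characters n"
  shows "frob_dual (abs_dual (n, \<xi>)) = abs_dual (n, \<lambda>x. \<xi> x ^ CARD('a))"
  using frob_dual.abs_eq[OF same_character_refl[OF assms]] by simp

lemma frob_dual_power:
  fixes \<xi> :: "'a::finite_field alg_closure \<Rightarrow> complex"
  assumes n: "n > 0" "\<xi> \<in> characters n"
  shows "(frob_dual ^^ i) (abs_dual (n, \<xi>)) = abs_dual (n, \<lambda>x. \<xi> x ^ (CARD('a) ^ i))"
proof (induction i)
  case (Suc i)
  have "(\<lambda>x. \<xi> x ^ (CARD('a) ^ i)) \<in> characters n"
    using n(2) CARD_finite_field_gt_1[where 'a = 'a] by (intro characters_power) auto
  then show ?case
    by (simp add: Suc frob_dual_abs[OF n(1)] mult.commute flip: power_mult)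
qed simp

lemma character_frob:
  fixes \<xi> :: "'a::finite_field alg_closure \<Rightarrow> complex"
  assumes "\<xi> \<in> characters n" "x \<in> units_level n"
  shows "\<xi> ((frob ^^ i) x) = \<xi> x ^ (CARD('a) ^ i)"
  using character_power[OF assms] by (simp add: frob_power)

lemma frob_dual_period:
  fixes \<xi> :: "'a::finite_field alg_closure \<Rightarrow> complex"
  assumes n: "n > 0" "\<xi> \<in> characters n"
  shows "(frob_dual ^^ n) (abs_dual (n, \<xi>)) = abs_dual (n, \<xi>)"
proof -
  have "\<xi> x ^ (CARD('a) ^ n) = \<xi> x" for x
  proof (cases "x \<in> units_level n")
    case True
    then show ?thesis
      using character_frob[OF n(2) True, of n] by (simp add: units_level_iff_frob)
  next
    case False
    then show ?thesis
      using character_outside[OF n(2)] CARD_finite_field_gt_1[where 'a = 'a] by (simp add: power_0_left)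
  qed
  then show ?thesis by (simp add: frob_dual_power[OF n])
qed

lemma Rep_char_orb: "Rep_dual_orb (char_orb n \<xi>) = orbit_of frob_dual (abs_dual (n, \<xi>))"
  unfolding char_orb_def by (rule Abs_dual_orb_inverse) blast

lemma char_orb_eq_iff:
  fixes \<xi> \<eta> :: "'a::finite_field alg_closure \<Rightarrow> complex"
  assumes n: "n > 0" "\<xi> \<in> characters n" "\<eta> \<in> characters n"
  shows "char_orb n \<eta> = char_orb n \<xi> \<longleftrightarrow> (\<exists>i. \<eta> = (\<lambda>x. \<xi> x ^ (CARD('a) ^ i)))"
proof -
  have pow: "(\<lambda>x. \<xi> x ^ (CARD('a) ^ i)) \<in> characters n" for i
    using n(2) CARD_finite_field_gt_1[where 'a = 'a] by (intro characters_power) auto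
  have "char_orb n \<eta> = char_orb n \<xi> \<longleftrightarrow>
      orbit_of frob_dual (abs_dual (n, \<eta>)) = orbit_of frob_dual (abs_dual (n, \<xi>))"
    by (simp add: Rep_char_orb flip: Rep_dual_orb_inject)
  also have "\<dots> \<longleftrightarrow> abs_dual (n, \<eta>) \<in> orbit_of frob_dual (abs_dual (n, \<xi>))"
    using orbit_of_eq[OF n(1) frob_dual_period[OF n(1,2)], of "abs_dual (n, \<eta>)"]
      orbit_of_refl[of "abs_dual (n, \<eta>)" frob_dual] by auto
  also have "\<dots> \<longleftrightarrow> (\<exists>i. abs_dual (n, \<eta>) = abs_dual (n, \<lambda>x. \<xi> x ^ (CARD('a) ^ i)))"
    by (simp add: orbit_of_def frob_dual_power[OF n(1,2)])
  also have "\<dots> \<longleftrightarrow> (\<exists>i. \<eta> = (\<lambda>x. \<xi> x ^ (CARD('a) ^ i)))"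
    using abs_dual_inj[OF n(1,3) pow] by blast
  finally show ?thesis .
qed

lemma
  assumes "n > 0" "\<xi> \<in> characters n"
  shows dual_size_char_orb_pos: "dual_size (char_orb n \<xi>) > 0"
    and dual_size_char_orb_dvd: "dual_size (char_orb n \<xi>) dvd n"
  using card_periodic_orbit_pos[OF assms(1) frob_dual_period[OF assms]]
    card_periodic_orbit_dvd[OF assms(1) frob_dual_period[OF assms]]
  by (simp_all add: dual_size_def Rep_char_orb)

text \<open>A character that is fixed by the \<open>N\<close>-th power of Frobenius is trivial on \<open>(q ^ N - 1)\<close>-th powers, hence on
  the kernel of the norm map to level \<open>N\<close>, and therefore it descends to that level. In this way every \<open>\<phi>\<close> is
  represented on each level divisible by \<open>\<bar>\<phi>\<bar>\<close>.\<close>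

lemma descend_character:
  fixes \<eta> :: "'a::finite_field alg_closure \<Rightarrow> complex"
  assumes K: "K > 0" "N dvd K" and \<eta>: "\<eta> \<in> characters K"
    and fixed: "\<And>x. \<eta> x ^ (CARD('a) ^ N) = \<eta> x"
  obtains \<xi> where "\<xi> \<in> characters N" "\<And>x. x \<in> units_level K \<Longrightarrow> \<xi> (norm_map K N x) = \<eta> x"
proof -
  have N: "N > 0" using K by (auto intro: Nat.gr0I)
  have norm_mult: "norm_map K N (x * y) = norm_map K N x * norm_map K N y" for x y :: "'a alg_closure"
    by (simp add: norm_map_eq_power power_mult_distrib)
  have kernel: "\<eta> x = 1" if x: "x \<in> units_level K" "norm_map K N x = 1" for x
  proof -
    obtain y where y: "y \<in> units_level K" "x = y ^ (CARD('a) ^ N - 1)"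
      using norm_map_eq_1[OF K x] by blast
    have "\<eta> y * \<eta> y ^ (CARD('a) ^ N - 1) = \<eta> y ^ (CARD('a) ^ N)"
      using CARD_power_gt_1[OF N, where 'a = 'a] by (simp flip: power_Suc)
    also have "\<dots> = \<eta> y * 1" by (simp add: fixed)
    finally show ?thesis
      using character_nonzero[OF \<eta> y(1)] by (simp add: y character_power[OF \<eta>])
  qed
  have well_defined: "\<eta> x = \<eta> y"
    if xy: "x \<in> units_level K" "y \<in> units_level K" "norm_map K N x = norm_map K N y" for x y
  proof -
    have y0: "y \<noteq> 0" using xy by (simp add: units_level_def)
    have "x / y \<in> units_level K"
      using xy by (simp add: units_level_def power_divide)
    moreover from this have "norm_map K N (x / y) = 1"
      using norm_mult[of "x / y" y] xy y0 by (simp add: norm_map_eq_power power_divide)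
    ultimately have "\<eta> (x / y) = 1" by (rule kernel)
    then show ?thesis
      using character_mult[OF \<eta> \<open>x / y \<in> units_level K\<close> xy(2)] y0 by simp
  qed
  define pre where "pre z = (SOME x. x \<in> units_level K \<and> norm_map K N x = z)" for z :: "'a alg_closure"
  have pre: "pre z \<in> units_level K" "norm_map K N (pre z) = z" if "z \<in> units_level N" for z
  proof -
    have "\<exists>x. x \<in> units_level K \<and> norm_map K N x = z"
      using that unfolding norm_map_surj[OF K, symmetric] by blast
    from someI_ex[OF this] show "pre z \<in> units_level K" "norm_map K N (pre z) = z"
      by (auto simp: pre_def)
  qed
  define \<xi> where "\<xi> z = (if z \<in> units_level N then \<eta> (pre z) else 0)" for z
  have \<xi>: "\<xi> (norm_map K N x) = \<eta> x" if "x \<in> units_level K" for x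
  proof -
    have z: "norm_map K N x \<in> units_level N" by (rule norm_map_in_units_level[OF K that])
    then show ?thesis
      using well_defined[OF pre(1)[OF z] that pre(2)[OF z]] by (simp add: \<xi>_def)
  qed
  have "\<xi> (x * y) = \<xi> x * \<xi> y" if xy: "x \<in> units_level N" "y \<in> units_level N" for x y
  proof -
    have "\<xi> (norm_map K N (pre x * pre y)) = \<eta> (pre x) * \<eta> (pre y)"
      using pre[OF xy(1)] pre[OF xy(2)] by (simp add: \<xi> mult_in_units_level character_mult[OF \<eta>])
    then show ?thesis
      using pre[OF xy(1)] pre[OF xy(2)] xy by (simp add: norm_mult) (simp add: \<xi>_def)
  qed
  then have "\<xi> \<in> characters N"
    using pre character_nonzero[OF \<eta>] by (auto simp: characters_def) (auto simp: \<xi>_def)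
  then show ?thesis using that \<xi> by blast
qed

lemma char_orb_surj:
  fixes \<phi> :: "'a::finite_field dual_orb"
  assumes N: "N > 0" "dual_size \<phi> dvd N"
  obtains \<xi> where "\<xi> \<in> characters N" "char_orb N \<xi> = \<phi>"
proof -
  obtain c where c: "Rep_dual_orb \<phi> = orbit_of frob_dual c"
    using Rep_dual_orb[of \<phi>] by auto
  obtain n \<eta> where n: "n > 0" "\<eta> \<in> characters n" "c = abs_dual (n, \<eta>)"
    by (rule dual_cases)
  let ?d = "dual_size \<phi>"
  have d: "(frob_dual ^^ ?d) c = c"
    using funpow_card_periodic_orbit[OF n(1) frob_dual_period[OF n(1,2)]] by (simp add: dual_size_def c n)
  obtain l where l: "N = ?d * l" using N by blast
  have "(frob_dual ^^ N) c = c"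
    using funpow_mod_eq[OF d, of N] by (simp add: l)
  moreover have pow: "(\<lambda>x. \<eta> x ^ (CARD('a) ^ N)) \<in> characters n"
    using n(2) CARD_finite_field_gt_1[where 'a = 'a] by (intro characters_power) auto
  ultimately have "(\<lambda>x. \<eta> x ^ (CARD('a) ^ N)) = \<eta>"
    using abs_dual_inj[OF n(1) pow n(2)] by (simp add: n(3) frob_dual_power[OF n(1,2)])
  then have fixed: "\<eta> x ^ (CARD('a) ^ N) = \<eta> x" for x
    by (metis (no_types))
  define K where "K = n * N"
  have K: "K > 0" "n dvd K" "N dvd K" using n N by (auto simp: K_def)
  define \<eta>' where "\<eta>' x = (if x \<in> units_level K then \<eta> (norm_map K n x) else 0)" for x
  have norm_mult: "norm_map K n (x * y) = norm_map K n x * norm_map K n y" for x y :: "'a alg_closure"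
    by (simp add: norm_map_eq_power power_mult_distrib)
  have "\<eta>' \<in> characters K"
    using norm_map_in_units_level[OF K(1,2)] character_nonzero[OF n(2)] character_mult[OF n(2)]
    by (auto simp: characters_def \<eta>'_def mult_in_units_level norm_mult)
  moreover have "\<eta>' x ^ (CARD('a) ^ N) = \<eta>' x" for x
    using CARD_finite_field_gt_1[where 'a = 'a] by (simp add: \<eta>'_def fixed power_0_left)
  ultimately obtain \<xi> where \<xi>: "\<xi> \<in> characters N" "\<And>x. x \<in> units_level K \<Longrightarrow> \<xi> (norm_map K N x) = \<eta>' x"
    using descend_character[OF K(1,3)] by blast
  have "same_character (N, \<xi>) (n, \<eta>)"
    using K n N \<xi> by (auto simp: \<eta>'_def intro!: exI[of _ K])
  then have "abs_dual (N, \<xi>) = c"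
    using abs_dual_eq_iff[OF N(1) \<xi>(1) n(1,2)] n(3) by simp
  then have "char_orb N \<xi> = \<phi>"
    by (simp add: Rep_char_orb c flip: Rep_dual_orb_inject)
  then show ?thesis using that \<xi>(1) by blast
qed

lemma dual_size_pos: "dual_size \<phi> > 0"
proof -
  obtain c where c: "Rep_dual_orb \<phi> = orbit_of frob_dual c"
    using Rep_dual_orb[of \<phi>] by auto
  obtain n \<eta> where n: "n > 0" "\<eta> \<in> characters n" "c = abs_dual (n, \<eta>)"
    by (rule dual_cases)
  show ?thesis
    using card_periodic_orbit_pos[OF n(1) frob_dual_period[OF n(1,2)]] by (simp add: dual_size_def c n)
qed

text \<open>The characters of level \<open>N\<close> in the orbit \<open>\<phi>\<close> correspond to the elements of \<open>\<phi>\<close>, because inflation is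
  injective.\<close>

lemma card_char_orb:
  fixes \<phi> :: "'a::finite_field dual_orb"
  assumes N: "N > 0" "dual_size \<phi> dvd N"
  shows "card {\<xi> \<in> characters N. char_orb N \<xi> = \<phi>} = dual_size \<phi>"
proof -
  obtain \<xi> where \<xi>: "\<xi> \<in> characters N" "char_orb N \<xi> = \<phi>"
    using char_orb_surj[OF N] by blast
  have pow: "(\<lambda>x. \<xi> x ^ (CARD('a) ^ i)) \<in> characters N" for i
    using \<xi>(1) CARD_finite_field_gt_1[where 'a = 'a] by (intro characters_power) auto
  have rep: "Rep_dual_orb \<phi> = {abs_dual (N, \<lambda>x. \<xi> x ^ (CARD('a) ^ i)) |i. True}"
    unfolding \<xi>(2)[symmetric] Rep_char_orb orbit_of_def frob_dual_power[OF N(1) \<xi>(1)] ..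
  have "bij_betw (\<lambda>\<eta>. abs_dual (N, \<eta>)) {\<eta> \<in> characters N. char_orb N \<eta> = \<phi>} (Rep_dual_orb \<phi>)"
    unfolding bij_betw_def
  proof
    show "inj_on (\<lambda>\<eta>. abs_dual (N, \<eta>)) {\<eta> \<in> characters N. char_orb N \<eta> = \<phi>}"
      using abs_dual_inj[OF N(1)] by (auto intro: inj_onI)
    have "{\<eta> \<in> characters N. char_orb N \<eta> = \<phi>} = {\<lambda>x. \<xi> x ^ (CARD('a) ^ i) |i. True}"
      using char_orb_eq_iff[OF N(1) \<xi>(1)] \<xi>(2) pow by auto
    then show "(\<lambda>\<eta>. abs_dual (N, \<eta>)) ` {\<eta> \<in> characters N. char_orb N \<eta> = \<phi>} = Rep_dual_orb \<phi>"
      unfolding rep by auto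
  qed
  then show ?thesis
    by (simp add: bij_betw_same_card dual_size_def)
qed

section \<open>The two sets of generators\<close>

lemma character_period:
  fixes \<xi> :: "'a::finite_field alg_closure \<Rightarrow> complex"
  assumes "\<xi> \<in> characters n"
  shows "\<xi> x ^ (CARD('a) ^ (n * i)) = \<xi> x"
proof (cases "x \<in> units_level n")
  case True
  then have "(frob ^^ n) x = x" by (simp add: units_level_iff_frob)
  then have "(frob ^^ (n * i)) x = x"
    using funpow_mod_eq[of n frob x "n * i"] by simp
  then show ?thesis using character_frob[OF assms True, of "n * i"] by simp
next
  case False
  then show ?thesis
    using character_outside[OF assms] CARD_finite_field_gt_1[where 'a = 'a] by (simp add: power_0_left)
qed

lemma bij_betw_frob_characters:
  assumes n: "n > 0"
  shows "bij_betw (\<lambda>\<xi> x. \<xi> x ^ (CARD('a) ^ i)) (characters n)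
    (characters n :: ('a::finite_field alg_closure \<Rightarrow> complex) set)"
proof -
  let ?t = "\<lambda>\<xi> x. \<xi> x ^ (CARD('a) ^ i) :: complex"
  have "inj_on ?t (characters n :: ('a alg_closure \<Rightarrow> complex) set)"
  proof (rule inj_onI)
    fix \<xi> \<eta> :: "'a alg_closure \<Rightarrow> complex"
    assume \<xi>: "\<xi> \<in> characters n" "\<eta> \<in> characters n" "?t \<xi> = ?t \<eta>"
    have i: "n * i = i + (n * i - i)" using n by simp
    have "\<xi> x = \<eta> x" for x
    proof -
      have "(\<xi> x ^ (CARD('a) ^ i)) ^ (CARD('a) ^ (n * i - i)) = (\<eta> x ^ (CARD('a) ^ i)) ^ (CARD('a) ^ (n * i - i))"
        using fun_cong[OF \<xi>(3), of x] by simp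
      then have "\<xi> x ^ (CARD('a) ^ (n * i)) = \<eta> x ^ (CARD('a) ^ (n * i))"
        by (subst (1 2) i) (simp only: power_add power_mult)
      then show ?thesis by (simp only: character_period \<xi>)
    qed
    then show "\<xi> = \<eta>" by blast
  qed
  moreover have "?t ` characters n \<subseteq> (characters n :: ('a alg_closure \<Rightarrow> complex) set)"
    using CARD_finite_field_gt_1[where 'a = 'a] by (auto intro!: characters_power)
  ultimately show ?thesis
    unfolding bij_betw_def using endo_inj_surj finite_characters[OF n] by blast
qed

lemma bij_betw_frob_units_level:
  assumes n: "n > 0"
  shows "bij_betw (frob ^^ i) (units_level n) (units_level n :: 'a::finite_field alg_closure set)"
proof -
  have "inj_on (frob ^^ i) (units_level n :: 'a alg_closure set)"
    using inj_fn[OF inj_frob] inj_on_subset by blast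
  moreover have "(frob ^^ i) ` units_level n \<subseteq> (units_level n :: 'a alg_closure set)"
    using power_in_units_level by (auto simp: frob_power)
  ultimately show ?thesis
    unfolding bij_betw_def using endo_inj_surj finite_units_level[OF n] by blast
qed

definition unit_orb :: "'a::finite_field alg_closure \<Rightarrow> 'a orb" where
  "unit_orb x = Abs_orb (orbit_of frob x)"

lemma Rep_unit_orb: "x \<noteq> 0 \<Longrightarrow> Rep_orb (unit_orb x) = orbit_of frob x"
  unfolding unit_orb_def by (rule Abs_orb_inverse) blast

lemma unit_orb_frob:
  assumes "n > 0" "x \<in> units_level n"
  shows "unit_orb ((frob ^^ i) x) = unit_orb x"
  using assms orbit_of_funpow[of n frob x i] by (simp add: unit_orb_def units_level_iff_frob)

lemma
  assumes "n > 0" "x \<in> units_level n"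
  shows orb_size_unit_orb_pos: "orb_size (unit_orb x) > 0"
    and orb_size_unit_orb_dvd: "orb_size (unit_orb x) dvd n"
  using card_periodic_orbit_pos[of n frob x] card_periodic_orbit_dvd[of n frob x] assms
  by (simp_all add: orb_size_def Rep_unit_orb units_level_iff_frob)

text \<open>Elements of the algebraic closure are periodic under Frobenius, so a root \<open>x\<close> of \<open>f\<close> has \<open>\<bar>f\<bar>\<close> conjugates and
  is fixed by the \<open>\<bar>f\<bar>\<close>-th power of Frobenius.\<close>

lemma unit_orb_surj:
  fixes f :: "'a::finite_field orb"
  obtains x where "unit_orb x = f" "\<And>n. x \<in> units_level (n * orb_size f)" "orb_size f > 0"
proof -
  obtain x where x: "x \<noteq> 0" "Rep_orb f = orbit_of frob x"
    using Rep_orb[of f] by auto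
  obtain n where n: "n > 0" "(frob ^^ n) x = x"
    using alg_closure_periodic by blast
  have "unit_orb x = f"
    using x by (simp add: unit_orb_def Rep_orb_inverse flip: x(2))
  moreover have "(frob ^^ orb_size f) x = x" "orb_size f > 0"
    using funpow_card_periodic_orbit[OF n] card_periodic_orbit_pos[OF n] by (simp_all add: orb_size_def x)
  then have "x \<in> units_level (n * orb_size f)" for n
    using funpow_mod_eq[of "orb_size f" frob x "n * orb_size f"] x by (simp add: units_level_iff_frob)
  ultimately show ?thesis using that \<open>orb_size f > 0\<close> by blast
qed

lemma orbit_of_frob_1: "orbit_of frob (1 :: 'a::finite_field alg_closure) = {1}"
  by (auto simp: orbit_of_def frob_power)

lemma f1_eq: "f1 = unit_orb (1 :: 'a::finite_field alg_closure)"
proof -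
  have "{x :: 'a alg_closure. poly (map_poly to_ac [:-1, 1:]) x = 0} = {1}"
    by (auto simp: map_poly_pCons)
  then show ?thesis by (simp add: f1_def poly_orb_def unit_orb_def orbit_of_frob_1)
qed

lemma unit_orb_eq_f1_iff: "x \<noteq> 0 \<Longrightarrow> unit_orb x = f1 \<longleftrightarrow> x = 1"
  using orbit_of_refl[of x frob]
  by (auto simp: f1_eq Rep_unit_orb orbit_of_frob_1 simp flip: Rep_orb_inject)

lemma orb_size_f1: "orb_size (f1 :: 'a::finite_field orb) = 1"
  by (simp add: orb_size_def f1_eq Rep_unit_orb orbit_of_frob_1)

text \<open>On level \<open>n\<close>, the generators of both kinds become functions on the group \<open>M\<^sub>n\<close> and on its dual that are
  invariant under Frobenius, and the change of generators becomes the Fourier transform.\<close>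

definition unit_gen :: "nat \<Rightarrow> 'a::finite_field alg_closure \<Rightarrow> ('a orb \<times> nat) cpoly" where
  "unit_gen n x = Var (unit_orb x, n div orb_size (unit_orb x) - 1)"

definition char_gen :: "nat \<Rightarrow> ('a::finite_field alg_closure \<Rightarrow> complex) \<Rightarrow> 'a FG" where
  "char_gen n \<xi> = p_dual (n div dual_size (char_orb n \<xi>)) (char_orb n \<xi>)"

text \<open>The definition of \<open>p\<^sub>m(f)\<close> chooses a root of \<open>f\<close>. Another root is the image of the chosen one under a power of
  Frobenius; this permutes the characters within their orbits and does not change the sum.\<close>

lemma p_orb_unit_orb:
  fixes x :: "'a::finite_field alg_closure"
  assumes n: "n > 0" and x: "x \<in> units_level n"
  shows "p_orb (n div orb_size (unit_orb x)) (unit_orb x) =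
    Const ((-1) ^ (n - 1) / (of_nat CARD('a) ^ n - 1)) *
      (\<Sum>\<xi>\<in>characters n. Const (cnj (\<xi> x)) * char_gen n \<xi>)"
proof -
  have level: "n div orb_size (unit_orb x) * orb_size (unit_orb x) = n"
    using orb_size_unit_orb_dvd[OF n x] by simp
  have x0: "x \<noteq> 0" using x by (simp add: units_level_def)
  define y where "y = (SOME y. y \<in> Rep_orb (unit_orb x))"
  have "y \<in> orbit_of frob x"
    unfolding y_def using someI[of "\<lambda>y. y \<in> Rep_orb (unit_orb x)" x] orbit_of_refl[of x frob]
    by (simp add: Rep_unit_orb[OF x0])
  then obtain i where i: "y = (frob ^^ i) x" by (auto simp: orbit_of_def)
  let ?t = "\<lambda>\<xi> x. \<xi> x ^ (CARD('a) ^ i) :: complex"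
  have gen: "char_gen n (?t \<xi>) = char_gen n \<xi>" if \<xi>: "\<xi> \<in> characters n" for \<xi> :: "'a alg_closure \<Rightarrow> complex"
  proof -
    have "?t \<xi> \<in> characters n"
      using bij_betwE[OF bij_betw_frob_characters[OF n]] \<xi> by blast
    then have "char_orb n (?t \<xi>) = char_orb n \<xi>"
      using char_orb_eq_iff[OF n \<xi>] by blast
    then show ?thesis by (simp add: char_gen_def)
  qed
  have "(\<Sum>\<xi>\<in>characters n. Const (cnj (\<xi> y)) * char_gen n \<xi>) =
      (\<Sum>\<xi>\<in>characters n. Const (cnj (?t \<xi> x)) * char_gen n (?t \<xi>))"
    by (intro sum.cong refl) (simp add: i character_frob[OF _ x] gen)
  also have "\<dots> = (\<Sum>\<xi>\<in>characters n. Const (cnj (\<xi> x)) * char_gen n \<xi>)"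
    by (rule sum.reindex_bij_betw[OF bij_betw_frob_characters[OF n],
          of "\<lambda>\<xi>. Const (cnj (\<xi> x)) * char_gen n \<xi>"])
  finally show ?thesis
    unfolding p_orb_def level Let_def y_def[symmetric] by (simp add: char_gen_def)
qed

lemma from_orb_gens_hom: "alg_hom from_orb_gens"
  unfolding from_orb_gens_def by (rule subst_hom)

lemma from_orb_gens_unit_gen:
  fixes x :: "'a::finite_field alg_closure"
  assumes n: "n > 0" and x: "x \<in> units_level n"
  shows "from_orb_gens (unit_gen n x) =
    Const ((-1) ^ (n - 1) / (of_nat CARD('a) ^ n - 1)) *
      (\<Sum>\<xi>\<in>characters n. Const (cnj (\<xi> x)) * char_gen n \<xi>)"
proof -
  have "n div orb_size (unit_orb x) > 0"
    using orb_size_unit_orb_dvd[OF n x] orb_size_unit_orb_pos[OF n x] n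
    by (simp add: div_greater_zero_iff dvd_imp_le)
  then show ?thesis
    by (simp add: from_orb_gens_def unit_gen_def subst_Var p_orb_unit_orb[OF n x])
qed

text \<open>The inverse Fourier transform. Of all characters in the orbit \<open>\<phi>\<close> any one can be used.\<close>

definition to_orb_gens :: "'a::finite_field FG \<Rightarrow> ('a orb \<times> nat) cpoly" where
  "to_orb_gens = subst (\<lambda>(\<phi>, k).
     let n = Suc k * dual_size \<phi>; \<xi> = (SOME \<xi>. \<xi> \<in> characters n \<and> char_orb n \<xi> = \<phi>) in
     Const ((-1) ^ (n - 1)) * (\<Sum>x\<in>units_level n. Const (\<xi> x) * unit_gen n x))"

lemma to_orb_gens_hom: "alg_hom to_orb_gens"
  unfolding to_orb_gens_def by (rule subst_hom)

lemma to_orb_gens_char_gen: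
  fixes \<xi> :: "'a::finite_field alg_closure \<Rightarrow> complex"
  assumes n: "n > 0" and \<xi>: "\<xi> \<in> characters n"
  shows "to_orb_gens (char_gen n \<xi>) =
    Const ((-1) ^ (n - 1)) * (\<Sum>x\<in>units_level n. Const (\<xi> x) * unit_gen n x)"
proof -
  define \<phi> where "\<phi> = char_orb n \<xi>"
  define k where "k = n div dual_size \<phi>"
  have d: "dual_size \<phi> > 0" "dual_size \<phi> dvd n"
    unfolding \<phi>_def using dual_size_char_orb_pos[OF n \<xi>] dual_size_char_orb_dvd[OF n \<xi>] by auto
  then have k: "k > 0" "k * dual_size \<phi> = n"
    unfolding k_def using n by (simp_all add: div_greater_zero_iff dvd_imp_le)
  define \<eta> where "\<eta> = (SOME \<eta>. \<eta> \<in> characters n \<and> char_orb n \<eta> = \<phi>)"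
  have \<eta>: "\<eta> \<in> characters n" "char_orb n \<eta> = char_orb n \<xi>"
    using someI[of "\<lambda>\<eta>. \<eta> \<in> characters n \<and> char_orb n \<eta> = \<phi>" \<xi>] \<xi> by (auto simp: \<eta>_def \<phi>_def)
  then obtain i where i: "\<eta> = (\<lambda>x. \<xi> x ^ (CARD('a) ^ i))"
    using char_orb_eq_iff[OF n \<xi>] by blast
  have "to_orb_gens (char_gen n \<xi>) =
      Const ((-1) ^ (n - 1)) * (\<Sum>x\<in>units_level n. Const (\<eta> x) * unit_gen n x)"
  proof -
    have "Suc (k - 1) * dual_size \<phi> = n" using k by simp
    then show ?thesis
      by (simp only: to_orb_gens_def char_gen_def p_dual_def subst_Var Let_def prod.case \<eta>_def
          \<phi>_def[symmetric] k_def[symmetric])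
  qed
  also have "(\<Sum>x\<in>units_level n. Const (\<eta> x) * unit_gen n x) =
      (\<Sum>x\<in>units_level n. Const (\<xi> ((frob ^^ i) x)) * unit_gen n ((frob ^^ i) x))"
    by (intro sum.cong refl) (simp add: i character_frob[OF \<xi>] unit_gen_def unit_orb_frob[OF n])
  also have "\<dots> = (\<Sum>x\<in>units_level n. Const (\<xi> x) * unit_gen n x)"
    by (rule sum.reindex_bij_betw[OF bij_betw_frob_units_level[OF n],
          of "\<lambda>x. Const (\<xi> x) * unit_gen n x"])
  finally show ?thesis .
qed

lemma CARD_power_minus_1:
  assumes "n > 0"
  shows "of_nat (CARD('a::finite_field) ^ n - 1) = (of_nat CARD('a) ^ n - 1 :: complex)"
    and "(of_nat CARD('a) ^ n - 1 :: complex) \<noteq> 0"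
proof -
  have gt: "CARD('a) ^ n > 1" by (rule CARD_power_gt_1[OF assms])
  then show eq: "of_nat (CARD('a) ^ n - 1) = (of_nat CARD('a) ^ n - 1 :: complex)"
    by (simp add: of_nat_diff)
  show "(of_nat CARD('a) ^ n - 1 :: complex) \<noteq> 0"
    unfolding eq[symmetric] of_nat_eq_0_iff using gt by simp
qed

lemma sign_cancel:
  "Const ((-1) ^ i) * (Const a * (Const ((-1) ^ i / m) * (Const b * G))) = Const (1 / m * (a * b)) * G"
  "Const ((-1) ^ i / m) * (Const b * (Const ((-1) ^ i) * (Const a * G))) = Const (1 / m * (a * b)) * G"
proof -
  have "(-1) ^ i * (-1) ^ i = (1 :: complex)" by (simp flip: power_mult_distrib)
  then have "(-1) ^ i * (a * ((-1) ^ i / m * b)) = 1 / m * (a * b)"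
    "(-1) ^ i / m * (b * ((-1) ^ i * a)) = 1 / m * (a * b)"
    by (simp_all add: mult.left_commute[of _ "(-1) ^ i"] mult.commute)
  then show "Const ((-1) ^ i) * (Const a * (Const ((-1) ^ i / m) * (Const b * G))) = Const (1 / m * (a * b)) * G"
    "Const ((-1) ^ i / m) * (Const b * (Const ((-1) ^ i) * (Const a * G))) = Const (1 / m * (a * b)) * G"
    by (simp_all only: Const_mult_assoc)
qed

lemma p_dual_eq_char_gen:
  fixes \<phi> :: "'a::finite_field dual_orb"
  assumes "k > 0"
  obtains \<xi> where "\<xi> \<in> characters (k * dual_size \<phi>)" "char_orb (k * dual_size \<phi>) \<xi> = \<phi>"
    "p_dual k \<phi> = char_gen (k * dual_size \<phi>) \<xi>"
proof -
  obtain \<xi> where "\<xi> \<in> characters (k * dual_size \<phi>)" "char_orb (k * dual_size \<phi>) \<xi> = \<phi>"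
    using char_orb_surj[of "k * dual_size \<phi>" \<phi>] assms dual_size_pos[of \<phi>] by auto
  then show ?thesis
    using that dual_size_pos[of \<phi>] by (simp add: char_gen_def)
qed

text \<open>The two orthogonality relations say that the Fourier transform and its inverse cancel in both orders.\<close>

lemma from_to_orb_gens: "from_orb_gens (to_orb_gens F) = (F :: 'a::finite_field FG)"
proof (rule alg_hom_fixing_Var)
  show "alg_hom (\<lambda>F. from_orb_gens (to_orb_gens F) :: 'a FG)"
    by (rule alg_hom_comp[OF from_orb_gens_hom to_orb_gens_hom])
  fix v :: "'a dual_orb \<times> nat"
  obtain \<phi> k where v: "v = (\<phi>, k)" by (cases v)
  define n where "n = Suc k * dual_size \<phi>"
  obtain \<xi> where \<xi>: "\<xi> \<in> characters n" "p_dual (Suc k) \<phi> = char_gen n \<xi>"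
    using p_dual_eq_char_gen[of "Suc k" \<phi>] unfolding n_def by blast
  have n: "n > 0" using dual_size_pos[of \<phi>] by (simp add: n_def)
  let ?m = "of_nat CARD('a) ^ n - 1 :: complex"
  note lin = alg_hom_linear[OF from_orb_gens_hom]
  have "from_orb_gens (to_orb_gens (char_gen n \<xi>)) =
      Const ((-1) ^ (n - 1)) * (\<Sum>x\<in>units_level n. Const (\<xi> x) * (Const ((-1) ^ (n - 1) / ?m) *
        (\<Sum>\<eta>\<in>characters n. Const (cnj (\<eta> x)) * char_gen n \<eta>)))"
    by (simp add: to_orb_gens_char_gen[OF n \<xi>(1)] linear_op_scale[OF lin] linear_op_sum[OF lin]
        from_orb_gens_unit_gen[OF n])
  also have "\<dots> = (\<Sum>x\<in>units_level n. \<Sum>\<eta>\<in>characters n.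
      Const (1 / ?m * (\<xi> x * cnj (\<eta> x))) * char_gen n \<eta>)"
    unfolding sum_distrib_left by (intro sum.cong refl) (rule sign_cancel)
  also have "\<dots> = (\<Sum>\<eta>\<in>characters n. Const (1 / ?m * (\<Sum>x\<in>units_level n. \<xi> x * cnj (\<eta> x))) * char_gen n \<eta>)"
    by (subst sum.swap) (simp add: Const_sum sum_distrib_left sum_distrib_right)
  also have "\<dots> = (\<Sum>\<eta>\<in>characters n. if \<xi> = \<eta> then char_gen n \<eta> else 0)"
    using sum_characters_units[OF n \<xi>(1)] CARD_power_minus_1[OF n, where 'a = 'a]
    by (intro sum.cong refl) simp
  also have "\<dots> = char_gen n \<xi>"
    by (simp add: \<xi>(1) finite_characters[OF n])
  finally show "from_orb_gens (to_orb_gens (Var v)) = Var v"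
    using \<xi>(2) by (simp add: v p_dual_def)
qed

lemma to_from_orb_gens: "to_orb_gens (from_orb_gens F) = (F :: ('a::finite_field orb \<times> nat) cpoly)"
proof (rule alg_hom_fixing_Var)
  show "alg_hom (\<lambda>F. to_orb_gens (from_orb_gens F) :: ('a orb \<times> nat) cpoly)"
    by (rule alg_hom_comp[OF to_orb_gens_hom from_orb_gens_hom])
  fix v :: "'a orb \<times> nat"
  obtain f k where v: "v = (f, k)" by (cases v)
  obtain x where x: "unit_orb x = f" "x \<in> units_level (Suc k * orb_size f)" "orb_size f > 0"
    using unit_orb_surj by blast
  define n where "n = Suc k * orb_size f"
  have n: "n > 0" and xn: "x \<in> units_level n" and gen: "Var v = unit_gen n x"
    using x by (simp_all add: n_def v unit_gen_def)
  let ?m = "of_nat CARD('a) ^ n - 1 :: complex"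
  note lin = alg_hom_linear[OF to_orb_gens_hom]
  have "to_orb_gens (from_orb_gens (unit_gen n x)) =
      Const ((-1) ^ (n - 1) / ?m) * (\<Sum>\<xi>\<in>characters n. Const (cnj (\<xi> x)) * (Const ((-1) ^ (n - 1)) *
        (\<Sum>y\<in>units_level n. Const (\<xi> y) * unit_gen n y)))"
    by (simp add: from_orb_gens_unit_gen[OF n xn] linear_op_scale[OF lin] linear_op_sum[OF lin]
        to_orb_gens_char_gen[OF n])
  also have "\<dots> = (\<Sum>\<xi>\<in>characters n. \<Sum>y\<in>units_level n.
      Const (1 / ?m * (\<xi> y * cnj (\<xi> x))) * unit_gen n y)"
    unfolding sum_distrib_left by (intro sum.cong refl) (rule sign_cancel)
  also have "\<dots> = (\<Sum>y\<in>units_level n. Const (1 / ?m * (\<Sum>\<xi>\<in>characters n. \<xi> y * cnj (\<xi> x))) * unit_gen n y)"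
    by (subst sum.swap) (simp add: Const_sum sum_distrib_left sum_distrib_right)
  also have "\<dots> = (\<Sum>y\<in>units_level n. if y = x then unit_gen n y else 0)"
    using sum_characters_dual[OF n _ xn] CARD_power_minus_1[OF n, where 'a = 'a]
    by (intro sum.cong refl) simp
  also have "\<dots> = unit_gen n x"
    by (simp add: xn finite_units_level[OF n])
  finally show "to_orb_gens (from_orb_gens (Var v)) = Var v"
    by (simp add: gen)
qed

subsection \<open>Derivatives of the generators\<close>

lemma partial_orb_eq:
  fixes f :: "'a::finite_field orb"
  shows "partial_orb k f F = from_orb_gens (partial_deriv (f, k - 1) (to_orb_gens F))"
proof -
  have "inv_into UNIV (from_orb_gens :: ('a orb \<times> nat) cpoly \<Rightarrow> _) = to_orb_gens"
    by (rule inv_equality) (rule to_from_orb_gens from_to_orb_gens)+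
  then show ?thesis by (simp add: partial_orb_def)
qed

lemma derivation_partial_orb: "derivation (partial_orb k f)"
  unfolding partial_orb_eq[abs_def]
  by (rule derivation_transport[OF from_orb_gens_hom to_orb_gens_hom derivation_partial_deriv from_to_orb_gens])

lemma derivation_partial_dual: "derivation (partial_dual k \<phi>)"
  unfolding partial_dual_def by (rule derivation_partial_deriv)

lemma partial_dual_p_dual:
  "k \<ge> 1 \<Longrightarrow> m \<ge> 1 \<Longrightarrow> partial_dual k \<phi> (p_dual m \<psi>) = (if \<phi> = \<psi> \<and> k = m then 1 else 0)"
  by (auto simp: partial_dual_def p_dual_def partial_deriv_Var)

text \<open>Only the summand of the unit \<open>1\<close> in the Fourier expansion of \<open>p\<^sub>m(\<phi>)\<close> involves \<open>f\<^sub>1\<close>.\<close>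

lemma partial_orb_f1_p_dual:
  fixes \<phi> :: "'a::finite_field dual_orb"
  assumes k: "k \<ge> 1" and m: "m \<ge> 1"
  shows "partial_orb k f1 (p_dual m \<phi>) = (if k = m * dual_size \<phi> then Const ((-1) ^ (k - 1)) else 0)"
proof -
  define n where "n = m * dual_size \<phi>"
  have n: "n > 0" using dual_size_pos[of \<phi>] m by (simp add: n_def)
  obtain \<xi> where \<xi>: "\<xi> \<in> characters n" "p_dual m \<phi> = char_gen n \<xi>"
    using p_dual_eq_char_gen[of m \<phi>] m unfolding n_def by auto
  note lin = derivation_linear[OF derivation_partial_deriv]
  have "partial_deriv (f1, k - 1) (unit_gen n x) = (if x = 1 \<and> k = n then 1 else 0)"
    if "x \<in> units_level n" for x :: "'a alg_closure"
  proof (cases "x = 1")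
    case True
    then show ?thesis
      using k n by (auto simp: unit_gen_def partial_deriv_Var orb_size_f1 simp flip: f1_eq)
  next
    case False
    have "x \<noteq> 0" using that by (simp add: units_level_def)
    then have "f1 \<noteq> unit_orb x" using False unit_orb_eq_f1_iff[of x] by metis
    then show ?thesis using False by (simp add: unit_gen_def partial_deriv_Var)
  qed
  then have "partial_deriv (f1, k - 1) (to_orb_gens (char_gen n \<xi>)) =
      Const ((-1) ^ (n - 1)) * (\<Sum>x\<in>units_level n. Const (\<xi> x) * (if x = 1 \<and> k = n then 1 else 0))"
    by (simp add: to_orb_gens_char_gen[OF n \<xi>(1)] linear_op_scale[OF lin] linear_op_sum[OF lin])
  also have "(\<Sum>x\<in>units_level n. Const (\<xi> x) * (if x = 1 \<and> k = n then 1 else 0)) =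
      (\<Sum>x\<in>(units_level n :: 'a alg_closure set). if x = 1 then (if k = n then 1 else 0) else 0)"
    by (intro sum.cong refl) (auto simp: character_one[OF \<xi>(1)])
  also have "\<dots> = (if k = n then 1 else 0)"
    by (simp add: one_in_units_level finite_units_level[OF n])
  finally show ?thesis
    by (simp add: partial_orb_eq \<xi>(2) alg_hom_Const[OF from_orb_gens_hom]
        linear_op_0[OF alg_hom_linear[OF from_orb_gens_hom]] flip: n_def)
qed

lemma partial_dual_p_orb_f1:
  fixes \<phi> :: "'a::finite_field dual_orb"
  assumes k: "k \<ge> 1" and n: "n \<ge> 1"
  shows "partial_dual k \<phi> (p_orb n f1) =
    (if n = dual_size \<phi> * k
     then Const ((-1) ^ (n - 1) / (of_nat CARD('a) ^ n - 1) * of_nat (dual_size \<phi>)) else 0)"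
proof -
  have n0: "n > 0" using n by simp
  note lin = derivation_linear[OF derivation_partial_dual]
  have "p_orb n f1 = Const ((-1) ^ (n - 1) / (of_nat CARD('a) ^ n - 1)) *
      (\<Sum>\<xi>\<in>characters n. (char_gen n \<xi> :: 'a FG))"
  proof -
    have "(\<Sum>\<xi>\<in>characters n. Const (cnj (\<xi> 1)) * char_gen n \<xi>) = (\<Sum>\<xi>\<in>characters n. (char_gen n \<xi> :: 'a FG))"
      by (intro sum.cong refl) (simp add: character_one)
    then show ?thesis
      using p_orb_unit_orb[OF n0 one_in_units_level, where 'a = 'a]
      by (simp add: orb_size_f1 flip: f1_eq)
  qed
  then have "partial_dual k \<phi> (p_orb n f1) = Const ((-1) ^ (n - 1) / (of_nat CARD('a) ^ n - 1)) *
      (\<Sum>\<xi>\<in>characters n. partial_dual k \<phi> (char_gen n \<xi>))"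
    by (simp add: linear_op_scale[OF lin] linear_op_sum[OF lin])
  also have "(\<Sum>\<xi>\<in>characters n. partial_dual k \<phi> (char_gen n \<xi>)) =
      (\<Sum>\<xi>\<in>characters n. if char_orb n \<xi> = \<phi> \<and> n = dual_size \<phi> * k then 1 else 0)"
  proof (intro sum.cong refl)
    fix \<xi> :: "'a alg_closure \<Rightarrow> complex" assume \<xi>: "\<xi> \<in> characters n"
    define \<psi> where "\<psi> = char_orb n \<xi>"
    have d: "dual_size \<psi> > 0" "dual_size \<psi> dvd n"
      unfolding \<psi>_def using dual_size_char_orb_pos[OF n0 \<xi>] dual_size_char_orb_dvd[OF n0 \<xi>] by auto
    then obtain l where l: "n = dual_size \<psi> * l" by blast
    then have "l \<ge> 1" using n0 by (cases l) auto
    moreover have "char_gen n \<xi> = p_dual l \<psi>"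
      unfolding char_gen_def \<psi>_def[symmetric] using d(1) l by simp
    ultimately have "partial_dual k \<phi> (char_gen n \<xi>) = (if \<phi> = \<psi> \<and> k = l then 1 else 0)"
      using k by (simp add: partial_dual_p_dual)
    moreover have "\<phi> = \<psi> \<and> k = l \<longleftrightarrow> \<psi> = \<phi> \<and> n = dual_size \<phi> * k"
      using d(1) l by auto
    ultimately show "partial_dual k \<phi> (char_gen n \<xi>) = (if char_orb n \<xi> = \<phi> \<and> n = dual_size \<phi> * k then 1 else 0)"
      by (simp add: \<psi>_def)
  qed
  also have "\<dots> = (if n = dual_size \<phi> * k then of_nat (dual_size \<phi>) else 0)"
  proof (cases "n = dual_size \<phi> * k")
    case True
    have "(\<Sum>\<xi>\<in>characters n. if char_orb n \<xi> = \<phi> then 1 else 0 :: 'a FG) =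
        of_nat (card {\<xi> \<in> characters n. char_orb n \<xi> = \<phi>})"
      by (simp add: finite_characters[OF n0] sum.If_cases Int_def)
    then show ?thesis
      using True card_char_orb[OF n0, of \<phi>] by simp
  qed simp
  finally show ?thesis
    by (auto simp only: Const_mult Const_of_nat mult_zero_right split: if_split)
qed

section \<open>The operators of the theorem\<close>

definition S_creation :: "'a::finite_field dual_orb \<Rightarrow> nat \<Rightarrow> 'a FG" where
  "S_creation \<phi> k = Const (1 / of_nat k) * p_dual k \<phi>"

definition S_annihilation :: "'a::finite_field dual_orb \<Rightarrow> nat \<Rightarrow> 'a FG \<Rightarrow> 'a FG" where
  "S_annihilation \<phi> k F = - partial_dual k \<phi> F"

definition Q_creation :: "nat \<Rightarrow> 'a::finite_field FG" where
  "Q_creation k = - (Const ((1 - 1 / of_nat CARD('a) ^ k) / of_nat k) * p_orb k f1)"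

definition Q_annihilation :: "nat \<Rightarrow> 'a::finite_field FG \<Rightarrow> 'a FG" where
  "Q_annihilation k = partial_orb k f1"

lemma Var_eq_p_dual: "Var (\<phi>, n) = p_dual (Suc n) \<phi>"
  by (simp add: p_dual_def)

lemma S_annihilation_p_dual:
  "k \<ge> 1 \<Longrightarrow> m \<ge> 1 \<Longrightarrow> S_annihilation \<phi> k (p_dual m \<psi>) = (if \<phi> = \<psi> \<and> k = m then Const (-1) else 0)"
  by (simp add: S_annihilation_def partial_dual_p_dual Const_uminus)

lemma derivation_S_annihilation: "derivation (S_annihilation \<phi> k)"
  unfolding S_annihilation_def[abs_def] by (rule derivation_uminus[OF derivation_partial_dual])

lemma derivation_Q_annihilation: "derivation (Q_annihilation k)"
  unfolding Q_annihilation_def by (rule derivation_partial_orb)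

text \<open>The generators with index \<open>0\<close> and with index \<open>1\<close> are the same variable.\<close>

lemma annihilation_0:
  "S_annihilation \<phi> 0 = S_annihilation \<phi> 1" "Q_annihilation 0 = Q_annihilation 1"
  by (simp_all add: fun_eq_iff S_annihilation_def Q_annihilation_def partial_dual_def partial_orb_def)

lemma annihilation_Var_Const:
  "\<exists>c. S_annihilation \<phi> k (Var v) = Const c" "\<exists>c. Q_annihilation k (Var v) = Const c"
proof -
  obtain \<psi> n where v: "v = (\<psi>, n)" by (cases v)
  define k' where "k' = max k 1"
  have k': "k' \<ge> 1" "S_annihilation \<phi> k = S_annihilation \<phi> k'" "Q_annihilation k = Q_annihilation k'"
    by (cases k; simp add: k'_def annihilation_0)+
  show "\<exists>c. S_annihilation \<phi> k (Var v) = Const c"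
    using k'(1) by (auto simp: v k'(2) Var_eq_p_dual S_annihilation_p_dual intro: exI[of _ 0])
  show "\<exists>c. Q_annihilation k (Var v) = Const c"
    using k'(1) unfolding k'(3)
    by (auto simp: v Var_eq_p_dual Q_annihilation_def partial_orb_f1_p_dual intro: exI[of _ 0])
qed

lemma derivations_commute_if_constant:
  assumes "derivation \<delta>" "derivation \<epsilon>" "\<And>v. \<exists>c. \<delta> (Var v) = Const c" "\<And>v. \<exists>c. \<epsilon> (Var v) = Const c"
  shows "\<delta> (\<epsilon> F) = \<epsilon> (\<delta> F)"
proof (rule derivations_commute[OF assms(1,2)])
  fix v
  show "\<delta> (\<epsilon> (Var v)) = \<epsilon> (\<delta> (Var v))"
    using assms(3)[of v] assms(4)[of v] derivation_Const[OF assms(1)] derivation_Const[OF assms(2)] by auto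
qed

lemma vertex_operator_S: "vertex_operator (S_annihilation \<phi>)"
proof
  show "S_annihilation \<phi> k (S_annihilation \<phi> l F) = S_annihilation \<phi> l (S_annihilation \<phi> k F)" for k l F
    by (intro derivations_commute_if_constant derivation_S_annihilation annihilation_Var_Const)
  show "\<exists>w c. \<forall>k\<ge>1. S_annihilation \<phi> k (Var v) = (if k = w then Const c else 0)" for v
  proof (cases v)
    case (Pair \<psi> n)
    show ?thesis
      by (rule exI[of _ "Suc n"], rule exI[of _ "if \<phi> = \<psi> then -1 else 0"])
        (simp add: Pair Var_eq_p_dual S_annihilation_p_dual)
  qed
qed (rule derivation_S_annihilation)

lemma vertex_operator_Q: "vertex_operator (Q_annihilation :: nat \<Rightarrow> 'a::finite_field FG \<Rightarrow> 'a FG)"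
proof
  show "Q_annihilation k (Q_annihilation l F) = Q_annihilation l (Q_annihilation k F)" for k l and F :: "'a FG"
    by (intro derivations_commute_if_constant derivation_Q_annihilation annihilation_Var_Const)
  show "\<exists>w c. \<forall>k\<ge>1. Q_annihilation k (Var v :: 'a FG) = (if k = w then Const c else 0)" for v
  proof (cases v)
    case (Pair \<psi> n)
    let ?w = "Suc n * dual_size \<psi>"
    show ?thesis
      by (rule exI[of _ ?w], rule exI[of _ "(-1) ^ (?w - 1)"])
        (simp add: Pair Var_eq_p_dual Q_annihilation_def partial_orb_f1_p_dual)
  qed
qed (rule derivation_Q_annihilation)

text \<open>With \<open>d = \<bar>\<phi>\<bar>\<close>, the generators \<open>p\<^sub>k(\<phi>)\<close> and \<open>p\<^sub>n(f\<^sub>1)\<close> interact only if \<open>n = d k\<close>. The \<open>d\<close> characters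
  in \<open>\<phi>\<close> cancel the \<open>d\<close> in \<open>1 / n = 1 / (d k)\<close>, and \<open>1 - q ^ (- n)\<close> cancels the denominator \<open>q ^ n - 1\<close> of \<open>p\<^sub>n(f\<^sub>1)\<close>
  up to \<open>q ^ (- n) = (q ^ d) ^ (- k)\<close>.\<close>

lemma vertex_pair:
  fixes \<phi> :: "'a::finite_field dual_orb"
  shows "vertex_pair (S_creation \<phi>) (S_annihilation \<phi>) Q_creation Q_annihilation
    (dual_size \<phi>) ((-1) ^ dual_size \<phi>) (of_nat CARD('a) ^ dual_size \<phi>)"
proof -
  let ?d = "dual_size \<phi>" and ?q = "of_nat CARD('a) :: complex"
  interpret S: vertex_operator "S_creation \<phi>" "S_annihilation \<phi>" by (rule vertex_operator_S)
  interpret Q: vertex_operator Q_creation "Q_annihilation :: nat \<Rightarrow> 'a FG \<Rightarrow> 'a FG" by (rule vertex_operator_Q)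
  have q: "?q \<noteq> 0" using CARD_finite_field_gt_1[where 'a = 'a] by simp
  show ?thesis
  proof
    show "?d > 0" by (rule dual_size_pos)
    show "(-1) ^ ?d * (-1) ^ ?d = (1 :: complex)" by (simp flip: power_mult_distrib)
    show "?q ^ ?d \<noteq> 0" using q by simp
  next
    fix k n :: nat assume k: "k \<ge> 1" and n: "n \<ge> 1"
    have sgn: "(-1) ^ n = - ((-1) ^ (n - 1) :: complex)" using n by (cases n) auto
    show "S_annihilation \<phi> k (Q_creation n) =
        (if n = ?d * k then Const (- (((-1) ^ ?d / ?q ^ ?d) ^ k / of_nat k)) else 0)"
    proof (cases "n = ?d * k")
      case True
      let ?m = "?q ^ n - 1"
      have m: "?m \<noteq> 0" using n by (intro CARD_power_minus_1) auto
      have d: "of_nat ?d \<noteq> (0 :: complex)" "of_nat k \<noteq> (0 :: complex)" using dual_size_pos[of \<phi>] k by auto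
      have "S_annihilation \<phi> k (Q_creation n) =
          Const ((1 - 1 / ?q ^ n) / of_nat n * ((-1) ^ (n - 1) / ?m * of_nat ?d))"
      proof -
        have "partial_dual k \<phi> (p_orb n f1) = Const ((-1) ^ (n - 1) / ?m * of_nat ?d)"
          using True k n by (simp add: partial_dual_p_orb_f1)
        then show ?thesis
          unfolding S_annihilation_def Q_creation_def linear_op_uminus[OF derivation_linear[OF derivation_partial_dual]]
            linear_op_scale[OF derivation_linear[OF derivation_partial_dual]]
          by (simp only: Const_mult minus_minus)
      qed
      also have "(1 - 1 / ?q ^ n) / of_nat n * ((-1) ^ (n - 1) / ?m * of_nat ?d) =
          (?m / ?q ^ n) / (of_nat ?d * of_nat k) * ((-1) ^ (n - 1) / ?m * of_nat ?d)"
        using q by (simp add: True diff_divide_distrib)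
      also have "\<dots> = (-1) ^ (n - 1) / ?q ^ n / of_nat k"
        using m d by simp
      also have "\<dots> = - ((-1) ^ n / ?q ^ n / of_nat k)" by (simp add: sgn)
      also have "\<dots> = - (((-1) ^ ?d / ?q ^ ?d) ^ k / of_nat k)"
        by (simp add: True power_mult power_divide)
      finally show ?thesis using True by simp
    next
      case False
      then show ?thesis
        using k n
        by (simp add: S_annihilation_def Q_creation_def linear_op_uminus[OF derivation_linear[OF derivation_partial_dual]]
            linear_op_scale[OF derivation_linear[OF derivation_partial_dual]] partial_dual_p_orb_f1)
    qed
    show "Q_annihilation n (S_creation \<phi> k) =
        (if n = ?d * k then Const (- (((-1) ^ ?d) ^ k / of_nat k)) else 0)"
      using k n sgn
      by (auto simp: Q_annihilation_def S_creation_def linear_op_scale[OF derivation_linear[OF derivation_partial_orb]]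
          partial_orb_f1_p_dual mult.commute[of k] simp flip: Const_mult power_mult)
  next
    show "S_annihilation \<phi> k (Q_annihilation n F) = Q_annihilation n (S_annihilation \<phi> k F)" for k n F
      by (intro derivations_commute_if_constant derivation_S_annihilation derivation_Q_annihilation
          annihilation_Var_Const)
  qed
qed

lemma S_op_eq_vop: "S_op n \<phi> = vertex_operator.vop (S_creation \<phi>) (S_annihilation \<phi>) n"
  unfolding S_op_def vertex_operator.vop_def[OF vertex_operator_S]
  by (simp add: S_creation_def S_annihilation_def[abs_def])

lemma Q_op_eq_vop:
  "(Q_op n :: 'a::finite_field FG \<Rightarrow> 'a FG) = vertex_operator.vop Q_creation Q_annihilation (- n)"
proof -
  have "(\<lambda>k F. - (Const ((1 - 1 / of_nat CARD('a) ^ k) / of_nat k) * p_orb k f1 * F)) =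
      (\<lambda>k F. Q_creation k * F :: 'a FG)"
    by (simp add: fun_eq_iff Q_creation_def)
  then show ?thesis
    unfolding Q_op_def vertex_operator.vop_def[OF vertex_operator_Q]
    by (simp add: Q_annihilation_def[abs_def])
qed

lemma S_op_linear: "linear_op (S_op n \<phi>)"
  unfolding S_op_eq_vop by (rule vertex_operator.vop_linear[OF vertex_operator_S])

text \<open>If the coefficients of the annihilation half of color \<open>\<phi>\<close> vanish on \<open>F\<close> beyond \<open>r\<close>, then \<open>S_op n \<phi> F = 0\<close> for
  \<open>n < - r\<close>. This is what makes the sums in the theorem finite.\<close>

definition annihilation_bound :: "'a::finite_field dual_orb \<Rightarrow> int \<Rightarrow> 'a FG \<Rightarrow> bool" where
  "annihilation_bound \<phi> r F \<longleftrightarrow> (\<forall>j>r. exp_coeffZ (S_annihilation \<phi>) j F = 0)"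

lemma annihilation_bound_1: "annihilation_bound \<phi> 0 1"
proof -
  interpret vertex_operator "S_creation \<phi>" "S_annihilation \<phi>" by (rule vertex_operator_S)
  show ?thesis using exp_coeffZ_Const[of _ 1] by (simp add: annihilation_bound_def)
qed

lemma S_annihilation_S_creation:
  assumes "k \<ge> 1"
  shows "S_annihilation \<phi> k (exp_poly (S_creation \<psi>) i) =
    Const (if \<phi> = \<psi> then - (1 / of_nat k) else 0) * exp_poly (S_creation \<psi>) (i - int k)"
  using assms
  by (intro derivation_exp_poly derivation_S_annihilation)
    (auto simp: S_creation_def linear_op_scale[OF derivation_linear[OF derivation_S_annihilation]]
      S_annihilation_p_dual simp flip: Const_mult)

text \<open>For equal colors the annihilation half passes the creation half with the factor \<open>1 - w / w'\<close>,
  where \<open>w'\<close> is the variable of the annihilation half and \<open>w\<close> that of \<open>S\<close>.\<close>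

lemma annihilation_S_op:
  fixes \<phi> \<psi> :: "'a::finite_field dual_orb"
  defines "c \<equiv> if \<phi> = \<psi> then 1 else 0"
  shows "exp_coeffZ (S_annihilation \<phi>) j (S_op n \<psi> F) = S_op n \<psi> (exp_coeffZ (S_annihilation \<phi>) j F) -
    Const c * S_op (n - 1) \<psi> (exp_coeffZ (S_annihilation \<phi>) (j - 1) F)"
proof -
  interpret A: vertex_operator "S_creation \<phi>" "S_annihilation \<phi>" by (rule vertex_operator_S)
  interpret B: vertex_operator "S_creation \<psi>" "S_annihilation \<psi>" by (rule vertex_operator_S)
  let ?h = "exp_poly (S_creation \<psi>)"
  have "S_annihilation \<phi> k (?h i * F) = ?h i * S_annihilation \<phi> k F -
      Const (c ^ k / of_nat k) * (?h (i - int k) * F)" if "k \<ge> 1" for k i and F :: "'a FG"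
    using that
    by (simp add: derivation_mult[OF derivation_S_annihilation] S_annihilation_S_creation c_def
        power_0_left Const_uminus algebra_simps)
  then have "exp_coeffZ (S_annihilation \<phi>) j (?h i * F) = ?h i * exp_coeffZ (S_annihilation \<phi>) j F -
      Const c * (?h (i - 1) * exp_coeffZ (S_annihilation \<phi>) (j - 1) F)" for j i and F :: "'a FG"
    using A.exp_commutation[of 1 "\<lambda>i F. ?h i * F" c 1 j i F] by (simp add: linear_op_mult)
  moreover have "exp_coeffZ (S_annihilation \<phi>) j (exp_coeffZ (S_annihilation \<psi>) i F) =
      exp_coeffZ (S_annihilation \<psi>) i (exp_coeffZ (S_annihilation \<phi>) j F)" for i j and F :: "'a FG"
    by (rule exp_coeffZ_commute[OF A.commuting_ops_axioms B.commuting_ops_axioms])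
      (intro derivations_commute_if_constant derivation_S_annihilation annihilation_Var_Const)
  ultimately show ?thesis
    unfolding S_op_eq_vop using B.vop_exchange[of "exp_coeffZ (S_annihilation \<phi>)" c 1 1 j n F] A.exp_coeffZ_linear
    by simp
qed

text \<open>The two terms of the factor \<open>1 - w / w'\<close> raise the bound by one.\<close>

lemma annihilation_bound_S_op:
  assumes "annihilation_bound \<phi> r F"
  shows "annihilation_bound \<phi> (r + 1) (S_op n \<phi> F)"
  using assms by (simp add: annihilation_bound_def annihilation_S_op linear_op_0[OF S_op_linear])

lemma annihilation_bound_S_op_other:
  assumes "annihilation_bound \<phi> r F" "\<phi> \<noteq> \<psi>"
  shows "annihilation_bound \<phi> r (S_op n \<psi> F)"
  using assms by (simp add: annihilation_bound_def annihilation_S_op linear_op_0[OF S_op_linear])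

lemma S_op_commute:
  assumes "\<phi> \<noteq> \<psi>"
  shows "S_op m \<phi> (S_op n \<psi> F) = S_op n \<psi> (S_op m \<phi> F)"
proof -
  interpret A: vertex_operator "S_creation \<phi>" "S_annihilation \<phi>" by (rule vertex_operator_S)
  interpret B: vertex_operator "S_creation \<psi>" "S_annihilation \<psi>" by (rule vertex_operator_S)
  let ?h = "exp_poly (S_creation \<psi>)"
  have "exp_coeffZ (S_annihilation \<phi>) j (?h i * F) = ?h i * exp_coeffZ (S_annihilation \<phi>) j F" for i j F
  proof (rule exp_coeffZ_commute_op[OF A.commuting_ops_axioms linear_op_mult])
    show "S_annihilation \<phi> k (?h i * F) = ?h i * S_annihilation \<phi> k F" if "k \<ge> 1" for k F
      using that assms
      by (simp add: derivation_mult[OF derivation_S_annihilation] S_annihilation_S_creation)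
  qed
  then have "S_op m \<phi> (?h i * F) = ?h i * S_op m \<phi> F" for i F
    unfolding S_op_eq_vop A.vop_eq
    by (simp add: Sum_any_right_distrib A.finite_support_mult mult.left_commute)
  moreover have "S_op m \<phi> (exp_coeffZ (S_annihilation \<psi>) j F) = exp_coeffZ (S_annihilation \<psi>) j (S_op m \<phi> F)" for j F
    using annihilation_S_op[of \<psi> j m \<phi> F] assms by simp
  ultimately show ?thesis
    using B.vop_exchange[of "\<lambda>_. S_op m \<phi>" 0 0 0 0 n F] A.vop_linear
    by (simp add: S_op_eq_vop)
qed

subsection \<open>Products of operators of one color\<close>

lemma S_seq_simps [simp]: "S_seq [] \<phi> F = F" "S_seq (n # \<alpha>) \<phi> F = S_op n \<phi> (S_seq \<alpha> \<phi> F)"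
  by (simp_all add: S_seq_def)

lemma S_seq_linear: "linear_op (S_seq \<alpha> \<phi>)"
  by (induction \<alpha>)
    (auto simp: linear_op_def linear_op_add[OF S_op_linear] linear_op_scale[OF S_op_linear])

lemma annihilation_bound_S_seq:
  assumes "annihilation_bound \<phi> r F"
  shows "annihilation_bound \<phi> (r + int (length \<alpha>)) (S_seq \<alpha> \<phi> F)"
proof (induction \<alpha>)
  case (Cons n \<alpha>)
  then show ?case using annihilation_bound_S_op[OF Cons.IH, of n] by (simp add: add_ac)
qed (use assms in simp)

lemma annihilation_bound_S_seq_other:
  "annihilation_bound \<phi> r F \<Longrightarrow> \<phi> \<noteq> \<psi> \<Longrightarrow> annihilation_bound \<phi> r (S_seq \<alpha> \<psi> F)"
  by (induction \<alpha>) (auto intro: annihilation_bound_S_op_other)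

lemma S_op_S_seq_commute: "\<phi> \<noteq> \<psi> \<Longrightarrow> S_op m \<phi> (S_seq \<beta> \<psi> F) = S_seq \<beta> \<psi> (S_op m \<phi> F)"
  by (induction \<beta>) (simp_all add: S_op_commute)

lemma S_seq_commute: "\<phi> \<noteq> \<psi> \<Longrightarrow> S_seq \<alpha> \<phi> (S_seq \<beta> \<psi> F) = S_seq \<beta> \<psi> (S_seq \<alpha> \<phi> F)"
  by (induction \<alpha>) (simp_all add: S_op_S_seq_commute)

lemma Q_op_S_op:
  fixes \<phi> :: "'a::finite_field dual_orb"
  assumes "annihilation_bound \<phi> r F" "int L > n + r" "L \<ge> 1"
  shows "Q_op k (S_op n \<phi> F) =
    (\<Sum>t=1..L. Const (A_factor (of_nat CARD('a) ^ dual_size \<phi>) t * (-1) ^ (dual_size \<phi> * t)) *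
       S_op (n - int t) \<phi> (Q_op (k - int (dual_size \<phi> * t)) F))"
proof -
  interpret vertex_pair "S_creation \<phi>" "S_annihilation \<phi>" Q_creation Q_annihilation
    "dual_size \<phi>" "(-1) ^ dual_size \<phi>" "of_nat CARD('a) ^ dual_size \<phi>" by (rule vertex_pair)
  show ?thesis
    using Q_S_exchange[of r F n L "- k"] assms
    by (simp add: annihilation_bound_def S_op_eq_vop Q_op_eq_vop power_mult)
qed

definition color_compositions :: "nat list \<Rightarrow> nat list set" where
  "color_compositions lam = {\<tau>. length \<tau> = length lam \<and>
     (\<forall>i<length \<tau>. 1 \<le> \<tau> ! i \<and> \<tau> ! i \<le> underline lam ! i)}"

lemma underline_Cons: "underline (n # lam) = (n + length lam + 1) # underline lam"
  by (rule nth_equalityI) (auto simp: underline_def nth_Cons' simp del: upt_Suc)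

lemma color_compositions_Nil: "color_compositions [] = {[]}"
  by (auto simp: color_compositions_def)

lemma color_compositions_Cons:
  "color_compositions (n # lam) = (\<lambda>(t, \<tau>). t # \<tau>) ` ({1..n + length lam + 1} \<times> color_compositions lam)"
proof (intro Set.set_eqI iffI)
  fix \<tau> assume "\<tau> \<in> color_compositions (n # lam)"
  then show "\<tau> \<in> (\<lambda>(t, \<tau>). t # \<tau>) ` ({1..n + length lam + 1} \<times> color_compositions lam)"
    by (cases \<tau>) (auto simp: color_compositions_def underline_Cons All_less_Suc2 image_iff)
qed (auto simp: color_compositions_def underline_Cons nth_Cons')

definition color_coeff :: "'a::finite_field dual_orb \<Rightarrow> nat list \<Rightarrow> complex" where
  "color_coeff \<phi> \<tau> = (\<Prod>i<length \<tau>. A_factor (of_nat CARD('a) ^ dual_size \<phi>) (\<tau> ! i))"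

lemma color_coeff_Cons:
  fixes \<phi> :: "'a::finite_field dual_orb"
  shows "color_coeff \<phi> (t # \<tau>) = A_factor (of_nat CARD('a) ^ dual_size \<phi>) t * color_coeff \<phi> \<tau>"
  by (simp add: color_coeff_def prod.lessThan_Suc_shift del: prod.lessThan_Suc)

text \<open>The operators are passed from left to right. The one at position \<open>i\<close> still has \<open>l - 1 - i\<close> operators of its color on
  its right, each of which raises the annihilation bound by one; hence \<open>\<tau>\<^sub>i\<close> runs up to \<open>\<lambda>\<^sub>i + (l - i)\<close>, which is
  part \<open>i\<close> of \<open>underline \<lambda>\<close>.\<close>

lemma Q_op_S_seq:
  fixes \<phi> :: "'a::finite_field dual_orb"
  assumes F: "annihilation_bound \<phi> 0 F"
  shows "Q_op k (S_seq (map int lam) \<phi> F) =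
    (\<Sum>\<tau>\<in>color_compositions lam. Const (color_coeff \<phi> \<tau> * (-1) ^ (dual_size \<phi> * sum_list \<tau>)) *
       S_seq (list_diff lam \<tau>) \<phi> (Q_op (k - int (dual_size \<phi> * sum_list \<tau>)) F))"
proof (induction lam arbitrary: k)
  case Nil
  show ?case by (simp add: color_compositions_Nil color_coeff_def list_diff_def)
next
  case (Cons n lam)
  let ?d = "dual_size \<phi>" and ?A = "A_factor (of_nat CARD('a) ^ dual_size \<phi>)"
  let ?L = "n + length lam + 1"
  let ?term = "\<lambda>\<tau>. Const (color_coeff \<phi> \<tau> * (-1) ^ (?d * sum_list \<tau>)) *
       S_seq (list_diff (n # lam) \<tau>) \<phi> (Q_op (k - int (?d * sum_list \<tau>)) F)"
  have bound: "annihilation_bound \<phi> (int (length lam)) (S_seq (map int lam) \<phi> F)"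
    using annihilation_bound_S_seq[OF F, of "map int lam"] by simp
  have "Q_op k (S_seq (map int (n # lam)) \<phi> F) =
      (\<Sum>t=1..?L. Const (?A t * (-1) ^ (?d * t)) *
        S_op (int n - int t) \<phi> (Q_op (k - int (?d * t)) (S_seq (map int lam) \<phi> F)))"
    using Q_op_S_op[OF bound, of "int n" ?L k] by simp
  also have "\<dots> = (\<Sum>t=1..?L. \<Sum>\<tau>\<in>color_compositions lam. ?term (t # \<tau>))"
  proof (intro sum.cong refl)
    fix t
    have "Const (?A t * (-1) ^ (?d * t)) * (Const (color_coeff \<phi> \<tau> * (-1) ^ (?d * sum_list \<tau>)) *
        S_op (int n - int t) \<phi> (S_seq (list_diff lam \<tau>) \<phi> (Q_op (k - int (?d * t) - int (?d * sum_list \<tau>)) F))) =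
        ?term (t # \<tau>)" for \<tau>
      by (simp add: Const_mult_assoc color_coeff_Cons list_diff_def algebra_simps power_add)
    then show "Const (?A t * (-1) ^ (?d * t)) *
        S_op (int n - int t) \<phi> (Q_op (k - int (?d * t)) (S_seq (map int lam) \<phi> F)) =
        (\<Sum>\<tau>\<in>color_compositions lam. ?term (t # \<tau>))"
      unfolding Cons.IH linear_op_sum[OF S_op_linear] linear_op_scale[OF S_op_linear] sum_distrib_left
      by (intro sum.cong refl)
  qed
  also have "\<dots> = (\<Sum>(t, \<tau>)\<in>{1..?L} \<times> color_compositions lam. ?term (t # \<tau>))"
    by (rule sum.cartesian_product)
  also have "\<dots> = (\<Sum>\<tau>\<in>color_compositions (n # lam). ?term \<tau>)"
    unfolding color_compositions_Cons by (subst sum.reindex) (auto simp: inj_on_def case_prod_unfold)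
  finally show ?case .
qed

subsection \<open>Products over the colors\<close>

lemma comp_fun_commute_S_seq: "comp_fun_commute_on UNIV (\<lambda>\<phi> T. S_seq (\<alpha> \<phi>) \<phi> \<circ> T)"
proof
  fix \<phi> \<psi> :: "'a dual_orb"
  show "(\<lambda>T. S_seq (\<alpha> \<psi>) \<psi> \<circ> T) \<circ> (\<lambda>T. S_seq (\<alpha> \<phi>) \<phi> \<circ> T) =
      (\<lambda>T. S_seq (\<alpha> \<phi>) \<phi> \<circ> T) \<circ> (\<lambda>T. S_seq (\<alpha> \<psi>) \<psi> \<circ> T)"
    by (cases "\<phi> = \<psi>") (auto simp: fun_eq_iff S_seq_commute)
qed

lemma S_colored_split:
  assumes "finite {\<psi>. \<alpha> \<psi> \<noteq> []}"
  shows "S_colored \<alpha> F = S_seq (\<alpha> \<phi>) \<phi> (S_colored (\<alpha>(\<phi> := [])) F)"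
proof (cases "\<alpha> \<phi> = []")
  case True
  then have "\<alpha>(\<phi> := []) = \<alpha>" by auto
  then show ?thesis using True by simp
next
  case False
  let ?\<beta> = "\<alpha>(\<phi> := [])" and ?A = "{\<psi>. (\<alpha>(\<phi> := [])) \<psi> \<noteq> []}"
  have A: "{\<psi>. \<alpha> \<psi> \<noteq> []} = insert \<phi> ?A" "\<phi> \<notin> ?A" "finite ?A"
    using False assms by (auto intro: finite_subset[OF _ assms])
  interpret comp_fun_commute_on UNIV "\<lambda>\<phi> T. S_seq (\<alpha> \<phi>) \<phi> \<circ> T" by (rule comp_fun_commute_S_seq)
  have "Finite_Set.fold (\<lambda>\<phi> T. S_seq (\<alpha> \<phi>) \<phi> \<circ> T) id ?A = Finite_Set.fold (\<lambda>\<phi> T. S_seq (?\<beta> \<phi>) \<phi> \<circ> T) id ?A"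
    by (rule Finite_Set.fold_cong[OF comp_fun_commute_S_seq comp_fun_commute_S_seq _ A(3)]) auto
  then show ?thesis
    unfolding S_colored_def A(1) using A by (subst fold_insert) auto
qed

lemma support_remove:
  assumes "insert \<phi> A = {\<psi>. \<alpha> \<psi> \<noteq> []}" "\<phi> \<notin> A"
  shows "A = {\<psi>. (\<alpha>(\<phi> := [])) \<psi> \<noteq> []}"
proof -
  have "{\<psi>. (\<alpha>(\<phi> := [])) \<psi> \<noteq> []} = insert \<phi> A - {\<phi>}" unfolding assms(1) by auto
  also have "\<dots> = A" using assms(2) by simp
  finally show ?thesis by (rule sym)
qed

lemma S_colored_empty: "S_colored (\<lambda>_. []) F = F"
  by (simp add: S_colored_def)

lemma annihilation_bound_S_colored:
  assumes "finite {\<psi>. \<alpha> \<psi> \<noteq> []}" "\<alpha> \<phi> = []"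
  shows "annihilation_bound \<phi> 0 (S_colored \<alpha> 1)"
  using assms
proof (induction "{\<psi>. \<alpha> \<psi> \<noteq> []}" arbitrary: \<alpha> rule: finite_induct)
  case empty
  then have "\<alpha> = (\<lambda>_. [])" by auto
  then show ?case by (simp add: S_colored_empty annihilation_bound_1)
next
  case (insert \<psi> A)
  have fin: "finite {\<chi>. \<alpha> \<chi> \<noteq> []}"
    unfolding insert.hyps(4)[symmetric] using insert.hyps(1) by simp
  have "\<phi> \<noteq> \<psi>"
    using insert.hyps(4) insert.prems by blast
  moreover have "annihilation_bound \<phi> 0 (S_colored (\<alpha>(\<psi> := [])) 1)"
    by (rule insert.hyps(3)[OF support_remove[OF insert.hyps(4,2)]]) (simp add: insert.prems)
  ultimately show ?case
    by (simp add: S_colored_split[OF fin, of _ \<psi>] annihilation_bound_S_seq_other)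
qed

lemma sum_sub_compositions_split:
  "(\<Sum>\<tau>\<in>sub_compositions lam. G \<tau>) =
    (\<Sum>\<tau>\<in>color_compositions (lam \<phi>). \<Sum>\<tau>'\<in>sub_compositions (lam(\<phi> := [])). G (\<tau>'(\<phi> := \<tau>)))"
proof -
  have "(\<Sum>\<tau>\<in>sub_compositions lam. G \<tau>) =
      (\<Sum>(\<tau>, \<tau>')\<in>color_compositions (lam \<phi>) \<times> sub_compositions (lam(\<phi> := [])). G (\<tau>'(\<phi> := \<tau>)))"
  proof (rule sum.reindex_bij_witness[where i = "\<lambda>(\<tau>, \<tau>'). \<tau>'(\<phi> := \<tau>)" and j = "\<lambda>\<tau>. (\<tau> \<phi>, \<tau>(\<phi> := []))"])
    fix p assume p: "p \<in> color_compositions (lam \<phi>) \<times> sub_compositions (lam(\<phi> := []))"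
    obtain \<tau> \<tau>' where [simp]: "p = (\<tau>, \<tau>')" by (cases p)
    have "\<tau>' \<phi> = []" using p by (auto simp: sub_compositions_def dest: spec[of _ \<phi>])
    then show "((case p of (\<tau>, \<tau>') \<Rightarrow> \<tau>'(\<phi> := \<tau>)) \<phi>, (case p of (\<tau>, \<tau>') \<Rightarrow> \<tau>'(\<phi> := \<tau>))(\<phi> := [])) = p"
      by (auto simp: fun_eq_iff)
    have "length (\<tau>' \<psi>) = length (lam \<psi>) \<and> (\<forall>i<length (\<tau>' \<psi>). 1 \<le> \<tau>' \<psi> ! i \<and> \<tau>' \<psi> ! i \<le> underline (lam \<psi>) ! i)"
      if "\<psi> \<noteq> \<phi>" for \<psi>
      using p that by (auto simp: sub_compositions_def dest!: spec[of _ \<psi>])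
    then show "(case p of (\<tau>, \<tau>') \<Rightarrow> \<tau>'(\<phi> := \<tau>)) \<in> sub_compositions lam"
      using p by (simp add: sub_compositions_def color_compositions_def)
  qed (auto simp: sub_compositions_def color_compositions_def)
  then show ?thesis by (simp add: sum.cartesian_product)
qed

lemma weight_update:
  assumes "finite {\<psi>. \<tau> \<psi> \<noteq> []}" "\<tau> \<phi> = []"
  shows "weight (\<tau>(\<phi> := xs)) = dual_size \<phi> * sum_list xs + weight \<tau>"
proof -
  let ?g = "\<lambda>\<psi>. dual_size \<psi> * sum_list (\<tau> \<psi>)"
  have "finite {\<psi>. ?g \<psi> \<noteq> 0}"
    by (rule finite_subset[OF _ assms(1)]) auto
  then have "Sum_any (?g(\<phi> := dual_size \<phi> * sum_list xs)) = dual_size \<phi> * sum_list xs + Sum_any ?g"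
    by (rule Sum_any.update) (simp add: assms(2))
  moreover have "(\<lambda>\<psi>. dual_size \<psi> * sum_list ((\<tau>(\<phi> := xs)) \<psi>)) = ?g(\<phi> := dual_size \<phi> * sum_list xs)"
    by auto
  ultimately show ?thesis by (simp only: weight_def)
qed

lemma A_coeff_update:
  fixes \<tau> :: "'a::finite_field dual_orb \<Rightarrow> nat list"
  assumes "finite {\<psi>. \<tau> \<psi> \<noteq> []}" "\<tau> \<phi> = []"
  shows "A_coeff (\<tau>(\<phi> := xs)) = color_coeff \<phi> xs * A_coeff \<tau>"
proof -
  let ?g = "\<lambda>\<psi>. color_coeff \<psi> (\<tau> \<psi>)"
  have A: "A_coeff \<sigma> = Prod_any (\<lambda>\<psi>. color_coeff \<psi> (\<sigma> \<psi>))" for \<sigma> :: "'a dual_orb \<Rightarrow> nat list"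
    by (simp add: A_coeff_def color_coeff_def)
  have "finite {\<psi>. ?g \<psi> \<noteq> 1}"
    by (rule finite_subset[OF _ assms(1)]) (auto simp: color_coeff_def)
  then have "Prod_any (?g(\<phi> := color_coeff \<phi> xs)) = color_coeff \<phi> xs * Prod_any ?g"
    by (rule Prod_any.update) (simp add: assms(2) color_coeff_def)
  moreover have "(\<lambda>\<psi>. color_coeff \<psi> ((\<tau>(\<phi> := xs)) \<psi>)) = ?g(\<phi> := color_coeff \<phi> xs)"
    by auto
  ultimately show ?thesis by (simp only: A)
qed

text \<open>Colors are treated one at a time: the operators of the remaining colors commute with the annihilation half
  of the color \<open>\<phi>\<close>, so they leave its bound at \<open>0\<close>.\<close>

lemma Q_op_S_colored:
  fixes lam :: "'a::finite_field dual_orb \<Rightarrow> nat list"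
  assumes "finite {\<phi>. lam \<phi> \<noteq> []}"
  shows "Q_op k (S_colored (\<lambda>\<phi>. map int (lam \<phi>)) 1) =
    (\<Sum>\<tau>\<in>sub_compositions lam. Const (A_coeff \<tau> * (-1) ^ weight \<tau>) *
       S_colored (\<lambda>\<phi>. list_diff (lam \<phi>) (\<tau> \<phi>)) (Q_op (k - int (weight \<tau>)) 1))"
  using assms
proof (induction "{\<phi>. lam \<phi> \<noteq> []}" arbitrary: lam k rule: finite_induct)
  case empty
  then have "lam = (\<lambda>_. [])" by auto
  moreover from this have "sub_compositions lam = {\<lambda>_. []}" by (auto simp: sub_compositions_def)
  ultimately show ?case
    by (simp add: S_colored_empty A_coeff_def weight_def list_diff_def)
next
  case (insert \<phi> A)
  let ?lam = "lam(\<phi> := [])" and ?d = "dual_size \<phi>"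
  have A: "A = {\<psi>. ?lam \<psi> \<noteq> []}"
    by (rule support_remove[OF insert.hyps(4,2)])
  have fin: "finite {\<psi>. lam \<psi> \<noteq> []}"
    unfolding insert.hyps(4)[symmetric] using insert.hyps(1) by simp
  define F where "F = S_colored (\<lambda>\<psi>. map int (?lam \<psi>)) 1"
  have upd: "(\<lambda>\<psi>. map int (lam \<psi>))(\<phi> := []) = (\<lambda>\<psi>. map int (?lam \<psi>))" by auto
  have bound: "annihilation_bound \<phi> 0 F"
    unfolding F_def using fin
    by (intro annihilation_bound_S_colored) (auto intro: finite_subset[OF _ fin])
  let ?term = "\<lambda>\<tau>. Const (A_coeff \<tau> * (-1) ^ weight \<tau>) *
       S_colored (\<lambda>\<psi>. list_diff (lam \<psi>) (\<tau> \<psi>)) (Q_op (k - int (weight \<tau>)) 1)"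
  have "Q_op k (S_colored (\<lambda>\<psi>. map int (lam \<psi>)) 1) = Q_op k (S_seq (map int (lam \<phi>)) \<phi> F)"
    using S_colored_split[of "\<lambda>\<psi>. map int (lam \<psi>)" 1 \<phi>] fin by (simp add: upd F_def)
  also have "\<dots> = (\<Sum>\<tau>\<in>color_compositions (lam \<phi>). Const (color_coeff \<phi> \<tau> * (-1) ^ (?d * sum_list \<tau>)) *
       S_seq (list_diff (lam \<phi>) \<tau>) \<phi> (Q_op (k - int (?d * sum_list \<tau>)) F))"
    by (rule Q_op_S_seq[OF bound])
  also have "\<dots> = (\<Sum>\<tau>\<in>color_compositions (lam \<phi>). \<Sum>\<tau>'\<in>sub_compositions ?lam. ?term (\<tau>'(\<phi> := \<tau>)))"
  proof (intro sum.cong refl)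
    fix \<tau> assume \<tau>: "\<tau> \<in> color_compositions (lam \<phi>)"
    have step: "Const (color_coeff \<phi> \<tau> * (-1) ^ (?d * sum_list \<tau>)) * (Const (A_coeff \<tau>' * (-1) ^ weight \<tau>') *
        S_seq (list_diff (lam \<phi>) \<tau>) \<phi> (S_colored (\<lambda>\<psi>. list_diff (?lam \<psi>) (\<tau>' \<psi>))
          (Q_op (k - int (?d * sum_list \<tau>) - int (weight \<tau>')) 1))) = ?term (\<tau>'(\<phi> := \<tau>))"
      if \<tau>': "\<tau>' \<in> sub_compositions ?lam" for \<tau>'
    proof -
      have len: "length (\<tau>' \<psi>) = length (?lam \<psi>)" for \<psi> using \<tau>' by (simp add: sub_compositions_def)
      then have "\<tau>' \<phi> = []" by (metis fun_upd_same length_0_conv)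
      moreover have "{\<psi>. \<tau>' \<psi> \<noteq> []} = {\<psi>. ?lam \<psi> \<noteq> []}"
        using len by (metis length_0_conv)
      then have "finite {\<psi>. \<tau>' \<psi> \<noteq> []}" using A insert.hyps(1) by simp
      ultimately have w: "weight (\<tau>'(\<phi> := \<tau>)) = ?d * sum_list \<tau> + weight \<tau>'"
        "A_coeff (\<tau>'(\<phi> := \<tau>)) = color_coeff \<phi> \<tau> * A_coeff \<tau>'"
        by (simp_all add: weight_update A_coeff_update)
      let ?\<alpha> = "\<lambda>\<psi>. list_diff (lam \<psi>) ((\<tau>'(\<phi> := \<tau>)) \<psi>)"
      have "finite {\<psi>. ?\<alpha> \<psi> \<noteq> []}"
        by (rule finite_subset[OF _ fin]) (auto simp: list_diff_def)
      moreover have "?\<alpha>(\<phi> := []) = (\<lambda>\<psi>. list_diff (?lam \<psi>) (\<tau>' \<psi>))"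
        by (auto simp: fun_eq_iff list_diff_def)
      ultimately have "S_colored ?\<alpha> G = S_seq (list_diff (lam \<phi>) \<tau>) \<phi> (S_colored (\<lambda>\<psi>. list_diff (?lam \<psi>) (\<tau>' \<psi>)) G)" for G
        using S_colored_split[of ?\<alpha> G \<phi>] by simp
      moreover have "k - int (?d * sum_list \<tau>) - int (weight \<tau>') = k - int (?d * sum_list \<tau> + weight \<tau>')"
        by simp
      moreover have "color_coeff \<phi> \<tau> * (-1) ^ (?d * sum_list \<tau>) * (A_coeff \<tau>' * (-1) ^ weight \<tau>') =
          color_coeff \<phi> \<tau> * A_coeff \<tau>' * (-1) ^ (?d * sum_list \<tau> + weight \<tau>')"
        by (simp add: power_add)
      ultimately show ?thesis by (simp only: w Const_mult_assoc)
    qed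
    have "Q_op k' F = (\<Sum>\<tau>'\<in>sub_compositions ?lam. Const (A_coeff \<tau>' * (-1) ^ weight \<tau>') *
       S_colored (\<lambda>\<psi>. list_diff (?lam \<psi>) (\<tau>' \<psi>)) (Q_op (k' - int (weight \<tau>')) 1))" for k'
      unfolding F_def by (rule insert.hyps(3)[OF A])
    then show "Const (color_coeff \<phi> \<tau> * (-1) ^ (?d * sum_list \<tau>)) *
       S_seq (list_diff (lam \<phi>) \<tau>) \<phi> (Q_op (k - int (?d * sum_list \<tau>)) F) =
       (\<Sum>\<tau>'\<in>sub_compositions ?lam. ?term (\<tau>'(\<phi> := \<tau>)))"
      by (simp only: linear_op_sum[OF S_seq_linear] linear_op_scale[OF S_seq_linear] sum_distrib_left step cong: sum.cong)
  qed
  also have "\<dots> = (\<Sum>\<tau>\<in>sub_compositions lam. ?term \<tau>)"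
    by (rule sum_sub_compositions_split[symmetric])
  finally show ?case .
qed

theorem corollary3p4:
  fixes lam :: "'a::finite_field dual_orb \<Rightarrow> nat list" and k :: nat
  assumes "colored_partition lam" and "0 < k"
  shows "Q_op (int k) (S_colored (\<lambda>\<phi>. map int (lam \<phi>)) 1) =
    (\<Sum>\<tau>\<in>sub_compositions lam. Const (A_coeff \<tau> * (-1) ^ weight \<tau>) *
       S_colored (\<lambda>\<phi>. list_diff (lam \<phi>) (\<tau> \<phi>)) (Q_op (int k - int (weight \<tau>)) 1))"
  using assms(1) by (intro Q_op_S_colored) (simp add: colored_partition_def)

end
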